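(* Let $G=(V,E)$ be a simple directed data graph, where each vertex has an out-degree at most $\lambda$. Let $P=(V_P,E_P)$ be a simple weakly-connected directed pattern graph with a constant number of vertices. Then one can build in $O(|E|)$ expected time a data structure that supports each subgraph sampling operation in $$O\left(\frac{\mathit{polymat}_{\mathit{dir}}(|E|,\lambda,P)}{\max\{1,\mathrm{OUT}\}}\right)$$ expected time, where $\mathrm{OUT}$ is the number of occurrences of $P$ in $G$ and $\mathit{polymat}_{\mathit{dir}}(|E|,\lambda,P)$ is the directed polymatroid bound of $|E|$, $\lambda$ and $P$.
   Context: **Occurrences.** A subgraph of $G=(V,E)$ is a simple directed graph $G_{\mathit{sub}}=(V_{\mathit{sub}},E_{\mathit{sub}})$ with $V_{\mathit{sub}}\subseteq V$, $E_{\mathit{sub}}\subseteq E$. It is an occurrence of $P$ if there is a bijection $f:V_{\mathit{sub}}\to V_P$ such that for all distinct $u_1,u_2\in V_{\mathit{sub}}$, $(u_1,u_2)\in E_{\mathit{sub}}$ iff $(f(u_1),f(u_2))\in E_P$. Occurrences are counted as subgraphs. **Subgraph sampling operation.** Such an operation returns an occurrence of $P$ in $G$ uniformly at random, or declares that there is no occurrence (when this is the case). The outcomes of all operations must be mutually independent. **Directed polymatroid bound.** Let $m\ge1$ and $\lambda\in[1,m]$ be integers. Let $\mathcal{C}$ be the set containing, for each edge $(X,Y)\in E_P$, the two triples $(\emptyset,\{X,Y\},m)$ and $(\{X\},\{X,Y\},\lambda)$. Then $$\mathit{polymat}_{\mathit{dir}}(m,\lambda,P)=2^{\max_h h(V_P)},$$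 where $h$ ranges over all functions $h:2^{V_P}\to\mathbb{R}_{\ge0}$ that satisfy $h(\emptyset)=0$, are monotone, submodular ($h(\mathcal{X}\cup\mathcal{Y})+h(\mathcal{X}\cap\mathcal{Y})\le h(\mathcal{X})+h(\mathcal{Y})$ for all $\mathcal{X},\mathcal{Y}\subseteq V_P$), and satisfy $h(\mathcal{Y})-h(\mathcal{X})\le\log_2 N$ for every $(\mathcal{X},\mathcal{Y},N)\in\mathcal{C}$. **Conventions.** $|E|\ge1$ and $\lambda$ is an integer in $[1,|E|]$; $P$ has at least one edge; the pattern $P$ is fixed, so constants hidden in $O(\cdot)$ may depend on $P$. Simple directed graphs have no self-loops or parallel edges but may contain both $(x,y)$ and $(y,x)$. Weakly connected means connected when edge directions are ignored. The model is the standard RAM model with randomization, where vertices fit in a machine word, and arithmetic on numbers, random choices and (expected, randomized) hashing operations take constant time. *)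

theory Defs
  imports "HOL-Probability.Probability" "Graph_Theory.Graph_Theory"
begin

section \<open>Graphs, occurrences and the directed polymatroid bound\<close>

text \<open>Simple directed graphs are the loop-free finite pair digraphs of \<^locale>\<open>pair_digraph\<close>; there
  arcs are pairs of vertices, so parallel arcs cannot occur, while \<open>(x, y)\<close> and \<open>(y, x)\<close> may coexist.\<close>

definition occurrences :: "'p pair_pre_digraph \<Rightarrow> 'a pair_pre_digraph \<Rightarrow> 'a pair_pre_digraph set" where
  "occurrences P G = {H. subgraph (with_proj H) (with_proj G) \<and>
     (\<exists>f. bij_betw f (pverts H) (pverts P) \<and>
       (\<forall>u1\<in>pverts H. \<forall>u2\<in>pverts H. u1 \<noteq> u2 \<longrightarrow>
          ((u1, u2) \<in> parcs H \<longleftrightarrow> (f u1, f u2) \<in> parcs P)))}"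

definition degree_constraints :: "nat \<Rightarrow> nat \<Rightarrow> 'p pair_pre_digraph \<Rightarrow> ('p set \<times> 'p set \<times> nat) set" where
  "degree_constraints m l P =
     (\<Union>(X, Y)\<in>parcs P. {({}, {X, Y}, m), ({X}, {X, Y}, l)})"

text \<open>Only the values of \<open>h\<close> on subsets of the pattern's vertex set matter; elsewhere \<open>h\<close> is
  unconstrained.\<close>

definition feasible_polymatroids :: "nat \<Rightarrow> nat \<Rightarrow> 'p pair_pre_digraph \<Rightarrow> ('p set \<Rightarrow> real) set" where
  "feasible_polymatroids m l P = {h.
     (\<forall>X. X \<subseteq> pverts P \<longrightarrow> 0 \<le> h X) \<and>
     h {} = 0 \<and>
     (\<forall>X Y. X \<subseteq> Y \<and> Y \<subseteq> pverts P \<longrightarrow> h X \<le> h Y) \<and>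
     (\<forall>X Y. X \<subseteq> pverts P \<and> Y \<subseteq> pverts P \<longrightarrow> h (X \<union> Y) + h (X \<inter> Y) \<le> h X + h Y) \<and>
     (\<forall>(X, Y, N)\<in>degree_constraints m l P. h Y - h X \<le> log 2 (real N))}"

text \<open>The supremum is a maximum whenever every pattern vertex is an endpoint of some arc (in
  particular for connected patterns with at least one arc) and \<open>m, l \<ge> 1\<close>:
  see \<open>polymat_dir_attained\<close> below.\<close>

definition polymat_dir :: "nat \<Rightarrow> nat \<Rightarrow> 'p pair_pre_digraph \<Rightarrow> real" where
  "polymat_dir m l P = 2 powr (SUP h\<in>feasible_polymatroids m l P. h (pverts P))"

lemma feasible_polymatroid_bound:
  assumes h: "h \<in> feasible_polymatroids m l P" and P: "pair_digraph P"
    and cover: "pverts P \<subseteq> (\<Union>(x, y)\<in>parcs P. {x, y})"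
  shows "h (pverts P) \<le> real (card (parcs P)) * log 2 (real m)"
proof -
  interpret pair_digraph P by fact
  have sub: "(\<Union>(x, y)\<in>A. {x, y}) \<subseteq> pverts P" if "A \<subseteq> parcs P" for A
    using that by (auto dest: in_arcsD1 in_arcsD2)
  have "h (\<Union>(x, y)\<in>A. {x, y}) \<le> real (card A) * log 2 (real m)" if "A \<subseteq> parcs P" for A
    using finite_subset[OF that pair_finite_arcs] that
  proof (induction A rule: finite_induct)
    case empty
    then show ?case using h by (simp add: feasible_polymatroids_def)
  next
    case (insert e A)
    obtain x y where e: "e = (x, y)" by (cases e)
    let ?U = "\<Union>(x, y)\<in>A. {x, y}"
    have V: "?U \<subseteq> pverts P" "{x, y} \<subseteq> pverts P"
      using sub[of A] sub[of "{e}"] insert.prems e by auto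
    have "h ({x, y} \<union> ?U) + h ({x, y} \<inter> ?U) \<le> h {x, y} + h ?U"
      using h V unfolding feasible_polymatroids_def by blast
    moreover have "{x, y} \<inter> ?U \<subseteq> pverts P"
      using V by (meson inf.coboundedI1)
    then have "0 \<le> h ({x, y} \<inter> ?U)"
      using h by (simp only: feasible_polymatroids_def mem_Collect_eq)
    moreover have "({}, {x, y}, m) \<in> degree_constraints m l P"
      using insert.prems e by (auto simp: degree_constraints_def)
    then have "h {x, y} - h {} \<le> log 2 (real m)"
      using h by (auto simp: feasible_polymatroids_def)
    moreover have "h {} = 0"
      using h by (simp add: feasible_polymatroids_def)
    moreover have "h ?U \<le> real (card A) * log 2 (real m)"
      using insert.IH insert.prems by simp
    moreover have "(\<Union>(x, y)\<in>insert e A. {x, y}) = {x, y} \<union> ?U" "card (insert e A) = Suc (card A)"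
      using e insert.hyps by simp_all
    ultimately show ?case
      by (simp add: algebra_simps del: Un_insert_left)
  qed
  moreover have "pverts P = (\<Union>(x, y)\<in>parcs P. {x, y})"
    using cover sub[of "parcs P"] by blast
  ultimately show ?thesis by auto
qed

lemma polymat_dir_attained:
  assumes P: "pair_digraph P" and cover: "pverts P \<subseteq> (\<Union>(x, y)\<in>parcs P. {x, y})"
    and ml: "1 \<le> m" "1 \<le> l"
  shows "\<exists>h\<in>feasible_polymatroids m l P. polymat_dir m l P = 2 powr h (pverts P) \<and>
    (\<forall>g\<in>feasible_polymatroids m l P. g (pverts P) \<le> h (pverts P))"
proof -
  let ?V = "pverts P" and ?F = "feasible_polymatroids m l P"
  define B where "B = real (card (parcs P)) * log 2 (real m)"
  define K where "K = ?F \<inter> {h. \<forall>X. \<not> X \<subseteq> ?V \<longrightarrow> h X = 0}"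
  have B: "0 \<le> B" using ml by (simp add: B_def)
  have cl: "closed K"
    unfolding K_def feasible_polymatroids_def degree_constraints_def
    by (intro closed_Int closed_Collect_conj closed_Collect_all closed_Collect_imp
        closed_Collect_le closed_Collect_eq continuous_intros continuous_on_product_coordinates
        open_Collect_const | simp add: case_prod_beta Ball_def)+
  have "compactin (product_topology (\<lambda>_::'a set. euclidean) UNIV) (\<Pi>\<^sub>E X\<in>UNIV. {0..B})"
    by (subst compactin_PiE) simp
  then have "compact (\<Pi>\<^sub>E X\<in>(UNIV::'a set set). {0..B})"
    by (simp add: euclidean_product_topology)
  moreover have "K \<subseteq> (\<Pi>\<^sub>E X\<in>UNIV. {0..B})"
  proof
    fix h assume h: "h \<in> K"
    have "h X \<in> {0..B}" for X
    proof (cases "X \<subseteq> ?V")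
      case True
      then have "0 \<le> h X" "h X \<le> h ?V"
        using h unfolding K_def feasible_polymatroids_def by auto
      then show ?thesis
        using feasible_polymatroid_bound[OF _ P cover, of h m l] h by (auto simp: K_def B_def)
    next
      case False
      then show ?thesis using h B by (simp add: K_def)
    qed
    then show "h \<in> (\<Pi>\<^sub>E X\<in>UNIV. {0..B})" by auto
  qed
  ultimately have "compact K" using cl by (metis compact_Int_closed inf.absorb2)
  moreover have "(\<lambda>X. 0) \<in> K"
    using ml by (auto simp: K_def feasible_polymatroids_def degree_constraints_def)
  ultimately obtain h where h: "h \<in> K" and max: "\<And>g. g \<in> K \<Longrightarrow> g ?V \<le> h ?V"
    using continuous_attains_sup[of K "\<lambda>h. h ?V"]
    by (metis continuous_on_product_coordinates continuous_on_subset empty_iff subset_UNIV)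
  have max': "g ?V \<le> h ?V" if g: "g \<in> ?F" for g
  proof -
    have wf: "x \<in> ?V \<and> y \<in> ?V" if "(x, y) \<in> parcs P" for x y
      using pair_digraph.axioms(1)[OF P] that
      by (auto simp: pair_fin_digraph_def dest: pair_wf_digraph.in_arcsD1 pair_wf_digraph.in_arcsD2)
    have "(\<lambda>X. if X \<subseteq> ?V then g X else 0) \<in> K"
      using g wf unfolding K_def feasible_polymatroids_def degree_constraints_def
      by (auto simp: le_infI1 intro: order_trans)
    from max[OF this] show ?thesis by simp
  qed
  have "(SUP g\<in>?F. g ?V) = h ?V"
    using h max' by (intro cSup_eq_maximum) (auto simp: K_def)
  then show ?thesis
    using h max' by (auto simp: K_def polymat_dir_def)
qed


section \<open>A randomized word RAM\<close>

text \<open>A program is a piece of finite syntax and does not depend on the input or on the word length.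
  Cells hold words, i.e. numbers below \<open>2 ^ w\<close>. Besides registers and
  an addressable memory there is a dictionary, which provides hashing: it maps
  keys, tuples of words of a length fixed in the program text, to words, and absent keys to 0.
  As usual for a word RAM, programs are run with words that can hold the vertices and have at least
  \<open>c * log 2 (|E| + 1)\<close> bits, for some constant \<open>c\<close>, so that addresses and numbers polynomial in the
  number of arcs fit in a word.\<close>

datatype binop = Plus | Minus | Times | Div | Mod | Less | Equal

datatype exp =
    Const nat
  | Reg nat
  | Load exp
  | Lookup "exp list"
  | Op binop exp exp

datatype com =
    Skip
  | Assign nat exp
  | Store exp exp
  | Insert "exp list" exp
  | Random nat exp
  | Seq com com
  | Cond exp com com
  | While exp com

record machine =
  regs :: "nat \<Rightarrow> nat"
  mem :: "nat \<Rightarrow> nat"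
  dict :: "nat list \<Rightarrow> nat"

text \<open>Addition and multiplication wrap around; subtraction is truncated at 0, and
  division by 0 gives 0. Truth values are 1 and 0.\<close>

fun eval_op :: "nat \<Rightarrow> binop \<Rightarrow> nat \<Rightarrow> nat \<Rightarrow> nat" where
  "eval_op w Plus a b = (a + b) mod 2 ^ w"
| "eval_op w Minus a b = a - b"
| "eval_op w Times a b = (a * b) mod 2 ^ w"
| "eval_op w Div a b = a div b"
| "eval_op w Mod a b = a mod b"
| "eval_op w Less a b = of_bool (a < b) mod 2 ^ w"
| "eval_op w Equal a b = of_bool (a = b) mod 2 ^ w"

fun eval :: "nat \<Rightarrow> machine \<Rightarrow> exp \<Rightarrow> nat" where
  "eval w s (Const k) = k mod 2 ^ w"
| "eval w s (Reg r) = regs s r"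
| "eval w s (Load e) = mem s (eval w s e)"
| "eval w s (Lookup es) = dict s (map (eval w s) es)"
| "eval w s (Op f e1 e2) = eval_op w f (eval w s e1) (eval w s e2)"

text \<open>Results are pairs of final state and running time. Mass missing from the subprobability
  distribution is the probability of not terminating.\<close>

partial_function (spmf) while_spmf ::
    "(machine \<Rightarrow> bool) \<Rightarrow> (machine \<Rightarrow> (machine \<times> nat) spmf) \<Rightarrow> machine \<Rightarrow> (machine \<times> nat) spmf" where
  "while_spmf b f s =
     (if b s then
        do {
          (s1, t1) \<leftarrow> f s;
          (s2, t2) \<leftarrow> while_spmf b f s1;
          return_spmf (s2, 1 + t1 + t2)
        }
      else return_spmf (s, 1))"

text \<open>Each executed instruction and each evaluated condition costs one unit, including the
  expressions in it: as the program is fixed, the number of operations in an expression is bounded by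
  a constant. Dictionary accesses are thereby charged their (constant) expected cost; their actual
  cost fluctuates with the randomness of the hash function, but has no influence on the results, and
  by linearity of expectation charging the expectation leaves expected running times correct up to a
  constant factor. \<open>Random r e\<close> draws a uniform number below the value of \<open>e\<close> (or 0, if that value
  is 0), independently of everything before.\<close>

primrec exec :: "nat \<Rightarrow> com \<Rightarrow> machine \<Rightarrow> (machine \<times> nat) spmf" where
  "exec w Skip s = return_spmf (s, 1)"
| "exec w (Assign r e) s = return_spmf (s\<lparr>regs := (regs s)(r := eval w s e)\<rparr>, 1)"
| "exec w (Store a e) s = return_spmf (s\<lparr>mem := (mem s)(eval w s a := eval w s e)\<rparr>, 1)"
| "exec w (Insert ks e) s =
     return_spmf (s\<lparr>dict := (dict s)(map (eval w s) ks := eval w s e)\<rparr>, 1)"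
| "exec w (Random r e) s =
     do {
       x \<leftarrow> (if eval w s e = 0 then return_spmf 0 else spmf_of_set {..<eval w s e});
       return_spmf (s\<lparr>regs := (regs s)(r := x)\<rparr>, 1)
     }"
| "exec w (Seq c1 c2) s =
     do {
       (s1, t1) \<leftarrow> exec w c1 s;
       (s2, t2) \<leftarrow> exec w c2 s1;
       return_spmf (s2, t1 + t2)
     }"
| "exec w (Cond e c1 c2) s =
     do {
       (s1, t1) \<leftarrow> (if eval w s e \<noteq> 0 then exec w c1 s else exec w c2 s);
       return_spmf (s1, 1 + t1)
     }"
| "exec w (While e c) s = while_spmf (\<lambda>s. eval w s e \<noteq> 0) (exec w c) s"


section \<open>Data structures for subgraph sampling\<close>

text \<open>The graph is given by its arcs \<open>es\<close>, in any order: arc number \<open>i\<close> occupies the memory cells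
  \<open>2 * i\<close> and \<open>2 * i + 1\<close>. Registers 0 and 1 hold the number of arcs and the degree bound.\<close>

definition input_state :: "nat \<Rightarrow> (nat \<times> nat) list \<Rightarrow> machine" where
  "input_state l es =
     \<lparr>regs = (\<lambda>r. if r = 0 then length es else if r = 1 then l else 0),
      mem = (\<lambda>a. if a < 2 * length es
                 then (if even a then fst (es ! (a div 2)) else snd (es ! (a div 2))) else 0),
      dict = (\<lambda>k. 0)\<rparr>"

text \<open>An operation declares that there is no occurrence by leaving 0 in register 0. Otherwise it
  returns a graph: registers 1 and 2 hold the length and the address of a list of its vertices,
  and registers 3 and 4 those of a list of its arcs (two cells per arc).\<close>

definition outcome :: "machine \<Rightarrow> nat pair_pre_digraph option" where
  "outcome s = (if regs s 0 = 0 then None else Some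
     \<lparr>pverts = (\<lambda>i. mem s (regs s 2 + i)) ` {..<regs s 1},
      parcs = (\<lambda>i. (mem s (regs s 4 + 2 * i), mem s (regs s 4 + 2 * i + 1))) ` {..<regs s 3}\<rparr>)"

text \<open>The joint distribution of the outcomes and running times of \<open>n\<close> consecutive operations. Each
  operation starts in the state left by its predecessor, so operations may modify the data
  structure.\<close>

primrec run_operations ::
    "nat \<Rightarrow> com \<Rightarrow> nat \<Rightarrow> machine \<Rightarrow> (nat pair_pre_digraph option \<times> nat) list spmf" where
  "run_operations w sample 0 s = return_spmf []"
| "run_operations w sample (Suc n) s =
     do {
       (s1, t) \<leftarrow> exec w sample s;
       rs \<leftarrow> run_operations w sample n s1;
       return_spmf ((outcome s1, t) # rs)
     }"

text \<open>The construction time, followed by the outcomes and running times of \<open>n\<close> operations.\<close>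

definition session ::
    "nat \<Rightarrow> com \<Rightarrow> com \<Rightarrow> nat \<Rightarrow> machine \<Rightarrow> (nat \<times> (nat pair_pre_digraph option \<times> nat) list) spmf" where
  "session w build sample n s =
     do {
       (s1, t) \<leftarrow> exec w build s;
       rs \<leftarrow> run_operations w sample n s1;
       return_spmf (t, rs)
     }"

definition uniform_occurrence ::
    "'p pair_pre_digraph \<Rightarrow> 'a pair_pre_digraph \<Rightarrow> 'a pair_pre_digraph option spmf" where
  "uniform_occurrence P G =
     (if occurrences P G = {} then return_spmf None
      else map_spmf Some (spmf_of_set (occurrences P G)))"

end

theory Submission
  imports Defs
begin

text \<open>Write \<open>a = log 2 m\<close> and \<open>b = log 2 l\<close>. A trial draws a number below \<open>N\<close> and decodes it into a map from
  the pattern to the graph: pieces of the pattern are located by the position of an arc (\<open>m\<close> choices), by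
  a rank among the out-neighbours of a vertex placed before (\<open>l\<close> choices), by such a rank below \<open>sqrt m\<close>
  for a vertex of out-degree at most \<open>sqrt m\<close>, or by the position of one of the at most \<open>sqrt m\<close> vertices
  of larger out-degree. The trial succeeds if the map is an embedding and the number is its code, so that
  every embedding is hit by exactly one number. Trials are repeated until one succeeds, in parallel with
  a scan of all numbers that detects the absence of embeddings; this takes \<open>N / max 1 OUT\<close> expected
  iterations.

  It remains to choose the pieces such that \<open>N\<close> is within a constant factor of the polymatroid bound. Take
  a maximal fractional packing of the pattern, where adjacent weights sum to at most \<open>a\<close> and heads of arcs
  have weight at most \<open>b\<close>. Hall's theorem for its tight arcs splits the vertices into tight arcs, vertices of
  maximal weight, and odd cycles of weight \<open>a / 2\<close> throughout, and the pieces pay exactly the total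
  weight. An odd cycle is covered by a matching and one more vertex, which is found from a light
  neighbour, or is itself heavy. If \<open>2 * b \<le> a\<close>, the source components with at least two vertices are
  taken out first: each pays one arc and then \<open>b\<close> for each further vertex, which matches the polymatroid
  \<open>X \<mapsto> (a - 2 * b) * of_bool (X \<noteq> {}) + b * card X\<close>. The weights depend on \<open>a\<close> and \<open>b\<close> only through
  a monotone substitution, so finitely many programs suffice.\<close>

section \<open>Maximal fractional packings\<close>

text \<open>The program text must not depend on the graph, whereas the best packing depends on the
  ratio of \<open>a\<close> and \<open>b\<close>. Hence the packing problem is solved only for
  sample values \<alpha>, \<beta> on either side of the threshold \<open>a = 2 * b\<close>, where
  the order of \<open>b\<close>, \<open>a / 2\<close> and \<open>a - b\<close> flips. A monotone
  \<psi> with \<open>\<psi> x + \<psi> (\<alpha> - x) = a\<close> keeps arcs within their bound and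
  tight arcs tight, so it carries the plan and the packing to the true \<open>a\<close> and
  \<open>b\<close> with equal totals. Vertices found as out-neighbours need a start. If
  \<open>a < 2 * b\<close>, two adjacent vertices cannot both weigh \<open>b\<close>, and a start
  exists; otherwise a source component may weigh \<open>b\<close> throughout, whence its special
  treatment. Which pattern vertices meet large out-degrees is unknown in advance: the set is guessed
  as part of the number, a constant factor, and all guesses have plans of equal cost, so one range
  \<open>N\<close> serves them all. Occurrences are subgraphs, each the image of as many embeddings
  as \<open>P\<close> has automorphisms, so uniformity passes from embeddings to
  occurrences.\<close>

theorem hall_matching:
  fixes N :: "'a \<Rightarrow> 'b set"
  assumes "finite U" "\<And>x. x \<in> U \<Longrightarrow> finite (N x)"
    and "\<And>A. A \<subseteq> U \<Longrightarrow> card A \<le> card (\<Union>(N ` A))"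
  shows "\<exists>\<phi>. inj_on \<phi> U \<and> (\<forall>x\<in>U. \<phi> x \<in> N x)"
  using assms
proof (induction "card U" arbitrary: U N rule: less_induct)
  case less
  note fin = less.prems(1) and finN = less.prems(2) and hall = less.prems(3)
  show ?case
  proof (cases "U = {}")
    case False
    show ?thesis
    \<comment> \<open>Halmos-Vaughan induction: a proper nonempty \<open>A\<close> with no spare
      neighbour is matched alone, and what it uses is withheld from the rest. If there is no such
      \<open>A\<close>, every proper nonempty subset has a neighbour to spare, so one pair may be
      fixed at will.\<close>
    proof (cases "\<exists>A. A \<subset> U \<and> A \<noteq> {} \<and> card (\<Union>(N ` A)) = card A")
      case True
      then obtain A where A: "A \<subset> U" "A \<noteq> {}" "card (\<Union>(N ` A)) = card A" by blast

      obtain \<phi> where \<phi>: "inj_on \<phi> A" "\<forall>x\<in>A. \<phi> x \<in> N x"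
      proof -
        have "\<exists>\<phi>. inj_on \<phi> A \<and> (\<forall>x\<in>A. \<phi> x \<in> N x)"
        proof (rule less.hyps)
          show "card A < card U" using A fin by (simp add: psubset_card_mono)
          show "finite A" using A fin by (meson finite_subset psubset_imp_subset)
        qed (use A finN in \<open>auto intro!: hall\<close>)
        then show ?thesis using that by blast
      qed
      define N' where "N' = (\<lambda>x. N x - \<Union>(N ` A))"
      have "\<exists>\<phi>. inj_on \<phi> (U - A) \<and> (\<forall>x\<in>U - A. \<phi> x \<in> N' x)"
      proof (rule less.hyps)
        show "card (U - A) < card U"
          using A fin by (intro psubset_card_mono) auto
        fix B assume B: "B \<subseteq> U - A"
        have "card B + card A = card (B \<union> A)"
          using B A fin by (subst card_Un_disjoint) (auto intro: finite_subset)
        also have "\<dots> \<le> card (\<Union>(N ` (B \<union> A)))"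
          using B A by (intro hall) auto
        also have "\<Union>(N ` (B \<union> A)) = \<Union>(N' ` B) \<union> \<Union>(N ` A)"
          by (auto simp: N'_def)
        also have "card \<dots> \<le> card (\<Union>(N' ` B)) + card (\<Union>(N ` A))"
          by (rule card_Un_le)
        finally show "card B \<le> card (\<Union>(N' ` B))" using A by simp
      qed (use fin finN in \<open>auto simp: N'_def\<close>)
      then obtain \<theta> where \<theta>: "inj_on \<theta> (U - A)" "\<forall>x\<in>U - A. \<theta> x \<in> N' x" by blast
      let ?f = "\<lambda>x. if x \<in> A then \<phi> x else \<theta> x"
      have ne: "\<phi> x \<noteq> \<theta> z" if "x \<in> A" "z \<in> U - A" for x z
        using \<phi>(2) \<theta>(2) that by (auto simp: N'_def)
      have "inj_on ?f U"
      proof (rule inj_onI)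
        fix x z assume "x \<in> U" "z \<in> U" "?f x = ?f z"
        then show "x = z"
          using ne[of x z] ne[of z x] \<phi>(1) \<theta>(1) by (auto split: if_splits dest: inj_onD)
      qed
      moreover have "\<forall>x\<in>U. ?f x \<in> N x" using \<phi> \<theta> by (auto simp: N'_def)
      ultimately show ?thesis by (intro exI[of _ ?f]) auto
    next
      case strict: False
      obtain x where x: "x \<in> U" using False by blast
      have "card {x} \<le> card (\<Union>(N ` {x}))" using x by (intro hall) auto
      then obtain y where y: "y \<in> N x" by fastforce
      define N' where "N' = (\<lambda>z. N z - {y})"
      have "\<exists>\<phi>. inj_on \<phi> (U - {x}) \<and> (\<forall>z\<in>U - {x}. \<phi> z \<in> N' z)"
      proof (rule less.hyps)
        show "card (U - {x}) < card U" using x fin by (rule card_Diff1_less[rotated])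
        fix B assume B: "B \<subseteq> U - {x}"
        show "card B \<le> card (\<Union>(N' ` B))"
        proof (cases "B = {}")
          case B0: False
          have "card B \<le> card (\<Union>(N ` B))" using B by (intro hall) auto
          moreover have "B \<subset> U" using B x by blast
          then have "card (\<Union>(N ` B)) \<noteq> card B" using strict B0 by metis
          moreover have "\<Union>(N' ` B) = \<Union>(N ` B) - {y}" by (auto simp: N'_def)
          ultimately show ?thesis
            by (cases "y \<in> \<Union>(N ` B)") (auto simp: card_Diff_singleton_if)
        qed simp
      qed (use fin finN in \<open>auto simp: N'_def\<close>)
      then obtain \<theta> where \<theta>: "inj_on \<theta> (U - {x})" "\<forall>z\<in>U - {x}. \<theta> z \<in> N' z" by blast
      let ?f = "\<theta>(x := y)"
      have ne: "y \<noteq> \<theta> z" if "z \<in> U - {x}" for z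
        using \<theta>(2) that by (auto simp: N'_def)
      have "inj_on ?f U"
      proof (rule inj_onI)
        fix z z' assume "z \<in> U" "z' \<in> U" "?f z = ?f z'"
        then show "z = z'"
          using ne[of z] ne[of z'] \<theta>(1) by (auto split: if_splits dest: inj_onD)
      qed
      moreover have "\<forall>z\<in>U. ?f z \<in> N z" using \<theta> y by (auto simp: N'_def)
      ultimately show ?thesis by (intro exI[of _ ?f]) auto
    qed
  qed simp
qed

section \<open>Fractional vertex packings and their tight arcs\<close>

definition packings :: "'a set \<Rightarrow> ('a \<times> 'a) set \<Rightarrow> ('a \<Rightarrow> real) \<Rightarrow> real \<Rightarrow> ('a \<Rightarrow> real) set" where
  "packings W E u \<alpha> = {h. (\<forall>v\<in>W. 0 \<le> h v \<and> h v \<le> u v) \<and>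
     (\<forall>x\<in>W. \<forall>y\<in>W. (x, y) \<in> E \<longrightarrow> h x + h y \<le> \<alpha>)}"

lemma packings_max:
  assumes u: "\<And>v. v \<in> W \<Longrightarrow> 0 \<le> u v" and \<alpha>: "0 \<le> \<alpha>"
  shows "\<exists>h\<in>packings W E u \<alpha>. \<forall>g\<in>packings W E u \<alpha>. sum g W \<le> sum h W"
proof -
  \<comment> \<open>Coordinates outside \<open>W\<close> are free in \<open>packings\<close>;
    pinning them to 0 makes the domain a product of intervals, compact by Tychonoff, without
    changing \<open>sum h W\<close>.\<close>
  define u' where "u' = (\<lambda>v. if v \<in> W then u v else 0)"
  define C where "C = {h. \<forall>x\<in>W. \<forall>y\<in>W. (x, y) \<in> E \<longrightarrow> h x + h y \<le> \<alpha>}"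
  have cl: "closed C"
    unfolding C_def Ball_def
    by (intro closed_Collect_all closed_Collect_imp closed_Collect_le continuous_intros
        continuous_on_product_coordinates open_Collect_const)
  have "compactin (product_topology (\<lambda>_::'a. euclidean) UNIV) (\<Pi>\<^sub>E v\<in>UNIV. {0..u' v})"
    by (subst compactin_PiE) simp
  then have "compact (\<Pi>\<^sub>E v\<in>(UNIV::'a set). {0..u' v})"
    by (simp add: euclidean_product_topology)
  then have K: "compact ((\<Pi>\<^sub>E v\<in>(UNIV::'a set). {0..u' v}) \<inter> C)" (is "compact ?K")
    using cl by (rule compact_Int_closed)
  have "(\<lambda>_. 0) \<in> ?K" using u \<alpha> by (auto simp: C_def u'_def)
  moreover have "continuous_on ?K (\<lambda>h. sum h W)"
    by (intro continuous_on_sum continuous_on_subset[OF continuous_on_product_coordinates]) auto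
  ultimately obtain h where h: "h \<in> ?K" "\<And>g. g \<in> ?K \<Longrightarrow> sum g W \<le> sum h W"
    using continuous_attains_sup[OF K, of "\<lambda>h. sum h W"] by blast
  have "h v \<in> {0..u' v}" for v using h(1) by (auto simp: PiE_def Pi_def)
  then have "0 \<le> h v \<and> h v \<le> u v" if "v \<in> W" for v
    by (metis atLeastAtMost_iff that u'_def)
  then have "h \<in> packings W E u \<alpha>" using h(1) by (auto simp: packings_def C_def)
  moreover have "sum g W \<le> sum h W" if "g \<in> packings W E u \<alpha>" for g
  proof -
    have "(\<lambda>v. if v \<in> W then g v else 0) \<in> ?K"
      using that by (auto simp: packings_def C_def u'_def)
    from h(2)[OF this] show ?thesis by simp
  qed
  ultimately show ?thesis by (intro bexI[of _ h] ballI)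
qed

lemma finite_uniform_slack:
  fixes f :: "'a \<Rightarrow> real"
  assumes "finite S" "\<And>x. x \<in> S \<Longrightarrow> 0 < f x"
  shows "\<exists>\<epsilon>>0. \<forall>x\<in>S. \<epsilon> \<le> f x"
proof (cases "S = {}")
  case False
  then show ?thesis using assms by (intro exI[of _ "Min (f ` S)"]) auto
qed (auto intro: exI[of _ 1])

definition tight_nbrs :: "'a set \<Rightarrow> ('a \<times> 'a) set \<Rightarrow> real \<Rightarrow> ('a \<Rightarrow> real) \<Rightarrow> 'a \<Rightarrow> 'a set" where
  "tight_nbrs W E \<alpha> h x = {y\<in>W. ((x, y) \<in> E \<or> (y, x) \<in> E) \<and> h x + h y = \<alpha>}"

text \<open>If the condition failed, raising a maximal packing on \<open>A\<close> and lowering it on the tight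
  neighbours of \<open>A\<close> would improve it.\<close>

lemma packing_max_hall:
  assumes W: "finite W" and h: "h \<in> packings W E u \<alpha>"
    and max: "\<And>g. g \<in> packings W E u \<alpha> \<Longrightarrow> sum g W \<le> sum h W"
    and u: "\<And>v. v \<in> W \<Longrightarrow> u v \<le> \<alpha>"
    and A: "A \<subseteq> {v\<in>W. h v < u v}"
  shows "card A \<le> card (\<Union>(tight_nbrs W E \<alpha> h ` A))"
proof (rule ccontr)
  define N where "N = \<Union>(tight_nbrs W E \<alpha> h ` A)"
  assume "\<not> card A \<le> card (\<Union>(tight_nbrs W E \<alpha> h ` A))"
  then have less: "card N < card A" by (simp add: N_def)
  have NW: "N \<subseteq> W" and AW: "A \<subseteq> W" using A by (auto simp: N_def tight_nbrs_def)
  then have fin: "finite N" "finite A" using W by (auto intro: finite_subset)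
  \<comment> \<open>A tight neighbour of \<open>x \<in> A\<close> has weight
    \<open>\<alpha> - h x\<close>, and \<open>h x < u x \<le> \<alpha>\<close>; so there is room to
    lower it.\<close>
  have pos: "0 < h v" if "v \<in> N" for v
    using that A u h unfolding N_def tight_nbrs_def by (force simp: packings_def)
  obtain \<epsilon>1 where \<epsilon>1: "\<epsilon>1 > 0" "\<forall>v\<in>A. \<epsilon>1 \<le> u v - h v"
    using finite_uniform_slack[of A "\<lambda>v. u v - h v"] fin A by auto
  obtain \<epsilon>2 where \<epsilon>2: "\<epsilon>2 > 0" "\<forall>v\<in>N. \<epsilon>2 \<le> h v"
    using finite_uniform_slack[of N h] fin pos by auto
  have "finite {e\<in>W \<times> W. h (fst e) + h (snd e) < \<alpha>}" using W by simp
  then obtain \<epsilon>3 where \<epsilon>3: "\<epsilon>3 > 0"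
    "\<forall>e\<in>{e\<in>W \<times> W. h (fst e) + h (snd e) < \<alpha>}. \<epsilon>3 \<le> \<alpha> - (h (fst e) + h (snd e))"
    using finite_uniform_slack[of "{e\<in>W \<times> W. h (fst e) + h (snd e) < \<alpha>}"
        "\<lambda>e. \<alpha> - (h (fst e) + h (snd e))"]
    by auto
  \<comment> \<open>Both ends of an arc that is not tight may be raised, hence half of
    \<open>\<epsilon>3\<close>.\<close>
  define \<epsilon> where "\<epsilon> = min \<epsilon>1 (min \<epsilon>2 (\<epsilon>3 / 2))"
  have \<epsilon>: "0 < \<epsilon>" "\<epsilon> \<le> \<epsilon>1" "\<epsilon> \<le> \<epsilon>2" "2 * \<epsilon> \<le> \<epsilon>3"
    using \<epsilon>1 \<epsilon>2 \<epsilon>3 by (auto simp: \<epsilon>_def)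
  \<comment> \<open>The two terms cancel on \<open>A \<inter> N\<close>, which may be nonempty. On a
    tight arc every end that is raised has a partner that is lowered.\<close>
  define g where "g = (\<lambda>v. h v + \<epsilon> * (of_bool (v \<in> A) - of_bool (v \<in> N)))"
  have "g \<in> packings W E u \<alpha>"
    unfolding packings_def mem_Collect_eq
  proof (intro conjI ballI impI)
    fix v assume v: "v \<in> W"
    have hv: "0 \<le> h v" "h v \<le> u v" using h v by (auto simp: packings_def)
    show "0 \<le> g v" using \<epsilon> \<epsilon>2 v hv by (force simp: g_def of_bool_def)
    show "g v \<le> u v" using \<epsilon> \<epsilon>1 v hv by (force simp: g_def of_bool_def)
  next
    fix x y assume xy: "x \<in> W" "y \<in> W" "(x, y) \<in> E"
    then have le: "h x + h y \<le> \<alpha>" using h by (auto simp: packings_def)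
    show "g x + g y \<le> \<alpha>"
    proof (cases "h x + h y = \<alpha>")
      case True
      then have "x \<in> A \<Longrightarrow> y \<in> N" "y \<in> A \<Longrightarrow> x \<in> N"
        using xy by (auto simp: N_def tight_nbrs_def add.commute)
      then show ?thesis using True \<epsilon> by (auto simp: g_def of_bool_def)
    next
      case False
      then have "h x + h y + 2 * \<epsilon> \<le> \<alpha>" using le \<epsilon>3 \<epsilon> xy by fastforce
      moreover have "g x \<le> h x + \<epsilon>" "g y \<le> h y + \<epsilon>" using \<epsilon> by (auto simp: g_def of_bool_def)
      ultimately show ?thesis by linarith
    qed
  qed
  from max[OF this] have "sum g W \<le> sum h W" .
  moreover have "(\<Sum>v\<in>W. of_bool (v \<in> A)) = real (card A)"
    using AW W by (simp add: Int_absorb1)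
  moreover have "(\<Sum>v\<in>W. of_bool (v \<in> N)) = real (card N)"
    using NW W by (simp add: Int_absorb1)
  ultimately have "\<epsilon> * (real (card A) - real (card N)) \<le> 0"
    by (simp add: g_def sum.distrib sum_subtractf flip: sum_distrib_left)
  then show False using \<epsilon> less by (simp add: mult_le_0_iff)
qed

section \<open>Plans for sampling a pattern\<close>

datatype 'p atom = ArcAtom 'p 'p | NbrAtom 'p 'p | LightAtom 'p 'p | HeavyAtom 'p

text \<open>\<open>LightAtom\<close> and \<open>HeavyAtom\<close> share a kind: which of them a plan
  uses depends on the out-degrees met in the graph, but the number of choices, about the square root
  of \<open>m\<close>, must not.\<close>

datatype kind = ArcKind | NbrKind | RootKind

fun needs :: "'p atom \<Rightarrow> 'p set" where
  "needs (ArcAtom x y) = {}"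
| "needs (NbrAtom x y) = {x}"
| "needs (LightAtom x y) = {x}"
| "needs (HeavyAtom x) = {}"

fun provides :: "'p atom \<Rightarrow> 'p set" where
  "provides (ArcAtom x y) = {x, y}"
| "provides (NbrAtom x y) = {y}"
| "provides (LightAtom x y) = {y}"
| "provides (HeavyAtom x) = {x}"

text \<open>\<open>S\<close> stands for the pattern vertices that are mapped to vertices of large
  out-degree.\<close>

fun atom_ok :: "('p \<times> 'p) set \<Rightarrow> 'p set \<Rightarrow> 'p atom \<Rightarrow> bool" where
  "atom_ok E S (ArcAtom x y) \<longleftrightarrow> (x, y) \<in> E"
| "atom_ok E S (NbrAtom x y) \<longleftrightarrow> (x, y) \<in> E"
| "atom_ok E S (LightAtom x y) \<longleftrightarrow> (x, y) \<in> E \<and> x \<notin> S"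
| "atom_ok E S (HeavyAtom x) \<longleftrightarrow> x \<in> S"

fun atom_kind :: "'p atom \<Rightarrow> kind" where
  "atom_kind (ArcAtom x y) = ArcKind"
| "atom_kind (NbrAtom x y) = NbrKind"
| "atom_kind (LightAtom x y) = RootKind"
| "atom_kind (HeavyAtom x) = RootKind"

fun ordered_plan :: "'p set \<Rightarrow> 'p atom list \<Rightarrow> bool" where
  "ordered_plan D [] \<longleftrightarrow> True"
| "ordered_plan D (a # as) \<longleftrightarrow> needs a \<subseteq> D \<and> ordered_plan (D \<union> provides a) as"

definition covered :: "'p atom list \<Rightarrow> 'p set" where
  "covered as = \<Union>(provides ` set as)"

lemma covered_simps [simp]:
  "covered [] = {}" "covered (a # as) = provides a \<union> covered as"
  "covered (as @ bs) = covered as \<union> covered bs"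
  by (auto simp: covered_def)

lemma ordered_plan_mono: "ordered_plan D as \<Longrightarrow> D \<subseteq> D' \<Longrightarrow> ordered_plan D' as"
proof (induction as arbitrary: D D')
  case (Cons a as)
  have "ordered_plan (D' \<union> provides a) as"
    by (rule Cons.IH[of "D \<union> provides a"]) (use Cons.prems in auto)
  then show ?case using Cons.prems by auto
qed simp

lemma ordered_plan_append:
  "ordered_plan D (as @ bs) \<longleftrightarrow> ordered_plan D as \<and> ordered_plan (D \<union> covered as) bs"
  by (induction as arbitrary: D) (auto simp: Un_assoc)

text \<open>The multiset \<open>K\<close> is a parameter because the plans for all \<open>S\<close>
  have to agree on it. Vertices may be placed twice, and beyond \<open>X\<close>: an arc that pays
  for one vertex also places its other end.\<close>

definition plan_for :: "('p \<times> 'p) set \<Rightarrow> 'p set \<Rightarrow> kind multiset \<Rightarrow> 'p set \<Rightarrow> 'p atom list \<Rightarrow> bool" where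
  "plan_for E S K X as \<longleftrightarrow> ordered_plan {} as \<and> (\<forall>a\<in>set as. atom_ok E S a) \<and>
     mset (map atom_kind as) = K \<and> X \<subseteq> covered as"

lemma plan_for_append:
  assumes "plan_for E S K X as" "plan_for E S L Y bs"
  shows "plan_for E S (K + L) (X \<union> Y) (as @ bs)"
  using assms ordered_plan_mono[of "{}" bs "covered as"]
  by (auto simp: plan_for_def ordered_plan_append)

fun kind_cost :: "real \<Rightarrow> real \<Rightarrow> kind \<Rightarrow> real" where
  "kind_cost a b ArcKind = a"
| "kind_cost a b NbrKind = b"
| "kind_cost a b RootKind = a / 2"

definition cost :: "real \<Rightarrow> real \<Rightarrow> kind multiset \<Rightarrow> real" where
  "cost a b K = \<Sum>\<^sub># (image_mset (kind_cost a b) K)"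

lemma cost_simps [simp]:
  "cost a b {#} = 0" "cost a b (K + L) = cost a b K + cost a b L"
  "cost a b (add_mset k K) = kind_cost a b k + cost a b K"
  "cost a b (replicate_mset n k) = n * kind_cost a b k"
  by (simp_all add: cost_def)

text \<open>Every second edge of the walk forms a matching of the \<open>2 * n\<close> positions,
  and an \<open>ArcAtom\<close> places both ends, so either orientation of an edge serves.\<close>

lemma path_plan:
  fixes f :: "nat \<Rightarrow> 'p"
  assumes "\<And>i. i < 2 * n - 1 \<Longrightarrow> (f i, f (Suc i)) \<in> E \<or> (f (Suc i), f i) \<in> E"
  shows "\<exists>as. plan_for E S (replicate_mset n ArcKind) (f ` {..<2 * n}) as"
  using assms
proof (induction n)
  case 0
  then show ?case by (auto simp: plan_for_def intro: exI[of _ "[]"])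
next
  case (Suc n)
  have "\<exists>as. plan_for E S (replicate_mset n ArcKind) (f ` {..<2 * n}) as"
    by (rule Suc.IH) (use Suc.prems in auto)
  then obtain as where as: "plan_for E S (replicate_mset n ArcKind) (f ` {..<2 * n}) as" by blast
  let ?x = "f (2 * n)" and ?y = "f (Suc (2 * n))"
  have "(?x, ?y) \<in> E \<or> (?y, ?x) \<in> E" using Suc.prems[of "2 * n"] by simp
  then obtain a where "plan_for E S {#ArcKind#} {?x, ?y} [a]"
  proof
    assume "(?x, ?y) \<in> E"
    then show ?thesis by (intro that[of "ArcAtom ?x ?y"]) (simp add: plan_for_def)
  next
    assume "(?y, ?x) \<in> E"
    then show ?thesis by (intro that[of "ArcAtom ?y ?x"]) (simp add: plan_for_def)
  qed
  from plan_for_append[OF this as]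
  have "plan_for E S (replicate_mset (Suc n) ArcKind) ({?x, ?y} \<union> f ` {..<2 * n}) (a # as)" by simp
  moreover have "{..<2 * Suc n} = {2 * n, Suc (2 * n)} \<union> {..<2 * n}" by auto
  ultimately show ?case by (metis image_Un image_insert image_empty)
qed

text \<open>Deleting one end of the closing arc leaves a path with an even number of vertices. If
  the tail of that arc is heavy, the tail is deleted and found by its position among the heavy
  vertices; if it is light, the head is deleted and found as one of the few out-neighbours of the
  tail. Either way the price is \<open>n\<close> arcs and one root, that is \<open>a / 2\<close> per
  vertex.\<close>

lemma odd_cycle_plan:
  fixes f :: "nat \<Rightarrow> 'p"
  assumes n: "0 < n"
    and adj: "\<And>i. i < 2 * n \<Longrightarrow> (f i, f (Suc i)) \<in> E \<or> (f (Suc i), f i) \<in> E"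
    and close: "(f (2 * n), f 0) \<in> E \<or> (f 0, f (2 * n)) \<in> E"
  shows "\<exists>as. plan_for E S (add_mset RootKind (replicate_mset n ArcKind)) (f ` {..2 * n}) as"
proof -
  obtain as where as: "plan_for E S (replicate_mset n ArcKind) (f ` {..<2 * n}) as"
    using path_plan[of n f E S] adj by auto
  obtain bs where bs: "plan_for E S (replicate_mset n ArcKind) ((\<lambda>i. f (Suc i)) ` {..<2 * n}) bs"
    using path_plan[of n "\<lambda>i. f (Suc i)" E S] adj by auto
  have eq1: "f ` {..2 * n} = insert (f (2 * n)) (f ` {..<2 * n})"
    by (simp add: lessThan_Suc_atMost[symmetric] lessThan_Suc)
  have eq2: "f ` {..2 * n} = insert (f 0) ((\<lambda>i. f (Suc i)) ` {..<2 * n})"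
    by (simp add: atMost_Suc_eq_insert_0 image_image lessThan_Suc_atMost[symmetric] lessThan_Suc_eq_insert_0)
  have mem: "f 0 \<in> f ` {..<2 * n}" "f (2 * n) \<in> (\<lambda>i. f (Suc i)) ` {..<2 * n}"
    using n by (auto intro!: image_eqI[of _ _ "2 * n - 1"])
  have light: "plan_for E S (add_mset RootKind (replicate_mset n ArcKind)) (insert y X) (cs @ [LightAtom x y])"
    if "plan_for E S (replicate_mset n ArcKind) X cs" "x \<in> X" "(x, y) \<in> E" "x \<notin> S" for x y X cs
    using that by (auto simp: plan_for_def ordered_plan_append)
  have heavy: "plan_for E S (add_mset RootKind (replicate_mset n ArcKind)) (insert x X) (HeavyAtom x # cs)"
    if "plan_for E S (replicate_mset n ArcKind) X cs" "x \<in> S" for x X cs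
    using that ordered_plan_mono[of "{}" cs "{x}"] by (auto simp: plan_for_def)
  from close show ?thesis
  proof
    assume e: "(f (2 * n), f 0) \<in> E"
    show ?thesis
    proof (cases "f (2 * n) \<in> S")
      case True
      from heavy[OF as this] show ?thesis unfolding eq1 by blast
    next
      case False
      from light[OF bs mem(2) e this] show ?thesis unfolding eq2 by blast
    qed
  next
    assume e: "(f 0, f (2 * n)) \<in> E"
    show ?thesis
    proof (cases "f 0 \<in> S")
      case True
      from heavy[OF bs this] show ?thesis unfolding eq2 by blast
    next
      case False
      from light[OF as mem(1) e this] show ?thesis unfolding eq1 by blast
    qed
  qed
qed

section \<open>Splitting an injective choice of tight neighbours into arcs and cycles\<close>

lemma permutation_cycle:
  assumes "finite U" "\<phi> ` U = U" "x \<in> U"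
  obtains k where "0 < k" "(\<phi> ^^ k) x = x" "inj_on (\<lambda>i. (\<phi> ^^ i) x) {..<k}"
    "(\<lambda>i. (\<phi> ^^ i) x) ` {..<k} \<subseteq> U"
proof -
  have inj: "inj_on \<phi> U" using assms by (simp add: eq_card_imp_inj_on)
  have inU: "(\<phi> ^^ i) x \<in> U" for i
    by (induction i) (use assms in auto)
  \<comment> \<open>Injectivity cancels \<phi> from both iterates, so any coincidence in the orbit
    is a return to \<open>x\<close> itself.\<close>
  have ret: "(\<phi> ^^ (j - i)) x = x" if "i \<le> j" "(\<phi> ^^ i) x = (\<phi> ^^ j) x" for i j
    using that
  proof (induction i arbitrary: j)
    case (Suc i)
    then obtain j' where j: "j = Suc j'" by (cases j) auto
    then have "\<phi> ((\<phi> ^^ i) x) = \<phi> ((\<phi> ^^ j') x)" using Suc.prems by simp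
    then have "(\<phi> ^^ i) x = (\<phi> ^^ j') x" using inj inU by (auto dest: inj_onD)
    then show ?case using Suc.IH[of j'] Suc.prems j by simp
  qed simp
  have "\<not> inj (\<lambda>i. (\<phi> ^^ i) x)"
    using inU assms(1) by (metis finite_subset image_subsetI infinite_UNIV_nat range_inj_infinite)
  then obtain i j where "i < j" "(\<phi> ^^ i) x = (\<phi> ^^ j) x"
    by (metis injI nat_neq_iff)
  then have ex: "\<exists>k>0. (\<phi> ^^ k) x = x" using ret[of i j] by (intro exI[of _ "j - i"]) auto
  define k where "k = (LEAST k. 0 < k \<and> (\<phi> ^^ k) x = x)"
  have k: "0 < k" "(\<phi> ^^ k) x = x" using LeastI_ex[OF ex] by (auto simp: k_def)
  have min: "k \<le> d" if "0 < d" "(\<phi> ^^ d) x = x" for d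
    unfolding k_def using that by (intro Least_le) auto
  have "inj_on (\<lambda>i. (\<phi> ^^ i) x) {..<k}"
  proof (rule linorder_inj_onI)
    fix i j assume "i < j" "i \<in> {..<k}" "j \<in> {..<k}"
    then show "(\<phi> ^^ i) x \<noteq> (\<phi> ^^ j) x"
      using ret[of i j] min[of "j - i"] by auto
  qed auto
  with k inU show ?thesis using that by blast
qed

text \<open>Weights that sum to \<alpha> go to values that sum to \<open>a\<close>, so tight arcs
  remain tight; in particular \<open>\<alpha> / 2\<close>, the weight on odd cycles, goes to
  \<open>a / 2\<close>.\<close>

definition symmetric_about :: "real \<Rightarrow> real \<Rightarrow> (real \<Rightarrow> real) \<Rightarrow> bool" where
  "symmetric_about \<alpha> a \<psi> \<longleftrightarrow> (\<forall>x. \<psi> x + \<psi> (\<alpha> - x) = a)"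

text \<open>The graph of an injective partial map consists of paths and cycles. Paths are consumed
  two vertices at a time from their starting points, even cycles by alternate arcs, and odd cycles
  by \<open>odd_cycle_plan\<close>; \<open>R\<close> collects the vertices at ends of paths that
  stay unmatched. \<open>K\<close> precedes the quantifiers over \<open>S\<close> and \<psi>, since
  the decomposition depends on neither.\<close>

lemma cycle_decomposition:
  fixes h :: "'p \<Rightarrow> real"
  assumes "finite W" "U \<subseteq> W" "inj_on \<phi> U" "\<phi> ` U \<subseteq> W"
    and "\<And>x. x \<in> U \<Longrightarrow> \<phi> x \<noteq> x \<and> ((x, \<phi> x) \<in> E \<or> (\<phi> x, x) \<in> E) \<and> h x + h (\<phi> x) = \<alpha>"
  shows "\<exists>R K. R \<subseteq> W - U \<and> (\<forall>S. \<exists>as. plan_for E S K (W - R) as) \<and>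
    (\<forall>\<psi> a b. symmetric_about \<alpha> a \<psi> \<longrightarrow> (\<Sum>v\<in>W. \<psi> (h v)) = cost a b K + (\<Sum>v\<in>R. \<psi> (h v)))"
    (is "\<exists>R K. ?decomp W U R K")
  using assms
proof (induction "card W" arbitrary: W U rule: less_induct)
  case less
  note fin = less.prems(1) and UW = less.prems(2) and inj = less.prems(3) and img = less.prems(4)
    and \<phi> = less.prems(5)
  have step: "\<exists>R K. ?decomp W U R K"
    if Q: "Q \<subseteq> W" "Q \<noteq> {}" and img': "\<phi> ` (U - Q) \<subseteq> W - Q"
      and L: "\<And>S. \<exists>as. plan_for E S L Q as"
      and c: "\<And>\<psi> a b. symmetric_about \<alpha> a \<psi> \<Longrightarrow> (\<Sum>v\<in>Q. \<psi> (h v)) = cost a b L" for Q L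
  proof -
    have "\<exists>R K. ?decomp (W - Q) (U - Q) R K"
    proof (rule less.hyps)
      show "card (W - Q) < card W" using Q fin by (intro psubset_card_mono) auto
      show "inj_on \<phi> (U - Q)" using inj by (auto simp: inj_on_def)
    qed (use fin UW img' \<phi> in auto)
    then obtain R K where RK: "?decomp (W - Q) (U - Q) R K" by blast
    have "?decomp W U R (L + K)"
    proof (intro conjI allI impI)
      show "R \<subseteq> W - U" using RK by blast
      fix S
      obtain as bs where "plan_for E S L Q as" "plan_for E S K (W - Q - R) bs" using L RK by metis
      from plan_for_append[OF this] show "\<exists>as. plan_for E S (L + K) (W - R) as"
        by (rule_tac x = "as @ bs" in exI) (auto simp: plan_for_def)
    next
      fix \<psi> a b assume s: "symmetric_about \<alpha> a \<psi>"
      have "(\<Sum>v\<in>W. \<psi> (h v)) = (\<Sum>v\<in>W - Q. \<psi> (h v)) + (\<Sum>v\<in>Q. \<psi> (h v))"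
        by (rule sum.subset_diff[OF Q(1) fin])
      then show "(\<Sum>v\<in>W. \<psi> (h v)) = cost a b (L + K) + (\<Sum>v\<in>R. \<psi> (h v))"
        using RK c[OF s, of b] s by simp
    qed
    then show ?thesis by blast
  qed
  consider "U = {}" | x where "x \<in> U" "x \<notin> \<phi> ` U" | "U \<noteq> {}" "U \<subseteq> \<phi> ` U" by blast
  then show ?case
  proof cases
    case 1
    have "?decomp W U W {#}" using 1 by (auto simp: plan_for_def intro: exI[of _ "[]"])
    then show ?thesis by blast
  next
    \<comment> \<open>A vertex without preimage starts a path. No other vertex is sent to
      \<open>x\<close> or \<open>\<phi> x\<close>, so \<phi> still maps the rest of \<open>U\<close>
      into the rest of \<open>W\<close>.\<close>
    case (2 x)
    have ne: "\<phi> x \<noteq> x" and adj: "(x, \<phi> x) \<in> E \<or> (\<phi> x, x) \<in> E" and t: "h x + h (\<phi> x) = \<alpha>"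
      using \<phi> 2 by auto
    show ?thesis
    proof (rule step[of "{x, \<phi> x}" "{#ArcKind#}"])
      show "\<phi> ` (U - {x, \<phi> x}) \<subseteq> W - {x, \<phi> x}"
        using img 2 inj by (auto dest: inj_onD)
      show "\<exists>as. plan_for E S {#ArcKind#} {x, \<phi> x} as" for S
        using path_plan[of 1 "\<lambda>i. if i = 0 then x else \<phi> x" E S] adj
        by (auto simp: numeral_2_eq_2 lessThan_Suc insert_commute)
      fix \<psi> a b assume "symmetric_about \<alpha> a \<psi>"
      then have "\<psi> (h x) + \<psi> (\<alpha> - h x) = a" by (simp add: symmetric_about_def)
      moreover have "\<alpha> - h x = h (\<phi> x)" using t by simp
      ultimately show "(\<Sum>v\<in>{x, \<phi> x}. \<psi> (h v)) = cost a b {#ArcKind#}" using ne by simp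
    qed (use 2 UW img in auto)
  next
    case 3
    have finU: "finite U" using UW fin by (rule finite_subset)
    have perm: "\<phi> ` U = U"
      using 3(2) inj finU by (metis card_image card_subset_eq finite_imageI)
    obtain x where x: "x \<in> U" using 3 by blast
    obtain k where k: "0 < k" "(\<phi> ^^ k) x = x" "inj_on (\<lambda>i. (\<phi> ^^ i) x) {..<k}"
      "(\<lambda>i. (\<phi> ^^ i) x) ` {..<k} \<subseteq> U"
      using permutation_cycle[OF finU perm x] by blast
    define f where "f = (\<lambda>i. (\<phi> ^^ i) x)"
    define Q where "Q = f ` {..<k}"
    have fU: "f i \<in> U" for i by (induction i) (use x perm in \<open>auto simp: f_def\<close>)
    have OU: "Q \<subseteq> U" using k by (simp add: Q_def f_def)
    have fSuc: "f (Suc i) = \<phi> (f i)" for i by (simp add: f_def)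
    have adj: "(f i, f (Suc i)) \<in> E \<or> (f (Suc i), f i) \<in> E" for i
      using \<phi>[OF fU[of i]] by (simp add: fSuc)
    have fk: "f k = f 0" using k by (simp add: f_def)
    \<comment> \<open>\<phi> has no fixed points, so an odd cycle has at least three vertices, as
      \<open>odd_cycle_plan\<close> requires.\<close>
    have k1: "k \<noteq> 1" using \<phi>[OF fU[of 0]] fk by (auto simp: f_def)
    have \<phi>Q: "\<phi> ` Q \<subseteq> Q"
    proof -
      have "f (Suc i) \<in> Q" if "i < k" for i
        using that k fk by (cases "Suc i = k") (auto simp: Q_def)
      then show ?thesis by (auto simp: Q_def simp flip: fSuc)
    qed
    have \<phi>Q': "\<phi> ` Q = Q"
      using OU finU inj \<phi>Q by (intro card_subset_eq card_image) (auto intro: finite_subset inj_on_subset)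
    have img': "\<phi> ` (U - Q) \<subseteq> W - Q"
    proof -
      have "\<phi> y \<notin> Q" if "y \<in> U - Q" for y
      proof
        assume "\<phi> y \<in> Q"
        then obtain z where "z \<in> Q" "\<phi> y = \<phi> z" using \<phi>Q' by auto
        then show False using that inj OU by (auto dest: inj_onD)
      qed
      then show ?thesis using img by auto
    qed
    \<comment> \<open>Every vertex of the cycle occurs once as \<open>v\<close> and once as
      \<open>\<phi> v\<close>, so twice the sum consists of \<open>k\<close> pairs, each worth
      \<open>a\<close>.\<close>
    have sum: "2 * (\<Sum>v\<in>Q. \<psi> (h v)) = real k * a" if "symmetric_about \<alpha> a \<psi>" for \<psi> a
    proof -
      have "(\<Sum>v\<in>Q. \<psi> (h (\<phi> v))) = (\<Sum>v\<in>\<phi> ` Q. \<psi> (h v))"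
        using inj OU by (subst sum.reindex) (auto intro: inj_on_subset)
      then have "2 * (\<Sum>v\<in>Q. \<psi> (h v)) = (\<Sum>v\<in>Q. \<psi> (h v) + \<psi> (h (\<phi> v)))"
        using \<phi>Q' by (simp add: sum.distrib)
      also have "\<dots> = (\<Sum>v\<in>Q. a)"
      proof (rule sum.cong)
        fix v assume "v \<in> Q"
        then have "h (\<phi> v) = \<alpha> - h v" using \<phi>[of v] OU by auto
        then show "\<psi> (h v) + \<psi> (h (\<phi> v)) = a" using that by (simp add: symmetric_about_def)
      qed simp
      also have "card Q = k" using k(3) by (simp add: Q_def f_def card_image)
      then have "(\<Sum>v\<in>Q. a) = real k * a" by simp
      finally show ?thesis .
    qed
    have Q: "Q \<subseteq> W" "Q \<noteq> {}" using OU UW k by (auto simp: Q_def)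
    show ?thesis
    proof (cases "even k")
      case True
      then obtain n where n: "k = 2 * n" by (elim evenE)
      show ?thesis
      proof (rule step[OF Q img', of "replicate_mset n ArcKind"])
        show "\<exists>as. plan_for E S (replicate_mset n ArcKind) Q as" for S
          unfolding Q_def n by (rule path_plan) (rule adj)
        show "(\<Sum>v\<in>Q. \<psi> (h v)) = cost a b (replicate_mset n ArcKind)"
          if "symmetric_about \<alpha> a \<psi>" for \<psi> a b
          using sum[OF that] by (simp add: n)
      qed
    next
      case False
      then obtain n where n: "k = Suc (2 * n)" by (metis oddE Suc_eq_plus1)
      have "0 < n" using k1 n by auto
      show ?thesis
      proof (rule step[OF Q img', of "add_mset RootKind (replicate_mset n ArcKind)"])
        show "\<exists>as. plan_for E S (add_mset RootKind (replicate_mset n ArcKind)) Q as" for S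
        proof -
          have "(f (2 * n), f 0) \<in> E \<or> (f 0, f (2 * n)) \<in> E"
            using adj[of "2 * n"] fk n by simp
          from odd_cycle_plan[OF \<open>0 < n\<close> adj this] show ?thesis
            by (simp add: Q_def n lessThan_Suc_atMost)
        qed
        show "(\<Sum>v\<in>Q. \<psi> (h v)) = cost a b (add_mset RootKind (replicate_mset n ArcKind))"
          if "symmetric_about \<alpha> a \<psi>" for \<psi> a b
          using sum[OF that] by (simp add: n algebra_simps)
      qed
    qed
  qed
qed

section \<open>The directed polymatroid bound\<close>

text \<open>Sets that no arc enters from outside; the minimal nonempty ones are the source strongly
  connected components.\<close>

definition pred_closed :: "('p \<times> 'p) set \<Rightarrow> 'p set \<Rightarrow> bool" where
  "pred_closed E M \<longleftrightarrow> (\<forall>(x, y)\<in>E. y \<in> M \<longrightarrow> x \<in> M)"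

lemma arcs_plan:
  assumes "finite I" "\<And>i. i \<in> I \<Longrightarrow> f i \<in> E"
  shows "\<exists>as. plan_for E S (replicate_mset (card I) ArcKind) (\<Union>i\<in>I. {fst (f i), snd (f i)}) as"
  using assms
proof (induction I rule: finite_induct)
  case empty
  then show ?case by (auto simp: plan_for_def intro: exI[of _ "[]"])
next
  case (insert i I)
  then obtain as where as:
    "plan_for E S (replicate_mset (card I) ArcKind) (\<Union>i\<in>I. {fst (f i), snd (f i)}) as" by auto
  have "plan_for E S {#ArcKind#} {fst (f i), snd (f i)} [ArcAtom (fst (f i)) (snd (f i))]"
    using insert.prems by (simp add: plan_for_def)
  from plan_for_append[OF this as] show ?case using insert.hyps by auto
qed

text \<open>The condition on subsets is applied to what is still missing: some missing vertex always
  has an in-neighbour that is already placed, so an order of placement exists.\<close>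

lemma nbrs_plan:
  assumes "finite T" "T \<subseteq> V" "plan_for E S K (V - T) as"
    and "\<And>T'. T' \<subseteq> T \<Longrightarrow> T' \<noteq> {} \<Longrightarrow> \<exists>x\<in>V - T'. \<exists>y\<in>T'. (x, y) \<in> E"
  shows "\<exists>bs. plan_for E S (K + replicate_mset (card T) NbrKind) V bs"
  using assms
proof (induction "card T" arbitrary: T K as)
  case 0
  then show ?case by auto
next
  case (Suc n)
  then have "T \<noteq> {}" by auto
  then obtain x y where xy: "x \<in> V - T" "y \<in> T" "(x, y) \<in> E" using Suc.prems(4)[of T] by blast
  have c: "card T = Suc (card (T - {y}))" "n = card (T - {y})"
    using xy Suc.prems(1) Suc.hyps(2) by (simp_all add: card_Diff_singleton)
  have "plan_for E S (add_mset NbrKind K) (V - (T - {y})) (as @ [NbrAtom x y])"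
    using Suc.prems(3) xy by (auto simp: plan_for_def ordered_plan_append)
  have "\<exists>bs. plan_for E S (add_mset NbrKind K + replicate_mset (card (T - {y})) NbrKind) V bs"
  proof (rule Suc.hyps(1)[OF c(2) _ _ \<open>plan_for E S (add_mset NbrKind K) _ _\<close>])
    show "\<exists>x\<in>V - T'. \<exists>y\<in>T'. (x, y) \<in> E" if "T' \<subseteq> T - {y}" "T' \<noteq> {}" for T'
      using Suc.prems(4)[of T'] that by blast
  qed (use Suc.prems in auto)
  then show ?case by (simp add: c(1))
qed

lemma pred_closedD: "pred_closed E M \<Longrightarrow> (x, y) \<in> E \<Longrightarrow> y \<in> M \<Longrightarrow> x \<in> M"
  unfolding pred_closed_def by blast

text \<open>A head of an arc is bounded by the out-degree constraint; a vertex that is no head is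
  bounded only through the arcs leaving it.\<close>

definition caps :: "('p \<times> 'p) set \<Rightarrow> real \<Rightarrow> real \<Rightarrow> 'p \<Rightarrow> real" where
  "caps E \<alpha> \<beta> v = (if v \<in> snd ` E then \<beta> else \<alpha>)"

definition packing_weight ::
    "'p set set \<Rightarrow> ('p \<Rightarrow> real) \<Rightarrow> (real \<Rightarrow> real) \<Rightarrow> real \<Rightarrow> 'p \<Rightarrow> real" where
  "packing_weight Ms h \<psi> b v = (if v \<in> \<Union>Ms then b else \<psi> (h v))"

text \<open>The sources of cost match the right-hand side term by term: tight arcs and cycles;
  vertices left over at their cap \<alpha>, worth one arc each; vertices left over at their cap
  \<beta>, worth one out-neighbour each; and per \<open>M \<in> Ms\<close> an arc and
  \<open>card M - 2\<close> out-neighbours, that is \<open>a - 2 * b\<close> on top of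
  \<open>b\<close> per vertex. \<open>unrooted\<close> ranges over all packings because the maximal
  one is chosen only inside the proof; it excludes a set of vertices that are all to be found as
  out-neighbours and that no arc enters.\<close>

lemma plans_from_packing:
  fixes E :: "('p \<times> 'p) set"
  assumes V: "finite V" "E \<subseteq> V \<times> V" "V \<subseteq> fst ` E \<union> snd ` E"
    and loopfree: "\<And>x. (x, x) \<notin> E"
    and \<alpha>\<beta>: "0 \<le> \<beta>" "\<beta> < \<alpha>"
    and Ms: "\<And>M. M \<in> Ms \<Longrightarrow> M \<subseteq> V" "disjoint Ms"
      "\<And>M. M \<in> Ms \<Longrightarrow> \<exists>(x, y)\<in>E. x \<in> M \<and> y \<in> M"
    and unrooted: "\<And>T h. \<lbrakk>T \<noteq> {}; T \<subseteq> V; pred_closed E T; T \<subseteq> snd ` E;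
        h \<in> packings (V - \<Union>Ms) E (caps E \<alpha> \<beta>) \<alpha>\<rbrakk> \<Longrightarrow>
        (\<exists>M\<in>Ms. M \<subseteq> T) \<or> (\<exists>x\<in>T - \<Union>Ms. h x \<noteq> \<beta>)"
    and nonsource: "\<Union>Ms \<subseteq> snd ` E"
  shows "\<exists>K h. h \<in> packings (V - \<Union>Ms) E (caps E \<alpha> \<beta>) \<alpha> \<and>
    (\<forall>S. \<exists>as. plan_for E S K V as) \<and>
    (\<forall>\<psi> a b. symmetric_about \<alpha> a \<psi> \<longrightarrow> \<psi> \<alpha> = a \<longrightarrow> \<psi> \<beta> = b \<longrightarrow>
       cost a b K = (a - 2 * b) * card Ms + (\<Sum>v\<in>V. packing_weight Ms h \<psi> b v))"
proof -
  define W where "W = V - \<Union>Ms"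
  define u where "u = caps E \<alpha> \<beta>"
  have finW: "finite W" using V by (simp add: W_def)
  obtain h where h: "h \<in> packings W E u \<alpha>"
    and max: "\<And>g. g \<in> packings W E u \<alpha> \<Longrightarrow> sum g W \<le> sum h W"
  proof -
    have "0 \<le> u v" for v using \<alpha>\<beta> by (simp add: u_def caps_def)
    then show ?thesis using packings_max[of W u \<alpha> E] \<alpha>\<beta> that by auto
  qed
  define U where "U = {v\<in>W. h v < u v}"
  have "\<exists>\<phi>. inj_on \<phi> U \<and> (\<forall>x\<in>U. \<phi> x \<in> tight_nbrs W E \<alpha> h x)"
  proof (rule hall_matching)
    show "card A \<le> card (\<Union> (tight_nbrs W E \<alpha> h ` A))" if "A \<subseteq> U" for A
      using packing_max_hall[OF finW h max, of A] that \<alpha>\<beta>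
      by (auto simp: U_def u_def caps_def)
  qed (use finW in \<open>auto simp: U_def tight_nbrs_def\<close>)
  then obtain \<phi> where \<phi>: "inj_on \<phi> U" "\<And>x. x \<in> U \<Longrightarrow> \<phi> x \<in> tight_nbrs W E \<alpha> h x" by blast
  have "\<exists>R K. R \<subseteq> W - U \<and> (\<forall>S. \<exists>as. plan_for E S K (W - R) as) \<and>
    (\<forall>\<psi> a b. symmetric_about \<alpha> a \<psi> \<longrightarrow> (\<Sum>v\<in>W. \<psi> (h v)) = cost a b K + (\<Sum>v\<in>R. \<psi> (h v)))"
  proof (rule cycle_decomposition[OF finW _ \<phi>(1)])
    show "\<phi> x \<noteq> x \<and> ((x, \<phi> x) \<in> E \<or> (\<phi> x, x) \<in> E) \<and> h x + h (\<phi> x) = \<alpha>" if "x \<in> U" for x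
      using \<phi>(2)[OF that] loopfree[of x] by (auto simp: tight_nbrs_def)
    show "\<phi> ` U \<subseteq> W" using \<phi>(2) by (auto simp: tight_nbrs_def)
  qed (auto simp: U_def)
  then obtain R K where R: "R \<subseteq> W - U" and plans: "\<And>S. \<exists>as. plan_for E S K (W - R) as"
    and sum_W: "\<And>\<psi> a b. symmetric_about \<alpha> a \<psi> \<Longrightarrow>
      (\<Sum>v\<in>W. \<psi> (h v)) = cost a b K + (\<Sum>v\<in>R. \<psi> (h v))" by metis
  have hR: "h v = u v" if "v \<in> R" for v
  proof -
    have "v \<in> W" "\<not> h v < u v" using that R by (auto simp: U_def)
    moreover have "h v \<le> u v" using h \<open>v \<in> W\<close> by (simp add: packings_def)
    ultimately show ?thesis by simp
  qed
  define A where "A = R - snd ` E"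
  define B where "B = R \<inter> snd ` E"
  have finR: "finite R" using R finW by (meson Diff_subset finite_subset)
  then have fin: "finite A" "finite B" by (simp_all add: A_def B_def)
  have finMs: "finite Ms" using Ms(1) V(1) by (meson Sup_le_iff finite_UnionD finite_subset)
  obtain r where r: "\<And>M. M \<in> Ms \<Longrightarrow> r M \<in> E \<and> fst (r M) \<in> M \<and> snd (r M) \<in> M"
    using Ms(3) by (metis (no_types, lifting) case_prodE fst_conv snd_conv)
  \<comment> \<open>The chosen arcs lie in disjoint sets and are no loops, so \<open>roots\<close>
    has exactly two vertices per \<open>M\<close>; the rest of each \<open>M\<close> goes into
    \<open>T\<close>.\<close>
  define roots where "roots = (\<Union>M\<in>Ms. {fst (r M), snd (r M)})"
  have finroots: "finite roots" using finMs by (simp add: roots_def)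
  have roots_sub: "roots \<subseteq> \<Union>Ms" using r by (auto simp: roots_def)
  have rne: "fst (r M) \<noteq> snd (r M)" if "M \<in> Ms" for M
    using r[OF that] loopfree by (metis prod.collapse)
  have "card roots = (\<Sum>M\<in>Ms. card {fst (r M), snd (r M)})"
    unfolding roots_def
  proof (rule card_UN_disjoint[OF finMs])
    show "\<forall>M\<in>Ms. \<forall>N\<in>Ms. M \<noteq> N \<longrightarrow> {fst (r M), snd (r M)} \<inter> {fst (r N), snd (r N)} = {}"
    proof (intro ballI impI)
      fix M N assume MN: "M \<in> Ms" "N \<in> Ms" "M \<noteq> N"
      then have "M \<inter> N = {}" using Ms(2) by (simp add: disjoint_def)
      moreover have "{fst (r M), snd (r M)} \<subseteq> M" "{fst (r N), snd (r N)} \<subseteq> N"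
        using r[OF MN(1)] r[OF MN(2)] by simp_all
      ultimately show "{fst (r M), snd (r M)} \<inter> {fst (r N), snd (r N)} = {}" by blast
    qed
  qed auto
  also have "\<dots> = 2 * card Ms" using rne by simp
  finally have card_roots: "card roots = 2 * card Ms" .
  define T where "T = (\<Union>Ms - roots) \<union> B"
  have finUMs: "finite (\<Union>Ms)" using Ms(1) V(1) by (meson Sup_le_iff finite_subset)
  have BMs: "B \<inter> \<Union>Ms = {}" using R by (auto simp: B_def W_def)
  have finT: "finite T" using finUMs fin by (simp add: T_def)
  have TV: "T \<subseteq> V" using Ms(1) R by (auto simp: T_def B_def W_def)
  have card_T: "card T = card (\<Union>Ms) - 2 * card Ms + card B" "2 * card Ms \<le> card (\<Union>Ms)"
  proof -
    have "card T = card (\<Union>Ms - roots) + card B"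
      unfolding T_def using BMs finUMs fin by (intro card_Un_disjoint) auto
    then show "card T = card (\<Union>Ms) - 2 * card Ms + card B"
      using card_Diff_subset[OF finroots roots_sub] card_roots by simp
    show "2 * card Ms \<le> card (\<Union>Ms)"
      using card_mono[OF finUMs roots_sub] card_roots by simp
  qed
  define K' where "K' = K + replicate_mset (card A) ArcKind + replicate_mset (card Ms) ArcKind +
    replicate_mset (card T) NbrKind"
  have plan: "\<exists>as. plan_for E S K' V as" for S
  proof -
    obtain as0 where as0: "plan_for E S K (W - R) as0" using plans by blast
    define f where "f = (\<lambda>v. SOME e. e \<in> E \<and> v \<in> {fst e, snd e})"
    have f': "f v \<in> E \<and> v \<in> {fst (f v), snd (f v)}" if "v \<in> A" for v
    proof -
      have "v \<in> fst ` E \<union> snd ` E" using V(3) R that by (auto simp: A_def W_def)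
      then have "\<exists>e. e \<in> E \<and> (v = fst e \<or> v = snd e)" by (elim UnE imageE) metis+
      then have "\<exists>e. e \<in> E \<and> v \<in> {fst e, snd e}" by (simp only: insert_iff empty_iff simp_thms)
      then show ?thesis
        unfolding f_def by (rule someI_ex[of "\<lambda>e. e \<in> E \<and> v \<in> {fst e, snd e}"])
    qed
    note f = f'[THEN conjunct1] f'[THEN conjunct2]
    obtain as1 where as1:
      "plan_for E S (replicate_mset (card A) ArcKind) (\<Union>v\<in>A. {fst (f v), snd (f v)}) as1"
      using arcs_plan[OF fin(1), of f E S] f(1) by blast
    obtain as2 where as2: "plan_for E S (replicate_mset (card Ms) ArcKind) roots as2"
      using arcs_plan[OF finMs, of r E S] r by (auto simp: roots_def)
    from plan_for_append[OF plan_for_append[OF as0 as1] as2]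
    have "plan_for E S (K + replicate_mset (card A) ArcKind + replicate_mset (card Ms) ArcKind)
        ((W - R) \<union> (\<Union>v\<in>A. {fst (f v), snd (f v)}) \<union> roots) ((as0 @ as1) @ as2)" .
    moreover have "A \<subseteq> (\<Union>v\<in>A. {fst (f v), snd (f v)})"
      by (rule subsetI, rule UN_I, assumption, rule f(2))
    then have "V - T \<subseteq> (W - R) \<union> (\<Union>v\<in>A. {fst (f v), snd (f v)}) \<union> roots"
      by (auto simp: T_def W_def A_def B_def)
    ultimately have "plan_for E S (K + replicate_mset (card A) ArcKind + replicate_mset (card Ms) ArcKind)
        (V - T) ((as0 @ as1) @ as2)"
      unfolding plan_for_def by blast
    then show ?thesis
      unfolding K'_def
    proof (rule nbrs_plan[OF finT TV])
      fix T' assume T': "T' \<subseteq> T" "T' \<noteq> {}"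
      show "\<exists>x\<in>V - T'. \<exists>y\<in>T'. (x, y) \<in> E"
      \<comment> \<open>A set \<open>T'\<close> that no arc enters would contain some
        \<open>M\<close>, hence a root, although roots are outside \<open>T\<close>, or a vertex of
        \<open>B\<close> whose weight differs from its cap \<beta>.\<close>
      proof (rule ccontr)
        assume "\<not> (\<exists>x\<in>V - T'. \<exists>y\<in>T'. (x, y) \<in> E)"
        then have cl: "pred_closed E T'" using V(2) by (auto simp: pred_closed_def)
        have src: "T' \<subseteq> snd ` E" using T' nonsource by (auto simp: T_def B_def)
        have "(\<exists>M\<in>Ms. M \<subseteq> T') \<or> (\<exists>x\<in>T' - \<Union>Ms. h x \<noteq> \<beta>)"
          using unrooted[OF T'(2) _ cl src] h T' TV by (auto simp: W_def u_def)
        then show False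
        proof
          assume "\<exists>M\<in>Ms. M \<subseteq> T'"
          then obtain M where M: "M \<in> Ms" "M \<subseteq> T'" by blast
          then have "fst (r M) \<in> T" "fst (r M) \<in> roots" using r[of M] T' by (auto simp: roots_def)
          then show False using BMs roots_sub by (auto simp: T_def)
        next
          assume "\<exists>x\<in>T' - \<Union>Ms. h x \<noteq> \<beta>"
          then obtain x where x: "x \<in> T'" "x \<notin> \<Union>Ms" "h x \<noteq> \<beta>" by blast
          then have "x \<in> B" using T' by (auto simp: T_def)
          then have "h x = \<beta>" using hR[of x] by (simp add: B_def u_def caps_def)
          with x show False by simp
        qed
      qed
    qed
  qed
  have "cost a b K' = (a - 2 * b) * card Ms + (\<Sum>v\<in>V. packing_weight Ms h \<psi> b v)"
    if \<psi>: "symmetric_about \<alpha> a \<psi>" "\<psi> \<alpha> = a" "\<psi> \<beta> = b" for \<psi> a b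
  proof -
    have "(\<Sum>v\<in>R. \<psi> (h v)) = (\<Sum>v\<in>A. \<psi> (h v)) + (\<Sum>v\<in>B. \<psi> (h v))"
      unfolding A_def B_def using finR by (rule sum.Int_Diff[THEN trans]) (rule add.commute)
    also have "(\<Sum>v\<in>A. \<psi> (h v)) = real (card A) * a"
      using hR \<psi> by (simp add: A_def u_def caps_def)
    also have "(\<Sum>v\<in>B. \<psi> (h v)) = real (card B) * b"
      using hR \<psi> by (simp add: B_def u_def caps_def)
    finally have R: "(\<Sum>v\<in>R. \<psi> (h v)) = real (card A) * a + real (card B) * b" .
    have UMsV: "\<Union>Ms \<subseteq> V" using Ms(1) by blast
    have "(\<Sum>v\<in>V. packing_weight Ms h \<psi> b v) =
        (\<Sum>v\<in>W. packing_weight Ms h \<psi> b v) + (\<Sum>v\<in>\<Union>Ms. packing_weight Ms h \<psi> b v)"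
      unfolding W_def by (rule sum.subset_diff[OF UMsV V(1)])
    also have "\<dots> = (\<Sum>v\<in>W. \<psi> (h v)) + real (card (\<Union>Ms)) * b"
      by (simp add: packing_weight_def W_def)
    finally show ?thesis
      using sum_W[OF \<psi>(1), of b] R card_T by (simp add: K'_def algebra_simps of_nat_diff)
  qed
  with h plan show ?thesis unfolding W_def u_def by blast
qed


text \<open>A nonnegative modular function plus a nonnegative multiple of a coverage function is
  monotone and submodular. For an arc \<open>(x, y)\<close>, a set \<open>M\<close> that contains
  \<open>y\<close> contains \<open>x\<close>, so adding \<open>y\<close> to \<open>{x}\<close> costs
  only the weight of \<open>y\<close>, at most \<open>b\<close>. If \<open>x\<close> lies in some
  \<open>M\<close>, the arc costs \<open>a - 2 * b + b\<close> plus at most \<open>b\<close>;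
  otherwise symmetry and monotonicity of \<psi> turn \<open>h x + h y \<le> \<alpha>\<close> into
  the bound \<open>a\<close>.\<close>

lemma packing_polymatroid:
  fixes P :: "'p pair_pre_digraph"
  assumes P: "pair_digraph P" and ml: "1 \<le> m" "1 \<le> l"
    and ab: "a = log 2 (real m)" "b = log 2 (real l)"
    and Ms: "\<And>M. M \<in> Ms \<Longrightarrow> M \<subseteq> pverts P" "disjoint Ms" "\<And>M. M \<in> Ms \<Longrightarrow> pred_closed (parcs P) M"
    and ab': "Ms = {} \<or> 2 * b \<le> a"
    and h: "h \<in> packings (pverts P - \<Union>Ms) (parcs P) (caps (parcs P) \<alpha> \<beta>) \<alpha>"
    and \<psi>: "mono \<psi>" "symmetric_about \<alpha> a \<psi>" "\<psi> 0 = 0" "\<psi> \<beta> = b"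
  shows "(\<lambda>X. (a - 2 * b) * card {M\<in>Ms. M \<inter> X \<noteq> {}} + (\<Sum>v\<in>X. packing_weight Ms h \<psi> b v))
    \<in> feasible_polymatroids m l P"
proof -
  interpret pair_digraph P by fact
  let ?V = "pverts P" and ?w = "packing_weight Ms h \<psi> b"
  define c where "c = (\<lambda>X. card {M\<in>Ms. M \<inter> X \<noteq> {}})"
  \<comment> \<open>With \<open>Ms\<close> empty the factor \<open>a - 2 * b\<close> may be
    negative; it then multiplies a count that is 0.\<close>
  define k where "k = (if Ms = {} then 0 else a - 2 * b)"
  define g where "g = (\<lambda>X. k * c X + sum ?w X)"
  have k: "0 \<le> k" using ab' by (auto simp: k_def)
  have ab0: "0 \<le> a" "0 \<le> b" using ab ml by auto
  have finMs: "finite Ms" using Ms(1) by (meson Sup_le_iff finite_UnionD finite_subset pair_finite_verts)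
  have finV: "finite X" if "X \<subseteq> ?V" for X using that pair_finite_verts by (rule finite_subset)
  have w0: "0 \<le> ?w v" if "v \<in> ?V" for v
  proof (cases "v \<in> \<Union>Ms")
    case False
    then have "0 \<le> h v" using h that by (simp add: packings_def)
    then have "\<psi> 0 \<le> \<psi> (h v)" by (rule monoD[OF \<psi>(1)])
    then show ?thesis using \<psi>(3) False by (simp add: packing_weight_def)
  qed (use ab0 in \<open>simp add: packing_weight_def\<close>)
  have c_mono: "c X \<le> c Y" if "X \<subseteq> Y" for X Y
    unfolding c_def using finMs that by (intro card_mono) auto
  have c_sub: "c (X \<union> Y) + c (X \<inter> Y) \<le> c X + c Y" for X Y
  proof -
    let ?F = "\<lambda>X. {M\<in>Ms. M \<inter> X \<noteq> {}}"
    have "c (X \<union> Y) + c (X \<inter> Y) \<le> card (?F X \<union> ?F Y) + card (?F X \<inter> ?F Y)"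
      unfolding c_def using finMs by (intro add_mono card_mono) auto
    also have "\<dots> = c X + c Y"
      unfolding c_def using finMs by (subst card_Un_Int[symmetric]) auto
    finally show ?thesis .
  qed
  have arc: "g {x, y} \<le> a \<and> g {x, y} - g {x} \<le> b" if e: "(x, y) \<in> parcs P" for x y
  proof -
    have xy: "x \<noteq> y" "x \<in> ?V" "y \<in> ?V"
      using e in_arcsD1 in_arcsD2 no_loops' by blast+
    have pc: "x \<in> M" if "M \<in> Ms" "y \<in> M" for M
      using Ms(3)[OF that(1)] that(2) e by (auto simp: pred_closed_def)
    then have "{M\<in>Ms. M \<inter> {x, y} \<noteq> {}} = {M\<in>Ms. M \<inter> {x} \<noteq> {}}" by blast
    then have cxy: "c {x, y} = c {x}" by (simp add: c_def)
    have wy: "?w y \<le> b"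
    proof (cases "y \<in> \<Union>Ms")
      case False
      have "y \<in> snd ` parcs P" using e by force
      then have "caps (parcs P) \<alpha> \<beta> y = \<beta>" by (simp only: caps_def if_True)
      moreover have "h y \<le> caps (parcs P) \<alpha> \<beta> y"
        using False h xy by (simp add: packings_def)
      ultimately have "h y \<le> \<beta>" by simp
      then have "\<psi> (h y) \<le> \<psi> \<beta>" by (rule monoD[OF \<psi>(1)])
      then show ?thesis using False \<psi>(4) by (simp add: packing_weight_def)
    qed (simp add: packing_weight_def)
    have "k * c {x} + ?w x + ?w y \<le> a"
    proof (cases "x \<in> \<Union>Ms")
      case True
      then obtain M where M: "M \<in> Ms" "x \<in> M" by blast
      then have "{M\<in>Ms. M \<inter> {x} \<noteq> {}} = {M}" using Ms(2) by (auto simp: disjoint_def)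
      then have "c {x} = 1" by (simp add: c_def)
      moreover have "k = a - 2 * b" using M by (auto simp: k_def)
      moreover have "?w x = b" using True by (simp add: packing_weight_def)
      ultimately show ?thesis using wy by simp
    next
      case False
      then have y: "y \<notin> \<Union>Ms" using pc by blast
      from False have "{M\<in>Ms. M \<inter> {x} \<noteq> {}} = {}" by auto
      then have "c {x} = 0" unfolding c_def by (metis card.empty)
      moreover have "h x + h y \<le> \<alpha>" using h xy e False y by (auto simp: packings_def)
      then have "\<psi> (h y) \<le> \<psi> (\<alpha> - h x)" by (intro monoD[OF \<psi>(1)]) simp
      moreover have "\<psi> (h x) + \<psi> (\<alpha> - h x) = a" using \<psi>(2) by (simp add: symmetric_about_def)
      ultimately show ?thesis using False y by (simp add: packing_weight_def)
    qed
    then show ?thesis using xy wy cxy by (simp add: g_def)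
  qed
  have "g \<in> feasible_polymatroids m l P"
    unfolding feasible_polymatroids_def mem_Collect_eq
  proof (intro conjI allI impI ballI)
    show "0 \<le> g X" if "X \<subseteq> ?V" for X
      using that w0 k by (auto simp: g_def intro!: add_nonneg_nonneg sum_nonneg)
    show "g {} = 0" by (simp add: g_def c_def)
    show "g X \<le> g Y" if "X \<subseteq> Y \<and> Y \<subseteq> ?V" for X Y
    proof -
      have "sum ?w X \<le> sum ?w Y" using that w0 finV by (intro sum_mono2) auto
      moreover have "k * c X \<le> k * c Y" using k c_mono that by (intro mult_left_mono) auto
      ultimately show ?thesis by (simp add: g_def)
    qed
    show "g (X \<union> Y) + g (X \<inter> Y) \<le> g X + g Y" if XY: "X \<subseteq> ?V \<and> Y \<subseteq> ?V" for X Y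
    proof -
      have "sum ?w (X \<union> Y) + sum ?w (X \<inter> Y) = sum ?w X + sum ?w Y"
        using finV XY by (intro sum.union_inter) auto
      moreover have "real (c (X \<union> Y) + c (X \<inter> Y)) \<le> real (c X + c Y)"
        using c_sub[of X Y] by (rule of_nat_mono)
      then have "k * real (c (X \<union> Y) + c (X \<inter> Y)) \<le> k * real (c X + c Y)"
        using k by (rule mult_left_mono)
      ultimately show ?thesis by (simp add: g_def algebra_simps)
    qed
    fix t assume "t \<in> degree_constraints m l P"
    then obtain x y where e: "(x, y) \<in> parcs P"
      and t: "t = ({}, {x, y}, m) \<or> t = ({x}, {x, y}, l)"
      by (auto simp: degree_constraints_def)
    have "g {} = 0" by (simp add: g_def c_def)
    with t arc[OF e] show "case t of (X, Y, N) \<Rightarrow> g Y - g X \<le> log 2 (real N)"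
      by (auto simp: ab)
  qed
  moreover have "(\<lambda>X. (a - 2 * b) * card {M\<in>Ms. M \<inter> X \<noteq> {}} + sum ?w X) = g"
    by (auto simp: g_def k_def c_def)
  ultimately show ?thesis by simp
qed

section \<open>The size of the code space and the two density regimes\<close>

fun kind_base :: "nat \<Rightarrow> nat \<Rightarrow> nat \<Rightarrow> kind \<Rightarrow> nat" where
  "kind_base m l s ArcKind = m"
| "kind_base m l s NbrKind = l"
| "kind_base m l s RootKind = s"

definition volume :: "nat \<Rightarrow> nat \<Rightarrow> nat \<Rightarrow> kind multiset \<Rightarrow> nat" where
  "volume m l s K = (\<Prod>k\<in>#K. kind_base m l s k)"

lemma volume_le_cost:
  assumes "1 \<le> m" "1 \<le> l" "s * s \<le> m"
  shows "real (volume m l s K) \<le> 2 powr cost (log 2 m) (log 2 l) K"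
proof (induction K)
  case (add k K)
  have "real (kind_base m l s k) \<le> 2 powr kind_cost (log 2 m) (log 2 l) k"
  proof (cases k)
    case RootKind
    have "real s \<le> sqrt (real m)" using assms(3)
      by (metis of_nat_le_iff of_nat_mult real_sqrt_le_mono real_sqrt_mult_self abs_of_nat real_sqrt_abs2)
    also have "sqrt (real m) = 2 powr (log 2 m / 2)"
      using assms by (simp add: powr_half_sqrt_powr)
    finally show ?thesis using RootKind by simp
  qed (use assms in auto)
  then have "real (kind_base m l s k) * real (volume m l s K) \<le>
      2 powr kind_cost (log 2 m) (log 2 l) k * 2 powr cost (log 2 m) (log 2 l) K"
    using add by (intro mult_mono) auto
  then show ?case by (simp add: volume_def powr_add)
qed (simp add: volume_def)

text \<open>Connectivity enters here: a vertex other than \<open>x\<close> that reaches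
  \<open>x\<close> in the symmetric closure has an arc at its first step. Hence every pattern vertex
  can be placed through an arc.\<close>

lemma connected_cover:
  assumes P: "pair_digraph P" "Digraph_Component.connected (with_proj P)" "parcs P \<noteq> {}"
  shows "pverts P \<subseteq> fst ` parcs P \<union> snd ` parcs P"
proof
  interpret pair_digraph P by fact
  fix v assume v: "v \<in> pverts P"
  obtain x y where xy: "(x, y) \<in> parcs P" using P(3) by auto
  have x: "x \<in> pverts P" using xy by (rule in_arcsD1)
  have "v \<rightarrow>\<^sup>*\<^bsub>mk_symmetric (with_proj P)\<^esub> x"
    using P(2) v x unfolding connected_def strongly_connected_def
    by (simp add: mk_symmetric_def)
  then have "v = x \<or> (\<exists>z. (v, z) \<in> parcs (mk_symmetric (with_proj P)))"
    unfolding reachable_def by (auto elim: converse_rtrancl_on_cases)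
  then show "v \<in> fst ` parcs P \<union> snd ` parcs P"
    using xy by (force simp: parcs_mk_symmetric)
qed

lemma polymat_dir_ge:
  assumes "pair_digraph P" "pverts P \<subseteq> fst ` parcs P \<union> snd ` parcs P" "1 \<le> m" "1 \<le> l"
    and "g \<in> feasible_polymatroids m l P"
  shows "2 powr g (pverts P) \<le> polymat_dir m l P"
proof -
  have "pverts P \<subseteq> (\<Union>(x, y)\<in>parcs P. {x, y})" using assms(2) by force
  from polymat_dir_attained[OF assms(1) this assms(3,4)] assms(5)
  show ?thesis by auto
qed

text \<open>\<open>K\<close> is fixed before \<open>m\<close>, \<open>l\<close> and
  \<open>S\<close>, as the program text must be; of the numbers it reflects only whether
  \<open>m < l * l\<close>, that is \<open>a < 2 * b\<close>.\<close>

definition sampling_kinds :: "'p pair_pre_digraph \<Rightarrow> bool \<Rightarrow> kind multiset \<Rightarrow> bool" where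
  "sampling_kinds P dense K \<longleftrightarrow> (\<forall>S. \<exists>as. plan_for (parcs P) S K (pverts P) as) \<and>
     (\<forall>m l s. 1 \<le> l \<longrightarrow> l \<le> m \<longrightarrow> s * s \<le> m \<longrightarrow> (m < l * l \<longleftrightarrow> dense) \<longrightarrow>
        real (volume m l s K) \<le> polymat_dir m l P)"

text \<open>\<alpha> and \<beta> are sample values for \<open>a\<close> and \<open>b\<close>, at
  which one packing is computed. For the actual \<open>m\<close> and \<open>l\<close>, the
  polymatroid \<open>g\<close> obtained from this packing through \<psi> takes the cost of the plan
  as its value on \<open>pverts P\<close>. So the volume is at most
  \<open>2 powr g (pverts P)\<close>, which the directed polymatroid bound dominates.\<close>

lemma sampling_kindsI:
  fixes P :: "'p pair_pre_digraph"
  assumes P: "pair_digraph P" "pverts P \<subseteq> fst ` parcs P \<union> snd ` parcs P"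
    and \<alpha>\<beta>: "0 \<le> \<beta>" "\<beta> < \<alpha>"
    and Ms: "\<And>M. M \<in> Ms \<Longrightarrow> M \<subseteq> pverts P" "disjoint Ms" "\<And>M. M \<in> Ms \<Longrightarrow> pred_closed (parcs P) M"
      "\<And>M. M \<in> Ms \<Longrightarrow> \<exists>(x, y)\<in>parcs P. x \<in> M \<and> y \<in> M" "\<Union>Ms \<subseteq> snd ` parcs P"
    and unrooted: "\<forall>T h. T \<noteq> {} \<and> T \<subseteq> pverts P \<and> pred_closed (parcs P) T \<and> T \<subseteq> snd ` parcs P \<and>
        h \<in> packings (pverts P - \<Union>Ms) (parcs P) (caps (parcs P) \<alpha> \<beta>) \<alpha> \<longrightarrow>
        (\<exists>M\<in>Ms. M \<subseteq> T) \<or> (\<exists>x\<in>T - \<Union>Ms. h x \<noteq> \<beta>)"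
    and \<psi>: "\<forall>m l. 1 \<le> l \<and> l \<le> m \<and> (m < l * l \<longleftrightarrow> dense) \<longrightarrow>
        (Ms = {} \<or> 2 * log 2 (real l) \<le> log 2 (real m)) \<and>
        (\<exists>\<psi>. mono \<psi> \<and> symmetric_about \<alpha> (log 2 (real m)) \<psi> \<and> \<psi> 0 = 0 \<and>
           \<psi> \<beta> = log 2 (real l) \<and> \<psi> \<alpha> = log 2 (real m))"
  shows "\<exists>K. sampling_kinds P dense K"
proof -
  interpret pair_digraph P by fact
  let ?V = "pverts P" and ?E = "parcs P"
  have EV: "?E \<subseteq> ?V \<times> ?V" using in_arcsD1 in_arcsD2 by auto
  have lf: "(x, x) \<notin> ?E" for x using no_loops' by blast
  obtain K h where h: "h \<in> packings (?V - \<Union>Ms) ?E (caps ?E \<alpha> \<beta>) \<alpha>"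
    and plans: "\<And>S. \<exists>as. plan_for ?E S K ?V as"
    and cost: "\<And>\<psi> a b. symmetric_about \<alpha> a \<psi> \<Longrightarrow> \<psi> \<alpha> = a \<Longrightarrow> \<psi> \<beta> = b \<Longrightarrow>
       cost a b K = (a - 2 * b) * card Ms + (\<Sum>v\<in>?V. packing_weight Ms h \<psi> b v)"
  proof -
    have "\<exists>K h. h \<in> packings (?V - \<Union>Ms) ?E (caps ?E \<alpha> \<beta>) \<alpha> \<and>
      (\<forall>S. \<exists>as. plan_for ?E S K ?V as) \<and>
      (\<forall>\<psi> a b. symmetric_about \<alpha> a \<psi> \<longrightarrow> \<psi> \<alpha> = a \<longrightarrow> \<psi> \<beta> = b \<longrightarrow>
        cost a b K = (a - 2 * b) * card Ms + (\<Sum>v\<in>?V. packing_weight Ms h \<psi> b v))"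
    proof (rule plans_from_packing)
      show "(\<exists>M\<in>Ms. M \<subseteq> T) \<or> (\<exists>x\<in>T - \<Union>Ms. h x \<noteq> \<beta>)"
        if "T \<noteq> {}" "T \<subseteq> ?V" "pred_closed ?E T" "T \<subseteq> snd ` ?E"
          "h \<in> packings (?V - \<Union>Ms) ?E (caps ?E \<alpha> \<beta>) \<alpha>" for T h
        using that unrooted by blast
    qed (fact pair_finite_verts EV P(2) lf \<alpha>\<beta> Ms(2) Ms(5) | rule Ms(1) Ms(4); assumption)+
    then show ?thesis using that by blast
  qed
  have "real (volume m l s K) \<le> polymat_dir m l P"
    if ml: "1 \<le> l" "l \<le> m" and s: "s * s \<le> m" and d: "m < l * l \<longleftrightarrow> dense" for m l s
  proof -
    let ?a = "log 2 (real m)" and ?b = "log 2 (real l)"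
    obtain \<psi> where ab: "Ms = {} \<or> 2 * ?b \<le> ?a" and \<psi>: "mono \<psi>" "symmetric_about \<alpha> ?a \<psi>"
      "\<psi> 0 = 0" "\<psi> \<beta> = ?b" "\<psi> \<alpha> = ?a"
      using \<psi>[rule_format, of l m] ml d by blast
    have ml1: "1 \<le> m" using ml by simp
    define g where "g = (\<lambda>X. (?a - 2 * ?b) * card {M\<in>Ms. M \<inter> X \<noteq> {}} +
      (\<Sum>v\<in>X. packing_weight Ms h \<psi> ?b v))"
    have g: "g \<in> feasible_polymatroids m l P"
      unfolding g_def by (rule packing_polymatroid[OF P(1) ml1 ml(1) refl refl Ms(1-3) ab h \<psi>(1-4)])
    have "M \<inter> ?V \<noteq> {}" if "M \<in> Ms" for M using Ms(1,4)[OF that] by blast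
    then have "{M\<in>Ms. M \<inter> ?V \<noteq> {}} = Ms" by blast
    then have "g ?V = cost ?a ?b K"
      unfolding g_def using cost[OF \<psi>(2,5,4)] by simp
    then show ?thesis
      using volume_le_cost[OF ml1 ml(1) s, of K] polymat_dir_ge[OF P ml1 ml(1) g] by simp
  qed
  with plans show ?thesis unfolding sampling_kinds_def by blast
qed

lemma sampling_kinds_dense:
  fixes P :: "'p pair_pre_digraph"
  assumes P: "pair_digraph P" "pverts P \<subseteq> fst ` parcs P \<union> snd ` parcs P"
  shows "\<exists>K. sampling_kinds P True K"
proof -
  interpret pair_digraph P by fact
  \<comment> \<open>Every vertex of \<open>T\<close> has an in-neighbour, again in \<open>T\<close>,
    and adjacent weights sum to at most 4, which is less than 3 + 3.\<close>
  have nonconst: "\<exists>z\<in>T. h z \<noteq> 3"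
    if T: "T \<noteq> {}" "T \<subseteq> pverts P" "pred_closed (parcs P) T" "T \<subseteq> snd ` parcs P"
      and h: "h \<in> packings (pverts P) (parcs P) (caps (parcs P) 4 3) 4" for T and h :: "'p \<Rightarrow> real"
  proof -
    obtain x y where xy: "(x, y) \<in> parcs P" "y \<in> T" using T(1,4) by force
    then have x: "x \<in> T" using T(3) pred_closedD by metis
    then have "x \<in> pverts P" "y \<in> pverts P" using T(2) xy(2) by auto
    then have "h x + h y \<le> 4" using h xy(1) by (simp add: packings_def)
    then have "h x \<noteq> 3 \<or> h y \<noteq> 3" by linarith
    then show ?thesis using x xy(2) by metis
  qed
  have \<psi>: "\<exists>\<psi>. mono \<psi> \<and> symmetric_about 4 a \<psi> \<and> \<psi> 0 = 0 \<and> \<psi> 3 = b \<and> \<psi> 4 = a"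
    if ml: "1 \<le> l" "l \<le> m" "m < l * l" and ab: "a = log 2 (real m)" "b = log 2 (real l)"
    for m l :: nat and a b :: real
  proof -
    have "b \<le> a" "0 \<le> b" using ml by (auto simp: ab)
    have "real m \<le> real (l * l)" using ml(3) by (simp only: of_nat_le_iff)
    then have "log 2 m \<le> log 2 (l * l)" using ml by simp
    then have "a \<le> 2 * b" using ml by (simp add: ab log_mult)
    \<comment> \<open>For \<open>a = 4\<close> and \<open>b = 3\<close> the numbers
      \<open>0\<close>, \<open>a - b\<close>, \<open>a / 2\<close>, \<open>b\<close>,
      \<open>a\<close> are 0, 1, 2, 3, 4; the step function sends these to the true values. It is
      monotone because \<open>0 \<le> b \<le> a \<le> 2 * b\<close>.\<close>
    let ?\<psi> = "\<lambda>x::real. if x < 1 then 0 else if x < 2 then a - b else if x = 2 then a / 2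
      else if x \<le> 3 then b else a"
    have "mono ?\<psi>" using \<open>b \<le> a\<close> \<open>0 \<le> b\<close> \<open>a \<le> 2 * b\<close> by (intro monoI) auto
    moreover have "symmetric_about 4 a ?\<psi>" by (auto simp: symmetric_about_def)
    ultimately show ?thesis by (intro exI[of _ ?\<psi>]) auto
  qed
  show ?thesis
    by (rule sampling_kindsI[OF P, where Ms = "{}" and \<alpha> = 4 and \<beta> = 3])
      (use nonconst \<psi> in auto)
qed

text \<open>For a loop-free \<open>P\<close> these are the source strongly connected components with
  at least two vertices: minimality makes them strongly connected, and the last condition excludes
  single vertices without in-arcs.\<close>

definition root_sets :: "'p pair_pre_digraph \<Rightarrow> 'p set set" where
  "root_sets P = {M. M \<noteq> {} \<and> M \<subseteq> pverts P \<and> pred_closed (parcs P) M \<and>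
     (\<forall>M'. M' \<subset> M \<longrightarrow> M' \<noteq> {} \<longrightarrow> \<not> pred_closed (parcs P) M') \<and> M \<subseteq> snd ` parcs P}"

lemma pred_closed_Int: "pred_closed E M \<Longrightarrow> pred_closed E N \<Longrightarrow> pred_closed E (M \<inter> N)"
  by (auto simp: pred_closed_def)

lemma sampling_kinds_sparse:
  fixes P :: "'p pair_pre_digraph"
  assumes P: "pair_digraph P" "pverts P \<subseteq> fst ` parcs P \<union> snd ` parcs P"
  shows "\<exists>K. sampling_kinds P False K"
proof -
  interpret pair_digraph P by fact
  have disj: "disjoint (root_sets P)"
    unfolding disjoint_def
  proof (intro ballI impI)
    fix M N assume MN: "M \<in> root_sets P" "N \<in> root_sets P" "M \<noteq> N"
    \<comment> \<open>The intersection of two root sets is closed again, so by minimality it is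
      empty.\<close>
    have "pred_closed (parcs P) (M \<inter> N)" using MN by (intro pred_closed_Int) (auto simp: root_sets_def)
    moreover have "M' = {}" if "pred_closed (parcs P) M'" "M' \<subset> L" "L \<in> root_sets P" for M' L
      using that by (simp add: root_sets_def) metis
    moreover have "M \<inter> N \<subset> M \<or> M \<inter> N \<subset> N" using MN(3) by blast
    ultimately show "M \<inter> N = {}" using MN(1,2) by metis
  qed
  have arcs: "\<exists>(x, y)\<in>parcs P. x \<in> M \<and> y \<in> M" if M: "M \<in> root_sets P" for M
  proof -
    have M': "M \<noteq> {}" "M \<subseteq> snd ` parcs P" "pred_closed (parcs P) M"
      using M by (simp_all add: root_sets_def)
    then obtain y where y: "y \<in> M" by blast
    then have "y \<in> snd ` parcs P" using M'(2) by blast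
    then obtain x where x: "(x, y) \<in> parcs P" by auto
    then have "x \<in> M" using M'(3) y pred_closedD by metis
    then show ?thesis using x y by (intro bexI[of _ "(x, y)"]) simp_all
  qed
  have unrooted: "\<exists>M\<in>root_sets P. M \<subseteq> T"
    if T: "T \<noteq> {}" "T \<subseteq> pverts P" "pred_closed (parcs P) T" "T \<subseteq> snd ` parcs P" for T
  proof -
    have "finite {M. M \<subseteq> T \<and> M \<noteq> {} \<and> pred_closed (parcs P) M}" (is "finite ?F")
      using finite_subset[OF T(2) pair_finite_verts] by (auto intro: finite_subset[of _ "Pow T"])
    moreover have "T \<in> ?F" using T by simp
    ultimately have "\<exists>M\<in>?F. M \<subseteq> T \<and> (\<forall>N\<in>?F. N \<subseteq> M \<longrightarrow> M = N)"
      by (rule finite_has_minimal2)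
    then obtain M where M: "M \<in> ?F" "\<And>N. N \<in> ?F \<Longrightarrow> N \<subseteq> M \<Longrightarrow> M = N"
      by (elim bexE conjE) simp
    then have "M \<noteq> {}" "M \<subseteq> T" "pred_closed (parcs P) M" by auto
    moreover have "\<not> pred_closed (parcs P) M'" if "M' \<subset> M" "M' \<noteq> {}" for M'
      using M(2)[of M'] that \<open>M \<subseteq> T\<close> by auto
    ultimately have "M \<in> root_sets P" using T by (auto simp: root_sets_def)
    then show ?thesis using \<open>M \<subseteq> T\<close> by blast
  qed
  have \<psi>: "2 * b \<le> a \<and> (\<exists>\<psi>. mono \<psi> \<and> symmetric_about 3 a \<psi> \<and> \<psi> 0 = 0 \<and> \<psi> 1 = b \<and> \<psi> 3 = a)"
    if ml: "1 \<le> l" "l \<le> m" "\<not> m < l * l" and ab: "a = log 2 (real m)" "b = log 2 (real l)"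
    for m l :: nat and a b :: real
  proof -
    have "0 \<le> b" using ml by (auto simp: ab)
    have "real (l * l) \<le> real m" using ml(3) by (simp only: of_nat_le_iff not_less)
    then have "log 2 (l * l) \<le> log 2 m" using ml by simp
    then have ba: "2 * b \<le> a" using ml by (simp add: ab log_mult)
    \<comment> \<open>The counterpart for \<open>2 * b \<le> a\<close>, with sample values
      \<open>a = 3\<close> and \<open>b = 1\<close>: the order is now \<open>0\<close>,
      \<open>b\<close>, \<open>a / 2\<close>, \<open>a - b\<close>, \<open>a\<close>.\<close>
    let ?\<psi> = "\<lambda>x::real. if x < 1 then 0 else if x < 3 / 2 then b else if x = 3 / 2 then a / 2
      else if x \<le> 2 then a - b else a"
    have "mono ?\<psi>" using \<open>0 \<le> b\<close> ba by (intro monoI) auto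
    moreover have "symmetric_about 3 a ?\<psi>" by (auto simp: symmetric_about_def)
    ultimately show ?thesis using ba by (intro conjI exI[of _ ?\<psi>]) auto
  qed
  show ?thesis
  proof (rule sampling_kindsI[OF P, where Ms = "root_sets P" and \<alpha> = 3 and \<beta> = 1])
    show "disjoint (root_sets P)" by (rule disj)
    show "\<exists>(x, y)\<in>parcs P. x \<in> M \<and> y \<in> M" if "M \<in> root_sets P" for M
      using that by (rule arcs)
    show "M \<subseteq> pverts P" "pred_closed (parcs P) M" if "M \<in> root_sets P" for M
      using that by (simp_all add: root_sets_def)
    show "\<Union> (root_sets P) \<subseteq> snd ` parcs P" by (auto simp: root_sets_def)
  qed (use unrooted \<psi> in auto)
qed

section \<open>Expected time and independence\<close>

text \<open>Monotone convergence along a chain of subdistributions. The chain may be uncountable,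
  but the support of its limit is countable, and the exchange of supremum and integral rests on
  that. It makes bounds on expectations admissible for fixed-point induction.\<close>

lemma nn_integral_lub_spmf:
  fixes g :: "'a \<Rightarrow> ennreal"
  assumes chain: "Complete_Partial_Order.chain (ord_spmf (=)) Y" and Y: "Y \<noteq> {}"
  shows "(\<integral>\<^sup>+ x. g x \<partial>measure_spmf (lub_spmf Y)) = (SUP p\<in>Y. \<integral>\<^sup>+ x. g x \<partial>measure_spmf p)"
proof -
  let ?M = "count_space (set_spmf (lub_spmf Y))"
  have chain': "Complete_Partial_Order.chain (\<le>) ((\<lambda>p x. ennreal (spmf p x) * g x) ` Y)"
    using chain by (rule chain_imageI) (auto simp: le_fun_def dest: ord_spmf_eq_leD intro!: mult_right_mono)
  have "(\<integral>\<^sup>+ x. g x \<partial>measure_spmf (lub_spmf Y)) = (\<integral>\<^sup>+ x. (SUP p\<in>Y. ennreal (spmf p x) * g x) \<partial>?M)"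
    unfolding nn_integral_measure_spmf'
    by (subst ennreal_spmf_lub_spmf[OF chain Y]) (subst SUP_mult_right_ennreal, simp_all add: Y)
  also have "\<dots> = (SUP p\<in>Y. \<integral>\<^sup>+ x. ennreal (spmf p x) * g x \<partial>?M)"
    using Y chain' by (rule nn_integral_monotone_convergence_SUP_countable) simp
  also have "\<dots> = (SUP p\<in>Y. \<integral>\<^sup>+ x. g x \<partial>measure_spmf p)"
    by (auto simp: nn_integral_measure_spmf nn_integral_count_space_indicator set_lub_spmf[OF chain]
        in_set_spmf_iff_spmf intro!: arg_cong[of _ _ Sup] image_cong nn_integral_cong split: split_indicator)
  finally show ?thesis .
qed

lemma nn_integral_bind_spmf:
  fixes g :: "'b \<Rightarrow> ennreal"
  shows "(\<integral>\<^sup>+ x. g x \<partial>measure_spmf (p \<bind> f)) =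
    (\<integral>\<^sup>+ x. (\<integral>\<^sup>+ y. g y \<partial>measure_spmf (f x)) \<partial>measure_spmf p)"
  unfolding measure_spmf_bind
  by (subst nn_integral_bind[where B = "count_space UNIV"])
    (auto simp: space_subprob_algebra o_def measurable_def sets_measure_spmf)

lemma nn_integral_return_spmf [simp]:
  "(\<integral>\<^sup>+ x. g x \<partial>measure_spmf (return_spmf a)) = (g a :: ennreal)"
proof -
  have "(\<integral>\<^sup>+ x. g x \<partial>measure_spmf (return_spmf a)) =
      (\<integral>\<^sup>+ x. g x * indicator {a} x \<partial>count_space UNIV)"
    unfolding nn_integral_measure_spmf
    by (intro nn_integral_cong) (auto split: split_indicator)
  also have "\<dots> = g a" by (simp add: nn_integral_count_space_indicator[symmetric] nn_integral_count_space_finite)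
  finally show ?thesis .
qed

lemma nn_integral_spmf_mono:
  assumes "\<And>x. x \<in> set_spmf p \<Longrightarrow> f x \<le> (g x :: ennreal)"
  shows "(\<integral>\<^sup>+ x. f x \<partial>measure_spmf p) \<le> (\<integral>\<^sup>+ x. g x \<partial>measure_spmf p)"
  using assms by (intro nn_integral_mono_AE) (simp add: AE_measure_spmf_iff)

lemma nn_integral_spmf_le_const:
  assumes "\<And>x. x \<in> set_spmf p \<Longrightarrow> f x \<le> (B :: ennreal)"
  shows "(\<integral>\<^sup>+ x. f x \<partial>measure_spmf p) \<le> B"
proof -
  have "(\<integral>\<^sup>+ x. f x \<partial>measure_spmf p) \<le> (\<integral>\<^sup>+ x. B \<partial>measure_spmf p)"
    by (rule nn_integral_spmf_mono) (rule assms)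
  also have "\<dots> = B * emeasure (measure_spmf p) (space (measure_spmf p))" by simp
  also have "\<dots> \<le> B * 1"
    by (intro mult_left_mono measure_spmf.subprob_emeasure_le_1) auto
  finally show ?thesis by simp
qed

lemma admissible_nn_integral_le:
  "spmf.admissible (\<lambda>w. (\<integral>\<^sup>+ x. g x \<partial>measure_spmf (w a)) \<le> (c :: ennreal))"
proof (rule ccpo.admissibleI)
  fix A :: "('a \<Rightarrow> 'b spmf) set"
  assume chain: "Complete_Partial_Order.chain (fun_ord (ord_spmf (=))) A" and A: "A \<noteq> {}"
    and le: "\<forall>w\<in>A. (\<integral>\<^sup>+ x. g x \<partial>measure_spmf (w a)) \<le> c"
  have chain': "Complete_Partial_Order.chain (ord_spmf (=)) ((\<lambda>w. w a) ` A)"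
    using chain by (rule chain_imageI) (simp add: fun_ord_def)
  have "fun_lub lub_spmf A a = lub_spmf ((\<lambda>w. w a) ` A)"
    by (auto simp: fun_lub_def intro: arg_cong[of _ _ lub_spmf])
  then show "(\<integral>\<^sup>+ x. g x \<partial>measure_spmf (fun_lub lub_spmf A a)) \<le> c"
    using nn_integral_lub_spmf[OF chain', of g] A le by (auto intro: SUP_least)
qed

text \<open>\<Phi> is a potential that bounds the expected remaining time; the 1 is the price of
  evaluating the condition. Runs that do not terminate carry no mass in this integral, so
  termination has to be shown separately.\<close>

lemma while_spmf_expected_time:
  assumes inv: "\<And>s s' t. I s \<Longrightarrow> b s \<Longrightarrow> (s', t) \<in> set_spmf (f s) \<Longrightarrow> I s'"
    and step: "\<And>s. I s \<Longrightarrow> b s \<Longrightarrow>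
      (\<integral>\<^sup>+ x. 1 + of_nat (snd x) + \<Phi> (fst x) \<partial>measure_spmf (f s)) \<le> \<Phi> s"
    and stop: "\<And>s. I s \<Longrightarrow> \<not> b s \<Longrightarrow> 1 \<le> \<Phi> s"
    and s: "I s"
  shows "(\<integral>\<^sup>+ x. of_nat (snd x) \<partial>measure_spmf (while_spmf b f s)) \<le> (\<Phi> s :: ennreal)"
proof -
  let ?E = "\<lambda>p. \<integral>\<^sup>+ x. of_nat (snd (x :: machine \<times> nat)) \<partial>measure_spmf p"
  let ?P = "\<lambda>w. \<forall>s. I s \<longrightarrow> ?E (w s) \<le> \<Phi> s"
  have "?P (while_spmf b f)"
  proof (rule while_spmf.fixp_induct[where P = "\<lambda>w. ?P (w b f)"])
    show "spmf.admissible (\<lambda>w. ?P (curry (curry w) b f))"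
      unfolding curry_def by (intro admissible_all admissible_imp admissible_const admissible_nn_integral_le | simp)+
  next
    fix w assume IH: "?P (w b f)"
    show "?P (\<lambda>s. if b s then f s \<bind> (\<lambda>(s1, t1). w b f s1 \<bind>
        (\<lambda>(s2, t2). return_spmf (s2, 1 + t1 + t2))) else return_spmf (s, 1))"
    proof (intro allI impI)
      fix s assume s: "I s"
      show "?E (if b s then f s \<bind> (\<lambda>(s1, t1). w b f s1 \<bind>
        (\<lambda>(s2, t2). return_spmf (s2, 1 + t1 + t2))) else return_spmf (s, 1)) \<le> \<Phi> s"
      proof (cases "b s")
        case True
        have "?E (f s \<bind> (\<lambda>(s1, t1). w b f s1 \<bind> (\<lambda>(s2, t2). return_spmf (s2, 1 + t1 + t2)))) =
            (\<integral>\<^sup>+ x. (\<integral>\<^sup>+ y. 1 + of_nat (snd x) + of_nat (snd y) \<partial>measure_spmf (w b f (fst x)))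
              \<partial>measure_spmf (f s))"
          by (simp add: nn_integral_bind_spmf case_prod_beta add.assoc)
        also have "\<dots> \<le> (\<integral>\<^sup>+ x. 1 + of_nat (snd x) + \<Phi> (fst x) \<partial>measure_spmf (f s))"
        proof (rule nn_integral_spmf_mono)
          fix x assume x: "x \<in> set_spmf (f s)"
          then have "I (fst x)" using inv[OF s True, of "fst x" "snd x"] by simp
          then have "?E (w b f (fst x)) \<le> \<Phi> (fst x)" using IH by simp
          moreover have "(\<integral>\<^sup>+ y. 1 + of_nat (snd x) + of_nat (snd y) \<partial>measure_spmf (w b f (fst x))) =
              (\<integral>\<^sup>+ y. 1 + of_nat (snd x) \<partial>measure_spmf (w b f (fst x))) + ?E (w b f (fst x))"
            by (rule nn_integral_add) auto
          moreover have "(\<integral>\<^sup>+ y. 1 + of_nat (snd x) \<partial>measure_spmf (w b f (fst x))) \<le> 1 + of_nat (snd x)"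
            by (rule nn_integral_spmf_le_const) simp
          ultimately show "(\<integral>\<^sup>+ y. 1 + of_nat (snd x) + of_nat (snd y) \<partial>measure_spmf (w b f (fst x)))
              \<le> 1 + of_nat (snd x) + \<Phi> (fst x)"
            by (simp add: add_mono)
        qed
        also have "\<dots> \<le> \<Phi> s" by (rule step[OF s True])
        finally show ?thesis using True by simp
      next
        case False
        then show ?thesis using stop[OF s] by simp
      qed
    qed
  qed simp
  with s show ?thesis by blast
qed

text \<open>\<open>p\<close> is the chance that one trial yields a given result, \<open>k\<close>
  the chance that it ends the search. Applying the step inequality to the infimum \<open>L\<close>
  of \<open>r\<close> over \<open>I\<close> gives \<open>p + (1 - k) * L \<le> L\<close>, hence
  \<open>p / k \<le> L\<close>, in place of summing a geometric series.\<close>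

lemma geometric_lower_bound:
  fixes r :: "'a \<Rightarrow> real"
  assumes r: "\<And>s. I s \<Longrightarrow> 0 \<le> r s" and k: "0 < k"
    and step: "\<And>s L. I s \<Longrightarrow> (\<And>s'. I s' \<Longrightarrow> L \<le> r s') \<Longrightarrow> p + (1 - k) * L \<le> r s"
    and s: "I s"
  shows "p / k \<le> r s"
proof -
  define L where "L = (INF s\<in>Collect I. r s)"
  have bdd: "bdd_below (r ` Collect I)" using r by (intro bdd_belowI[of _ 0]) auto
  have L: "L \<le> r s'" if "I s'" for s' unfolding L_def using bdd that by (auto intro: cINF_lower)
  have "p + (1 - k) * L \<le> L"
    using s step[OF _ L] by (subst (2) L_def) (auto intro!: cINF_greatest)
  then have "p / k \<le> L" using k by (simp add: field_simps)
  with L[OF s] show ?thesis by simp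
qed

section \<open>Independence of repeated operations\<close>

primrec iid_spmf :: "nat \<Rightarrow> 'a spmf \<Rightarrow> 'a list spmf" where
  "iid_spmf 0 U = return_spmf []"
| "iid_spmf (Suc n) U = U \<bind> (\<lambda>x. map_spmf ((#) x) (iid_spmf n U))"

lemma lossless_iid_spmf: "lossless_spmf U \<Longrightarrow> lossless_spmf (iid_spmf n U)"
  by (induction n) auto

lemma iid_spmf_nth:
  assumes U: "lossless_spmf U" and "i < n"
  shows "map_spmf (\<lambda>xs. xs ! i) (iid_spmf n U) = U"
  using \<open>i < n\<close>
proof (induction n arbitrary: i)
  case (Suc n)
  show ?case
  proof (cases i)
    case 0
    have "map_spmf (\<lambda>xs. xs ! i) (iid_spmf (Suc n) U) =
        bind_spmf U (\<lambda>x. map_spmf (\<lambda>_. x) (iid_spmf n U))"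
      by (simp add: map_spmf_bind_spmf o_def spmf.map_comp 0)
    also have "\<dots> = U \<bind> return_spmf"
      using lossless_iid_spmf[OF U, of n] by (simp only: map_spmf_conv_bind_spmf bind_spmf_const lossless_weight_spmfD scale_spmf_1)
    finally show ?thesis by simp
  next
    case (Suc j)
    have "map_spmf (\<lambda>xs. xs ! i) (iid_spmf (Suc n) U) =
        bind_spmf U (\<lambda>x. map_spmf (\<lambda>xs. xs ! j) (iid_spmf n U))"
      by (simp add: map_spmf_bind_spmf o_def spmf.map_comp Suc)
    also have "\<dots> = U" using Suc Suc.prems Suc.IH[of j] U
      by (simp add: bind_spmf_const lossless_weight_spmfD)
    finally show ?thesis .
  qed
qed simp

lemma measure_iid_spmf:
  assumes U: "lossless_spmf U"
  shows "measure (measure_spmf (iid_spmf n U)) {xs. \<forall>i<n. xs ! i \<in> A i} =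
    (\<Prod>i<n. measure (measure_spmf U) (A i))"
proof -
  have "emeasure (measure_spmf (iid_spmf n U)) {xs. \<forall>i<n. xs ! i \<in> A i} =
    (\<Prod>i<n. emeasure (measure_spmf U) (A i))" for A
  proof (induction n arbitrary: A)
    case 0
    have "measure (measure_spmf (return_spmf ([] :: 'a list))) UNIV = 1"
      using lossless_weight_spmfD[OF lossless_return_spmf[of "[] :: 'a list"]]
      unfolding space_measure_spmf .
    then show ?case by (simp add: measure_spmf.emeasure_eq_measure)
  next
    case (Suc n)
    have "emeasure (measure_spmf (iid_spmf (Suc n) U)) {xs. \<forall>i<Suc n. xs ! i \<in> A i} =
      (\<integral>\<^sup>+ x. (\<integral>\<^sup>+ xs. indicator {xs. \<forall>i<Suc n. xs ! i \<in> A i} (x # xs) \<partial>measure_spmf (iid_spmf n U)) \<partial>measure_spmf U)"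
      unfolding iid_spmf.simps
      by (subst nn_integral_indicator[symmetric]) (simp, simp only: nn_integral_bind_spmf nn_integral_map_spmf o_def)
    also have "\<dots> = (\<integral>\<^sup>+ x. indicator (A 0) x *
      emeasure (measure_spmf (iid_spmf n U)) {xs. \<forall>i<n. xs ! i \<in> A (Suc i)} \<partial>measure_spmf U)"
    proof (rule nn_integral_cong)
      fix x
      have "(\<integral>\<^sup>+ xs. indicator {xs. \<forall>i<Suc n. xs ! i \<in> A i} (x # xs) \<partial>measure_spmf (iid_spmf n U)) =
        (\<integral>\<^sup>+ xs. indicator (A 0) x * indicator {xs. \<forall>i<n. xs ! i \<in> A (Suc i)} xs \<partial>measure_spmf (iid_spmf n U))"
        by (intro nn_integral_cong) (auto simp: All_less_Suc2 split: split_indicator)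
      also have "\<dots> = indicator (A 0) x *
        emeasure (measure_spmf (iid_spmf n U)) {xs. \<forall>i<n. xs ! i \<in> A (Suc i)}"
        by (simp add: nn_integral_cmult)
      finally show "(\<integral>\<^sup>+ xs. indicator {xs. \<forall>i<Suc n. xs ! i \<in> A i} (x # xs) \<partial>measure_spmf (iid_spmf n U)) =
        indicator (A 0) x * emeasure (measure_spmf (iid_spmf n U)) {xs. \<forall>i<n. xs ! i \<in> A (Suc i)}" .
    qed
    also have "\<dots> = emeasure (measure_spmf U) (A 0) *
        emeasure (measure_spmf (iid_spmf n U)) {xs. \<forall>i<n. xs ! i \<in> A (Suc i)}"
      by (simp add: nn_integral_multc)
    also have "\<dots> = (\<Prod>i<Suc n. emeasure (measure_spmf U) (A i))"
      by (simp add: Suc.IH[of "\<lambda>i. A (Suc i)"] prod.lessThan_Suc_shift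
          del: prod.lessThan_Suc)
    finally show ?case .
  qed
  then have "ennreal (measure (measure_spmf (iid_spmf n U)) {xs. \<forall>i<n. xs ! i \<in> A i}) =
    ennreal (\<Prod>i<n. measure (measure_spmf U) (A i))"
    by (simp add: measure_spmf.emeasure_eq_measure prod_ennreal)
  then show ?thesis by (simp add: prod_nonneg)
qed

text \<open>All sets are measurable in the discrete space, so independence amounts to the product
  rule for boxes, which a list of independent samples satisfies by \<open>measure_iid_spmf\<close>.
  The map \<open>h\<close> collects the variables into such a list.\<close>

lemma iid_spmf_indep_vars:
  assumes D: "lossless_spmf D" and U: "lossless_spmf U"
    and h: "map_spmf h D = iid_spmf n U" "\<And>x i. i < n \<Longrightarrow> h x ! i = X i x"
  shows "prob_space.indep_vars (measure_spmf D) (\<lambda>_. count_space UNIV) X {..<n}"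
proof -
  interpret prob_space "measure_spmf D"
    by (rule prob_spaceI) (use D in \<open>simp add: lossless_spmf_def measure_spmf.emeasure_eq_measure\<close>)
  have marg: "map_spmf (X i) D = U" if "i < n" for i
  proof -
    have "map_spmf (X i) D = map_spmf (\<lambda>xs. xs ! i) (map_spmf h D)"
      using h(2)[OF that] by (simp add: spmf.map_comp o_def)
    then show ?thesis using h(1) iid_spmf_nth[OF U that] by simp
  qed
  show ?thesis
  proof (cases "n = 0")
    \<comment> \<open>\<open>indep_vars_finite\<close> requires a nonempty index set.\<close>
    case True
    then show ?thesis by (simp add: indep_vars_def indep_sets_def)
  next
    case False
    have "measure (measure_spmf D) (\<Inter>i\<in>{..<n}. X i -` A i \<inter> space (measure_spmf D)) =
      (\<Prod>i<n. measure (measure_spmf D) (X i -` A i \<inter> space (measure_spmf D)))" for A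
    proof -
      have eq: "(\<Inter>i\<in>{..<n}. X i -` A i \<inter> space (measure_spmf D)) = h -` {xs. \<forall>i<n. xs ! i \<in> A i}"
        by (intro set_eqI) (auto simp: h(2))
      have "measure (measure_spmf D) (\<Inter>i\<in>{..<n}. X i -` A i \<inter> space (measure_spmf D)) =
        measure (measure_spmf (iid_spmf n U)) {xs. \<forall>i<n. xs ! i \<in> A i}"
        unfolding eq h(1)[symmetric] measure_map_spmf ..
      also have "\<dots> = (\<Prod>i<n. measure (measure_spmf U) (A i))" by (rule measure_iid_spmf[OF U])
      also have "\<dots> = (\<Prod>i<n. measure (measure_spmf D) (X i -` A i \<inter> space (measure_spmf D)))"
      proof (rule prod.cong)
        fix i assume "i \<in> {..<n}"
        then show "measure (measure_spmf U) (A i) =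
            measure (measure_spmf D) (X i -` A i \<inter> space (measure_spmf D))"
          using measure_map_spmf[of "X i" D "A i"] marg[of i] by simp
      qed simp
      finally show ?thesis .
    qed
    moreover have "sigma_sets UNIV UNIV = (UNIV :: 'b set set)" by (auto intro: sigma_sets.Basic)
    ultimately show ?thesis
      using False
      by (subst indep_vars_finite[where E = "\<lambda>_. UNIV"])
        (simp_all add: Int_stable_def lessThan_empty_iff measurable_def)
  qed
qed

lemma run_operations_length: "rs \<in> set_spmf (run_operations w c n s) \<Longrightarrow> length rs = n"
  by (induction n arbitrary: s rs) (auto simp: set_bind_spmf)

text \<open>The outcome has the same distribution \<open>U\<close> from every state in
  \<open>I\<close>, and \<open>I\<close> is preserved. So an outcome does not depend on what earlier
  operations left in memory, which is the source of independence.\<close>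

locale sampling_operation =
  fixes w :: nat and c :: com and I :: "machine \<Rightarrow> bool"
    and U :: "nat pair_pre_digraph option spmf" and B :: ennreal
  assumes exec_lossless: "I s \<Longrightarrow> lossless_spmf (exec w c s)"
    and exec_inv: "I s \<Longrightarrow> (s', t) \<in> set_spmf (exec w c s) \<Longrightarrow> I s'"
    and exec_outcome: "I s \<Longrightarrow> map_spmf (outcome \<circ> fst) (exec w c s) = U"
    and exec_time: "I s \<Longrightarrow> (\<integral>\<^sup>+ x. of_nat (snd x) \<partial>measure_spmf (exec w c s)) \<le> B"
begin

lemma run_lossless: "I s \<Longrightarrow> lossless_spmf (run_operations w c n s)"
  by (induction n arbitrary: s) (auto simp: exec_lossless dest: exec_inv)

lemma run_outcomes: "I s \<Longrightarrow> map_spmf (map fst) (run_operations w c n s) = iid_spmf n U"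
proof (induction n arbitrary: s)
  case (Suc n)
  have "map_spmf (map fst) (run_operations w c (Suc n) s) =
    exec w c s \<bind> (\<lambda>x. map_spmf ((#) (outcome (fst x))) (map_spmf (map fst) (run_operations w c n (fst x))))"
    by (simp only: run_operations.simps map_spmf_conv_bind_spmf bind_spmf_assoc return_bind_spmf
        case_prod_beta o_def list.map fst_conv)
  also have "\<dots> = exec w c s \<bind> (\<lambda>x. map_spmf ((#) (outcome (fst x))) (iid_spmf n U))"
    using Suc by (intro bind_spmf_cong refl) (auto simp: Suc.IH dest: exec_inv)
  also have "\<dots> = map_spmf (outcome \<circ> fst) (exec w c s) \<bind> (\<lambda>x. map_spmf ((#) x) (iid_spmf n U))"
    by (simp add: bind_map_spmf o_def)
  finally show ?case using exec_outcome[OF Suc.prems] by simp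
qed simp

lemma run_time:
  "I s \<Longrightarrow> i < n \<Longrightarrow> (\<integral>\<^sup>+ rs. of_nat (snd (rs ! i)) \<partial>measure_spmf (run_operations w c n s)) \<le> B"
proof (induction n arbitrary: s i)
  case (Suc n)
  have eq: "(\<integral>\<^sup>+ rs. of_nat (snd (rs ! i)) \<partial>measure_spmf (run_operations w c (Suc n) s)) =
    (\<integral>\<^sup>+ x. (\<integral>\<^sup>+ rs. of_nat (snd (((outcome (fst x), snd x) # rs) ! i))
      \<partial>measure_spmf (run_operations w c n (fst x))) \<partial>measure_spmf (exec w c s))"
    by (simp add: nn_integral_bind_spmf case_prod_beta)
  show ?case
  proof (cases i)
    case 0
    have "(\<integral>\<^sup>+ x. (\<integral>\<^sup>+ rs. of_nat (snd (((outcome (fst x), snd x) # rs) ! i))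
      \<partial>measure_spmf (run_operations w c n (fst x))) \<partial>measure_spmf (exec w c s)) \<le>
      (\<integral>\<^sup>+ x. of_nat (snd x) \<partial>measure_spmf (exec w c s))"
      by (intro nn_integral_spmf_mono nn_integral_spmf_le_const) (simp add: 0)
    with exec_time[OF Suc.prems(1)] show ?thesis unfolding eq by (rule order_trans[rotated])
  next
    case (Suc j)
    show ?thesis unfolding eq
      by (rule nn_integral_spmf_le_const)
        (use Suc Suc.prems Suc.IH in \<open>auto dest: exec_inv\<close>)
  qed
qed simp

lemma session_correct:
  assumes build: "exec w b s = return_spmf (s0, t)" and s0: "I s0" and U: "lossless_spmf U"
    and D_def: "D = session w b c n s"
  shows "lossless_spmf D" "(\<integral>\<^sup>+ x. of_nat (fst x) \<partial>measure_spmf D) \<le> of_nat t"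
    "i < n \<Longrightarrow> (\<integral>\<^sup>+ x. of_nat (snd (snd x ! i)) \<partial>measure_spmf D) \<le> B"
    "i < n \<Longrightarrow> map_spmf (\<lambda>x. fst (snd x ! i)) D = U"
    "prob_space.indep_vars (measure_spmf D) (\<lambda>_. count_space UNIV) (\<lambda>i x. fst (snd x ! i)) {..<n}"
proof -
  \<comment> \<open>The construction is deterministic, so it contributes only the constant
    \<open>t\<close>.\<close>
  have D: "D = map_spmf (Pair t) (run_operations w c n s0)"
    by (simp add: D_def session_def build map_spmf_conv_bind_spmf)
  show ll: "lossless_spmf D" using run_lossless[OF s0] by (simp add: D)
  show "(\<integral>\<^sup>+ x. of_nat (fst x) \<partial>measure_spmf D) \<le> of_nat t"
    by (rule nn_integral_spmf_le_const) (auto simp: D)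
  show "(\<integral>\<^sup>+ x. of_nat (snd (snd x ! i)) \<partial>measure_spmf D) \<le> B" if "i < n"
    using run_time[OF s0 that] by (simp add: D o_def)
  define h where "h = (\<lambda>x :: nat \<times> (nat pair_pre_digraph option \<times> nat) list. map (\<lambda>i. fst (snd x ! i)) [0..<n])"
  have "map_spmf h D = map_spmf (\<lambda>rs. map (\<lambda>i. fst (rs ! i)) [0..<n]) (run_operations w c n s0)"
    by (simp add: D spmf.map_comp o_def h_def)
  also have "\<dots> = map_spmf (map fst) (run_operations w c n s0)"
    by (intro map_spmf_cong refl) (auto dest!: run_operations_length intro: nth_equalityI)
  finally have h: "map_spmf h D = iid_spmf n U" using run_outcomes[OF s0] by simp
  have hi: "h x ! i = fst (snd x ! i)" if "i < n" for x i using that by (simp add: h_def)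
  show "map_spmf (\<lambda>x. fst (snd x ! i)) D = U" if "i < n"
  proof -
    have "map_spmf (\<lambda>x. fst (snd x ! i)) D = map_spmf (\<lambda>xs. xs ! i) (map_spmf h D)"
      by (simp add: spmf.map_comp o_def hi[OF that])
    then show ?thesis by (simp add: h iid_spmf_nth[OF U that])
  qed
  show "prob_space.indep_vars (measure_spmf D) (\<lambda>_. count_space UNIV) (\<lambda>i x. fst (snd x ! i)) {..<n}"
    by (rule iid_spmf_indep_vars[OF ll U h hi])
qed

end

section \<open>Building the index\<close>

text \<open>The record \<open>machine\<close> holds unbounded numbers; the word bound is an
  invariant of execution. Values within it are left intact by reduction modulo
  \<open>2 ^ w\<close>.\<close>

definition words :: "nat \<Rightarrow> machine \<Rightarrow> bool" where
  "words w st \<longleftrightarrow> (\<forall>r. regs st r < 2 ^ w) \<and> (\<forall>a. mem st a < 2 ^ w) \<and> (\<forall>k. dict st k < 2 ^ w)"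

lemma exec_while_det:
  assumes step: "\<And>i st. i < N \<Longrightarrow> Inv i st \<Longrightarrow> eval w st e \<noteq> 0 \<and>
      (\<exists>st' t. exec w c st = return_spmf (st', t) \<and> t \<le> T \<and> Inv (Suc i) st')"
    and stop: "\<And>st. Inv N st \<Longrightarrow> eval w st e = 0"
    and st: "Inv 0 st"
  shows "\<exists>st' t. exec w (While e c) st = return_spmf (st', t) \<and> Inv N st' \<and> t \<le> N * (T + 1) + 1"
proof -
  have "\<exists>st' t. exec w (While e c) st = return_spmf (st', t) \<and> Inv N st' \<and> t \<le> (N - i) * (T + 1) + 1"
    if "i \<le> N" "Inv i st" for i st
    using that
  proof (induction "N - i" arbitrary: i st)
    case 0
    then have "Inv N st" by simp
    with stop[OF this] show ?case
      by (intro exI[of _ st] exI[of _ 1]) (simp add: while_spmf.simps)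
  next
    case (Suc d)
    then have i: "i < N" by simp
    obtain st1 t1 where st1: "exec w c st = return_spmf (st1, t1)" "t1 \<le> T" "Inv (Suc i) st1"
      and e: "eval w st e \<noteq> 0"
      using step[OF i Suc.prems(2)] by blast
    have "\<exists>st' t. exec w (While e c) st1 = return_spmf (st', t) \<and> Inv N st' \<and>
        t \<le> (N - Suc i) * (T + 1) + 1"
      using Suc.hyps(2) i st1(3) by (intro Suc.hyps(1)) auto
    then obtain st2 t2 where st2: "exec w (While e c) st1 = return_spmf (st2, t2)" "Inv N st2"
      "t2 \<le> (N - Suc i) * (T + 1) + 1" by blast
    have "exec w (While e c) st = return_spmf (st2, 1 + t1 + t2)"
      using e st1(1) st2(1) by (simp add: while_spmf.simps[of _ _ st])
    moreover have "N - i = Suc (N - Suc i)" using i by simp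
    ultimately show ?case
      using st1(2) st2 by (intro exI[of _ st2] exI[of _ "1 + t1 + t2"]) simp
  qed
  from this[of 0 st] st show ?thesis by simp
qed

section \<open>Out-degrees and heavy vertices\<close>

definition out_count :: "(nat \<times> nat) list \<Rightarrow> nat \<Rightarrow> nat" where
  "out_count es u = length (filter (\<lambda>e. fst e = u) es)"

lemma out_count_simps [simp]:
  "out_count [] u = 0"
  "out_count (es @ [e]) u = out_count es u + (if fst e = u then 1 else 0)"
  by (simp_all add: out_count_def)

lemma out_count_le_length: "out_count es u \<le> length es"
  by (simp add: out_count_def)

lemma sum_out_count: "finite H \<Longrightarrow> (\<Sum>u\<in>H. out_count es u) \<le> length es"
proof (induction es rule: rev_induct)
  case (snoc e es)
  have "(\<Sum>u\<in>H. if fst e = u then 1 else 0) \<le> (1 :: nat)"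
    using snoc.prems by (simp add: sum.delta)
  then show ?case using snoc by (simp add: sum.distrib)
qed simp

lemma finite_heavy: "finite {u. s < out_count es u}"
proof (rule finite_subset)
  show "{u. s < out_count es u} \<subseteq> fst ` set es"
  proof
    fix u assume "u \<in> {u. s < out_count es u}"
    then have "filter (\<lambda>e. fst e = u) es \<noteq> []" by (auto simp: out_count_def)
    then show "u \<in> fst ` set es" by (auto simp: filter_empty_conv)
  qed
qed simp

text \<open>Heavy vertices own disjoint sets of more than \<open>s\<close> arcs each. With
  \<open>length es < Suc s * Suc s\<close> there are at most \<open>s\<close> of them.\<close>

lemma card_heavy: "card {u. s < out_count es u} * Suc s \<le> length es"
proof -
  have "card {u. s < out_count es u} * Suc s = (\<Sum>u\<in>{u. s < out_count es u}. Suc s)" by simp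
  also have "\<dots> \<le> (\<Sum>u\<in>{u. s < out_count es u}. out_count es u)" by (rule sum_mono) simp
  also have "\<dots> \<le> length es" by (rule sum_out_count[OF finite_heavy])
  finally show ?thesis .
qed

text \<open>The dictionary after inserting the arcs \<open>es\<close>. Key tag 0 leads from an arc to its position
  in \<open>es\<close>, tag 6 to its rank among the arcs with the same tail, tag 2 from a vertex and a rank to
  the head of that arc, tag 3 from a vertex of out-degree above \<open>s\<close> to its position among these
  vertices, tag 4 back, tag 5 to the out-degree. Positions and ranks are stored incremented.\<close>

definition dict_ok :: "nat \<Rightarrow> (nat \<times> nat) list \<Rightarrow> nat \<Rightarrow> (nat list \<Rightarrow> nat) \<Rightarrow> bool" where
  "dict_ok s es h D \<longleftrightarrow>
     (\<forall>u v. (u, v) \<notin> set es \<longrightarrow> D [0, u, v] = 0) \<and>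
     (\<forall>j<length es. D [0, fst (es ! j), snd (es ! j)] = Suc j) \<and>
     (\<forall>u v. (u, v) \<in> set es \<longrightarrow> (\<exists>r<out_count es u. D [6, u, v] = Suc r \<and> D [2, u, r] = v)) \<and>
     (\<forall>u. s < out_count es u \<longrightarrow> (\<exists>k<h. D [3, u] = Suc k \<and> D [4, k] = u)) \<and>
     (\<forall>u. out_count es u \<le> s \<longrightarrow> D [3, u] = 0) \<and>
     h = card {u. s < out_count es u} \<and>
     (\<forall>u. D [5, u] = out_count es u)"

text \<open>The effect of one \<open>insert_arc\<close> on the dictionary. A vertex is entered among
  the heavy ones when its out-degree rises from \<open>s\<close> to \<open>s + 1\<close>, so the
  test \<open>r = s\<close> succeeds once per heavy vertex. Absent keys give 0, the right initial
  out-degree.\<close>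

definition dict_insert :: "nat \<Rightarrow> nat \<Rightarrow> nat \<Rightarrow> nat \<Rightarrow> nat \<Rightarrow> (nat list \<Rightarrow> nat) \<Rightarrow> nat list \<Rightarrow> nat" where
  "dict_insert s i u v h D =
    (let r = D [5, u];
       D1 = D([0, u, v] := Suc i, [6, u, v] := Suc r, [2, u, r] := v);
       D2 = (if r = s then D1([3, u] := Suc h, [4, h] := u) else D1)
     in D2([5, u] := Suc r))"

lemma dict_ok_insert:
  assumes ok: "dict_ok s es h D" and new: "(u, v) \<notin> set es"
  shows "dict_ok s (es @ [(u, v)]) (if D [5, u] = s then Suc h else h)
    (dict_insert s (length es) u v h D)"
proof -
  let ?es = "es @ [(u, v)]" and ?D = "dict_insert s (length es) u v h D"
  let ?h = "if D [5, u] = s then Suc h else h"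
  have cnt: "D [5, x] = out_count es x" for x using ok unfolding dict_ok_def by blast
  have D0: "?D [0, x, y] = (if x = u \<and> y = v then Suc (length es) else D [0, x, y])" for x y
    by (simp add: dict_insert_def Let_def)
  have D1: "?D [6, x, y] = (if x = u \<and> y = v then Suc (out_count es u) else D [6, x, y])" for x y
    by (simp add: dict_insert_def Let_def cnt)
  have D2: "?D [2, x, y] = (if x = u \<and> y = out_count es u then v else D [2, x, y])" for x y
    by (simp add: dict_insert_def Let_def cnt)
  have D3: "?D [3, x] = (if x = u \<and> out_count es u = s then Suc h else D [3, x])" for x
    by (simp add: dict_insert_def Let_def cnt)
  have D4: "?D [4, x] = (if x = h \<and> out_count es u = s then u else D [4, x])" for x
    by (simp add: dict_insert_def Let_def cnt)
  have D5: "?D [5, x] = (if x = u then Suc (out_count es u) else D [5, x])" for x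
    by (simp add: dict_insert_def Let_def cnt)
  have ok0: "D [0, x, y] = 0" if "(x, y) \<notin> set es" for x y
    using ok that unfolding dict_ok_def by blast
  have ok1: "D [0, fst (es ! j), snd (es ! j)] = Suc j" if "j < length es" for j
    using ok that unfolding dict_ok_def by blast
  have ok3: "D [3, x] = 0" if "out_count es x \<le> s" for x
    using ok that unfolding dict_ok_def by blast
  have h: "h = card {u. s < out_count es u}" using ok unfolding dict_ok_def by blast
  show ?thesis
    unfolding dict_ok_def
  proof (intro conjI allI impI ballI)
    show "?D [0, x, y] = 0" if "(x, y) \<notin> set ?es" for x y
      using that by (auto simp: D0 ok0)
    show "?D [0, fst (?es ! j), snd (?es ! j)] = Suc j" if "j < length ?es" for j
    proof (cases "j < length es")
      case True
      then have "es ! j \<noteq> (u, v)" using new nth_mem by metis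
      then have "\<not> (fst (es ! j) = u \<and> snd (es ! j) = v)" by (simp add: prod_eq_iff)
      then show ?thesis using True by (simp add: D0 nth_append ok1)
    next
      case False
      then show ?thesis using that by (simp add: D0 nth_append)
    qed
    show "\<exists>r<out_count ?es x. ?D [6, x, y] = Suc r \<and> ?D [2, x, r] = y"
      if e: "(x, y) \<in> set ?es" for x y
    proof (cases "(x, y) = (u, v)")
      case True
      then show ?thesis by (simp add: D1 D2)
    next
      case False
      then have mem: "(x, y) \<in> set es" using e by auto
      then obtain r where r: "r < out_count es x" "D [6, x, y] = Suc r" "D [2, x, r] = y"
        using ok unfolding dict_ok_def by blast
      have "\<not> (x = u \<and> y = v)" using mem new by auto
      then show ?thesis using r by (auto simp: D1 D2 intro!: exI[of _ r])
    qed
    show "\<exists>k<?h. ?D [3, x] = Suc k \<and> ?D [4, k] = x" if x: "s < out_count ?es x" for x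
    proof (cases "x = u \<and> out_count es u = s")
      case True
      then show ?thesis by (intro exI[of _ h]) (simp add: D3 D4 cnt)
    next
      case False
      then have "s < out_count es x" using x by (auto split: if_splits)
      then obtain k where "k < h" "D [3, x] = Suc k" "D [4, k] = x"
        using ok unfolding dict_ok_def by blast
      then show ?thesis using False by (intro exI[of _ k]) (auto simp: D3 D4)
    qed
    show "?D [3, x] = 0" if x: "out_count ?es x \<le> s" for x
      using x by (auto simp: D3 ok3 split: if_splits)
    show "?h = card {x. s < out_count ?es x}"
    proof (cases "out_count es u = s")
      case True
      then have "{x. s < out_count ?es x} = insert u {x. s < out_count es x}" by auto
      then show ?thesis using True h finite_heavy[of s es] by (simp add: cnt)
    next
      case False
      then have "{x. s < out_count ?es x} = {x. s < out_count es x}" by auto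
      then show ?thesis using False h by (simp add: cnt)
    qed
    show "?D [5, x] = out_count ?es x" for x by (simp add: D5 cnt)
  qed
qed

definition add_const :: "nat \<Rightarrow> nat \<Rightarrow> exp" where
  "add_const r k = Op Plus (Reg r) (Const k)"

definition insert_arc :: com where
  "insert_arc = Seq (Assign 10 (Load (Op Times (Const 2) (Reg 8))))
    (Seq (Assign 11 (Load (Op Plus (Op Times (Const 2) (Reg 8)) (Const 1))))
    (Seq (Assign 12 (Lookup [Const 5, Reg 10]))
    (Seq (Insert [Const 0, Reg 10, Reg 11] (add_const 8 1))
    (Seq (Insert [Const 6, Reg 10, Reg 11] (add_const 12 1))
    (Seq (Insert [Const 2, Reg 10, Reg 12] (Reg 11))
    (Seq (Cond (Op Equal (Reg 12) (Reg 7))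
       (Seq (Insert [Const 3, Reg 10] (add_const 9 1))
       (Seq (Insert [Const 4, Reg 9] (Reg 10)) (Assign 9 (add_const 9 1)))) Skip)
    (Seq (Insert [Const 5, Reg 10] (add_const 12 1)) (Assign 8 (add_const 8 1)))))))))"

text \<open>The number of arcs and the degree bound move to registers 5 and 6, since outputs occupy
  registers 0 to 4. Registers 7, 8 and 9 rely on their initial value 0 and become the integer square
  root, the arc counter and the number of heavy vertices. The linear search for the root takes at
  most as many rounds as there are arcs.\<close>

definition build_index :: com where
  "build_index = Seq (Assign 5 (Reg 0)) (Seq (Assign 6 (Reg 1))
    (Seq (While (Op Equal (Op Less (Reg 5) (Op Times (add_const 7 1) (add_const 7 1))) (Const 0))
       (Assign 7 (add_const 7 1)))
    (While (Op Less (Reg 8) (Reg 5)) insert_arc)))"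

text \<open>What an operation must preserve. All other registers and all cells behind the arcs are
  scratch space.\<close>

definition index_ready :: "nat \<Rightarrow> (nat \<times> nat) list \<Rightarrow> nat \<Rightarrow> nat \<Rightarrow> (nat list \<Rightarrow> nat) \<Rightarrow> machine \<Rightarrow> bool" where
  "index_ready w es l s D st \<longleftrightarrow> words w st \<and> regs st 5 = length es \<and> regs st 6 = l \<and> regs st 7 = s \<and>
     (\<forall>i<length es. mem st (2 * i) = fst (es ! i) \<and> mem st (2 * i + 1) = snd (es ! i)) \<and> dict st = D"

lemma build_index_correct:
  assumes es: "distinct es" "\<And>u v. (u, v) \<in> set es \<Longrightarrow> u < 2 ^ w \<and> v < 2 ^ w"
    and l: "l \<le> length es" "es \<noteq> []" and w: "(length es + 1) ^ 4 \<le> 2 ^ w"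
  shows "\<exists>st t D s h. exec w build_index (input_state l es) = return_spmf (st, t) \<and>
    t \<le> 20 * length es \<and> index_ready w es l s D st \<and> dict_ok s es h D \<and>
    s * s \<le> length es \<and> length es < Suc s * Suc s"
proof -
  let ?m = "length es"
  define s where "s = (GREATEST s. s * s \<le> ?m)"
  have sle: "k \<le> ?m" if "k * k \<le> ?m" for k :: nat using that le_square[of k] by linarith
  have s: "s * s \<le> ?m" unfolding s_def
    by (rule GreatestI_nat[of "\<lambda>s. s * s \<le> ?m" 0 ?m]) (auto intro: sle)
  have s': "?m < Suc s * Suc s"
  proof (rule ccontr)
    assume "\<not> ?thesis"
    then have "Suc s \<le> s" unfolding s_def
      by (intro Greatest_le_nat[of "\<lambda>s. s * s \<le> ?m" _ ?m]) (auto intro: sle simp: s_def)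
    then show False by simp
  qed
  have m1: "1 \<le> ?m" using l by (cases es) auto

  \<comment> \<open>Since \<open>length es + 1\<close> is at least 2, two of the four factors give
    the 4. The slack covers \<open>(s + 1) * (s + 1)\<close> in the root search and the address
    \<open>2 * i + 1\<close>, so nothing wraps around.\<close>
  have pw: "(?m + 1) * (?m + 1) * 4 \<le> 2 ^ w"
  proof -
    have "(2::nat) * 2 \<le> (?m + 1) * (?m + 1)" using m1 by (intro mult_mono) auto
    then have "(?m + 1) * (?m + 1) * 4 \<le> (?m + 1) * (?m + 1) * ((?m + 1) * (?m + 1))"
      by (intro mult_left_mono) auto
    also have "\<dots> = (?m + 1) ^ 4" by (simp only: power4_eq_xxxx mult.assoc)
    finally show ?thesis using w by simp
  qed
  have m2: "2 * 2 \<le> (?m + 1) * (?m + 1)" using m1 by (intro mult_mono) auto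
  have w16: "16 \<le> (2::nat) ^ w" using pw m2 by linarith
  have wpos: "0 < w" using w16 by (cases w) auto
  have msq: "?m + 1 \<le> (?m + 1) * (?m + 1)" by simp
  have "4 * (?m + 1) \<le> (?m + 1) * (?m + 1) * 4" using msq by simp
  then have m_w: "4 * (?m + 1) \<le> 2 ^ w" using pw by (rule order_trans)
  have lt_w: "k < 2 ^ w" if "k < 4 * (?m + 1)" for k using that m_w by (rule less_le_trans)
  have const: "k mod 2 ^ w = k" if "k < 16" for k :: nat using that w16 by simp
  have w0: "of_bool b mod 2 ^ w = (of_bool b :: nat)" for b using const[of "of_bool b"] by (cases b) auto
  define Inv0 where "Inv0 = (\<lambda>i st. st = (input_state l es)\<lparr>regs :=
    (regs (input_state l es))(5 := ?m, 6 := l, 7 := i)\<rparr>)"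
  have loop0: "\<exists>st' t. exec w (While (Op Equal (Op Less (Reg 5) (Op Times (add_const 7 1) (add_const 7 1))) (Const 0))
       (Assign 7 (add_const 7 1))) (input_state l es\<lparr>regs := (regs (input_state l es))(5 := ?m, 6 := l)\<rparr>)
     = return_spmf (st', t) \<and> Inv0 s st' \<and> t \<le> s * (1 + 1) + 1"
  proof (rule exec_while_det)
    have small: "i + 1 < 2 ^ w" "(i + 1) * (i + 1) < 2 ^ w" if "i \<le> s" for i
    proof -
      have "i \<le> ?m" using that sle[OF s] by simp
      then show "i + 1 < 2 ^ w" by (intro lt_w) simp
      have "(i + 1) * (i + 1) \<le> (?m + 1) * (?m + 1)" using \<open>i \<le> ?m\<close> by (intro mult_mono) auto
      then have "(i + 1) * (i + 1) < (?m + 1) * (?m + 1) * 4" by simp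
      then show "(i + 1) * (i + 1) < 2 ^ w" using pw by (rule less_le_trans)
    qed
    {
      fix i st assume i: "i < s" and st: "Inv0 i st"
      have "Suc i * Suc i \<le> s * s" using i by (intro mult_mono) auto
      then have "Suc i * Suc i \<le> ?m" using s by simp
      then show "eval w st (Op Equal (Op Less (Reg 5) (Op Times (add_const 7 1) (add_const 7 1))) (Const 0)) \<noteq> 0 \<and>
        (\<exists>st' t. exec w (Assign 7 (add_const 7 1)) st = return_spmf (st', t) \<and> t \<le> 1 \<and> Inv0 (Suc i) st')"
        using small[of i] i st wpos by (simp add: Inv0_def add_const_def const w0)
    next
      fix st assume st: "Inv0 s st"
      show "eval w st (Op Equal (Op Less (Reg 5) (Op Times (add_const 7 1) (add_const 7 1))) (Const 0)) = 0"
        using small[of s] s' st wpos by (simp add: Inv0_def add_const_def const w0)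
    next
      show "Inv0 0 (input_state l es\<lparr>regs := (regs (input_state l es))(5 := ?m, 6 := l)\<rparr>)"
        by (auto simp: Inv0_def input_state_def)
    }
  qed
  then obtain st0 t0 where st0: "Inv0 s st0" "t0 \<le> s * 2 + 1" and exec0: "exec w (While (Op Equal (Op Less (Reg 5)
       (Op Times (add_const 7 1) (add_const 7 1))) (Const 0)) (Assign 7 (add_const 7 1)))
     (input_state l es\<lparr>regs := (regs (input_state l es))(5 := ?m, 6 := l)\<rparr>) = return_spmf (st0, t0)"
    by auto
  define Inv where "Inv = (\<lambda>i st. words w st \<and> regs st 5 = ?m \<and> regs st 6 = l \<and> regs st 7 = s \<and>
    regs st 8 = i \<and> mem st = mem (input_state l es) \<and> dict_ok s (take i es) (regs st 9) (dict st))"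
  have mem_in: "mem (input_state l es) (2 * i) = fst (es ! i)"
    "mem (input_state l es) (Suc (2 * i)) = snd (es ! i)" if "i < ?m" for i
    using that by (simp_all add: input_state_def)
  have es_w: "fst (es ! i) < 2 ^ w" "snd (es ! i) < 2 ^ w" if "i < ?m" for i
    using es(2)[of "fst (es ! i)" "snd (es ! i)"] that by simp_all
  have "\<exists>st' t. exec w (While (Op Less (Reg 8) (Reg 5)) insert_arc) st0 = return_spmf (st', t) \<and>
      Inv ?m st' \<and> t \<le> ?m * (13 + 1) + 1"
  proof (rule exec_while_det)
    fix i st assume i: "i < ?m" and inv: "Inv i st"
    obtain u v where uv: "es ! i = (u, v)" by (cases "es ! i")
    have uvw: "u < 2 ^ w" "v < 2 ^ w" using es_w[OF i] uv by simp_all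
    have take: "take (Suc i) es = take i es @ [(u, v)]" "length (take i es) = i"
      using i uv by (simp_all add: take_Suc_conv_app_nth)
    have new: "(u, v) \<notin> set (take i es)"
      using es(1) i uv by (metis distinct_take not_distinct_conv_prefix take(1) distinct.simps(2) distinct_append disjoint_iff list.set_intros(1))
    define D where "D = dict st"
    define h where "h = regs st 9"
    have ok: "dict_ok s (take i es) h D" using inv by (simp add: Inv_def D_def h_def)
    have D5: "D [5, u] \<le> i" "h \<le> i"
    proof -
      show "D [5, u] \<le> i" using ok out_count_le_length[of "take i es" u] i by (simp add: dict_ok_def)
      have "h * Suc s \<le> i" using ok card_heavy[of s "take i es"] i by (simp add: dict_ok_def)
      then show "h \<le> i" by simp
    qed
    have lt: "Suc i < 2 ^ w" "Suc (D [5, u]) < 2 ^ w" "Suc h < 2 ^ w" "2 * i < 2 ^ w" "Suc (2 * i) < 2 ^ w"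
      by (rule lt_w; use D5 i in simp)+
    have R: "regs st 5 = ?m" "regs st 6 = l" "regs st 7 = s" "regs st 8 = i" "regs st 9 = h"
      "mem st (2 * i) = u" "mem st (Suc (2 * i)) = v" "dict st = D"
      using inv mem_in[OF i] uv by (simp_all add: Inv_def h_def D_def)
    define rs where "rs = (regs st)(10 := u, 11 := v, 12 := D [5, u])"
    define st' where "st' = st\<lparr>regs := (if D [5, u] = s then rs(9 := Suc h) else rs)(8 := Suc i),
      dict := dict_insert s i u v h D\<rparr>"
    have ex: "\<exists>t\<le>13. exec w insert_arc st = return_spmf (st', t)"
    proof (cases "D [5, u] = s")
      case True
      then show ?thesis
        using lt R wpos unfolding insert_arc_def
        by (simp add: add_const_def const w0 st'_def rs_def dict_insert_def Let_def)
    next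
      case False
      then show ?thesis
        using lt R wpos unfolding insert_arc_def
        by (simp add: add_const_def const w0 st'_def rs_def dict_insert_def Let_def)
    qed
    have "words w st'"
    proof -
      have W: "words w st" using inv by (simp only: Inv_def)
      have "dict_insert s i u v h D k < 2 ^ w" for k
        using inv lt uvw by (auto simp: dict_insert_def Let_def Inv_def words_def D_def)
      then show ?thesis
        using W lt uvw by (simp add: st'_def rs_def words_def)
    qed
    moreover have "dict_ok s (take (Suc i) es) (regs st' 9) (dict st')"
      using dict_ok_insert[OF ok new, unfolded take(2)] take(1) R(5)
      by (cases "D [5, u] = s") (simp_all add: st'_def rs_def)
    ultimately have "Inv (Suc i) st'" using inv by (simp add: Inv_def st'_def rs_def)
    then show "eval w st (Op Less (Reg 8) (Reg 5)) \<noteq> 0 \<and>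
        (\<exists>st' t. exec w insert_arc st = return_spmf (st', t) \<and> t \<le> 13 \<and> Inv (Suc i) st')"
      using ex R i wpos by (auto simp: w0)
  next
    fix st assume "Inv ?m st"
    then show "eval w st (Op Less (Reg 8) (Reg 5)) = 0" by (simp add: Inv_def)
  next
    have "l < 2 ^ w" "s < 2 ^ w" "?m < 2 ^ w" by (rule lt_w; use l(1) sle[OF s] in simp)+
    then have "words w st0"
      using st0(1) es_w by (auto simp: Inv0_def words_def input_state_def)
    then show "Inv 0 st0"
      using st0(1) by (simp add: Inv_def Inv0_def input_state_def dict_ok_def)
  qed
  then obtain st1 t1 where st1: "Inv ?m st1" "t1 \<le> ?m * 14 + 1"
    and exec1: "exec w (While (Op Less (Reg 8) (Reg 5)) insert_arc) st0 = return_spmf (st1, t1)"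
    by auto
  have in0: "regs (input_state l es) 0 = ?m" "regs (input_state l es) 1 = l" by (simp_all add: input_state_def)
  have "exec w build_index (input_state l es) = return_spmf (st1, 1 + (1 + (t0 + t1)))"
    unfolding build_index_def using exec0 exec1 in0 by (simp del: exec.simps(8))
  \<comment> \<open>Two assignments, at most \<open>2 * s + 1\<close> for the root and
    \<open>14 * ?m + 1\<close> for the arcs, with \<open>s \<le> ?m\<close> and
    \<open>1 \<le> ?m\<close>: at most \<open>16 * ?m + 4\<close> in all.\<close>
  moreover have "1 + (1 + (t0 + t1)) \<le> 20 * ?m" using st0(2) st1(2) sle[OF s] m1 by linarith
  moreover have "index_ready w es l s (dict st1) st1"
    using st1(1) mem_in by (simp add: Inv_def index_ready_def)
  moreover have "dict_ok s es (regs st1 9) (dict st1)" using st1(1) by (simp add: Inv_def)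
  ultimately show ?thesis using s s' by blast
qed

section \<open>Codes of embeddings\<close>

lemma eval_op_lt:
  assumes "a < 2 ^ w" "b < 2 ^ w"
  shows "eval_op w f a b < 2 ^ w"
proof (cases f)
  case Minus
  then show ?thesis using assms by (simp add: less_imp_diff_less)
next
  case Div
  then show ?thesis using assms by (simp add: le_less_trans[OF div_le_dividend])
next
  case Mod
  then show ?thesis using assms by (simp add: le_less_trans[OF mod_less_eq_dividend])
qed simp_all

lemma eval_lt: "words w st \<Longrightarrow> eval w st e < 2 ^ w"
proof (induction e)
  case (Op f e1 e2)
  then show ?case by (simp add: eval_op_lt)
qed (simp_all add: words_def)

text \<open>Expressions have no conditional, so a truth value selects a branch by multiplication.
  Both branches are evaluated; the rejected one may be junk.\<close>

definition if_exp :: "exp \<Rightarrow> exp \<Rightarrow> exp \<Rightarrow> exp" where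
  "if_exp b e1 e2 = Op Plus (Op Times b e1) (Op Times (Op Minus (Const 1) b) e2)"

lemma eval_if_exp:
  assumes "words w st" "0 < w" "eval w st b = of_bool c"
  shows "eval w st (if_exp b e1 e2) = (if c then eval w st e1 else eval w st e2)"
  using assms eval_lt[OF assms(1), of e1] eval_lt[OF assms(1), of e2]
  by (cases c) (simp_all add: if_exp_def)

definition select_exp :: "('i \<Rightarrow> exp) \<Rightarrow> ('i \<Rightarrow> exp) \<Rightarrow> 'i list \<Rightarrow> exp" where
  "select_exp b f is = foldr (\<lambda>i e. if_exp (b i) (f i) e) is (Const 0)"

lemma eval_select_exp:
  assumes w: "words w st" "0 < w" and j: "j \<in> set is"
    and b: "\<And>i. i \<in> set is \<Longrightarrow> eval w st (b i) = of_bool (i = j)"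
  shows "eval w st (select_exp b f is) = eval w st (f j)"
  using j b
proof (induction "is")
  case (Cons i "is")
  show ?case
  proof (cases "i = j")
    case True
    have "eval w st (select_exp b f (i # is)) = eval w st (if_exp (b i) (f i) (select_exp b f is))"
      by (simp add: select_exp_def)
    also have "\<dots> = eval w st (f i)"
      using eval_if_exp[OF w, of "b i" True] Cons.prems(2)[of i] True by simp
    finally show ?thesis using True by simp
  next
    case False
    have "eval w st (select_exp b f (i # is)) = eval w st (if_exp (b i) (f i) (select_exp b f is))"
      by (simp add: select_exp_def)
    also have "\<dots> = eval w st (select_exp b f is)"
      using eval_if_exp[OF w, of "b i" False] Cons.prems(2)[of i] False by simp
    also have "\<dots> = eval w st (f j)" using Cons False by auto
    finally show ?thesis .
  qed
qed simp

definition conj_exp :: "exp list \<Rightarrow> exp" where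
  "conj_exp bs = foldr (Op Times) bs (Const 1)"

lemma eval_conj_exp:
  assumes "0 < w" "\<And>b. b \<in> set bs \<Longrightarrow> eval w st b \<in> {0, 1}"
  shows "eval w st (conj_exp bs) = of_bool (\<forall>b\<in>set bs. eval w st b = 1)"
  using assms(2)
proof (induction bs)
  case Nil
  then show ?case using assms(1) by (simp add: conj_exp_def)
next
  case (Cons b bs)
  have "eval w st (conj_exp (b # bs)) = (eval w st b * eval w st (conj_exp bs)) mod 2 ^ w"
    by (simp add: conj_exp_def)
  also have "\<dots> = of_bool (\<forall>b\<in>set (b # bs). eval w st b = 1)"
  proof (cases "eval w st b = 1")
    case True
    then show ?thesis using Cons assms(1) by auto
  next
    case False
    then have "eval w st b = 0" using Cons.prems[of b] by simp
    then show ?thesis by simp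
  qed
  finally show ?case .
qed

section \<open>Mixed-radix codes of embeddings\<close>

fun base_reg :: "'p atom \<Rightarrow> nat" where
  "base_reg (ArcAtom x y) = 5"
| "base_reg (NbrAtom x y) = 6"
| "base_reg (LightAtom x y) = 7"
| "base_reg (HeavyAtom x) = 7"

fun assign_exp :: "'p atom \<Rightarrow> exp \<Rightarrow> ('p \<Rightarrow> exp) \<Rightarrow> 'p \<Rightarrow> exp" where
  "assign_exp (ArcAtom x y) d env = env(x := Load (Op Times (Const 2) d),
     y := Load (Op Plus (Op Times (Const 2) d) (Const 1)))"
| "assign_exp (NbrAtom x y) d env = env(y := Lookup [Const 2, env x, d])"
| "assign_exp (LightAtom x y) d env = env(y := Lookup [Const 2, env x, d])"
| "assign_exp (HeavyAtom x) d env = env(x := Lookup [Const 4, d])"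

fun digit_exp :: "'p atom \<Rightarrow> ('p \<Rightarrow> exp) \<Rightarrow> exp" where
  "digit_exp (ArcAtom x y) g = Op Minus (Lookup [Const 0, g x, g y]) (Const 1)"
| "digit_exp (NbrAtom x y) g = Op Minus (Lookup [Const 6, g x, g y]) (Const 1)"
| "digit_exp (LightAtom x y) g = Op Minus (Lookup [Const 6, g x, g y]) (Const 1)"
| "digit_exp (HeavyAtom x) g = Op Minus (Lookup [Const 3, g x]) (Const 1)"

text \<open>A mixed-radix number with one digit per atom, the first atom being the least
  significant. \<open>env\<close> gives for each pattern vertex an expression for its image, so
  decoding is a symbolic substitution that takes place in the program text.\<close>

fun decode_exp :: "'p atom list \<Rightarrow> exp \<Rightarrow> ('p \<Rightarrow> exp) \<Rightarrow> 'p \<Rightarrow> exp" where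
  "decode_exp [] c env = env"
| "decode_exp (a # as) c env =
     decode_exp as (Op Div c (Reg (base_reg a))) (assign_exp a (Op Mod c (Reg (base_reg a))) env)"

fun encode_exp :: "'p atom list \<Rightarrow> ('p \<Rightarrow> exp) \<Rightarrow> exp" where
  "encode_exp [] g = Const 0"
| "encode_exp (a # as) g =
     Op Plus (digit_exp a g) (Op Times (Reg (base_reg a)) (encode_exp as g))"

fun atom_verts :: "'p atom \<Rightarrow> 'p set" where
  "atom_verts (ArcAtom x y) = {x, y}"
| "atom_verts (NbrAtom x y) = {x, y}"
| "atom_verts (LightAtom x y) = {x, y}"
| "atom_verts (HeavyAtom x) = {x}"

locale graph_index =
  fixes w :: nat and es :: "(nat \<times> nat) list" and l s h :: nat and D :: "nat list \<Rightarrow> nat"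
  assumes es: "distinct es" "es \<noteq> []" and l: "1 \<le> l" "l \<le> length es"
    and degree: "out_count es u \<le> l"
    and s: "s * s \<le> length es" "length es < Suc s * Suc s"
    and D: "dict_ok s es h D"
    and word: "16 \<le> (2::nat) ^ w" "2 * length es < 2 ^ w"
begin

abbreviation ready :: "machine \<Rightarrow> bool" where
  "ready st \<equiv> index_ready w es l s D st"

lemma w_pos: "0 < w"
  using word(1) by (cases w) auto

lemma const_mod: "k < 16 \<Longrightarrow> k mod 2 ^ w = (k::nat)"
  using word(1) by simp

lemma ready_words: "ready st \<Longrightarrow> words w st"
  by (simp add: index_ready_def)

fun base :: "'p atom \<Rightarrow> nat" where
  "base a = kind_base (length es) l s (atom_kind a)"

fun digit :: "'p atom \<Rightarrow> ('p \<Rightarrow> nat) \<Rightarrow> nat" where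
  "digit (ArcAtom x y) g = D [0, g x, g y] - 1"
| "digit (NbrAtom x y) g = D [6, g x, g y] - 1"
| "digit (LightAtom x y) g = D [6, g x, g y] - 1"
| "digit (HeavyAtom x) g = D [3, g x] - 1"

fun code :: "'p atom list \<Rightarrow> ('p \<Rightarrow> nat) \<Rightarrow> nat" where
  "code [] g = 0"
| "code (a # as) g = digit a g + base a * code as g"

definition vol :: "'p atom list \<Rightarrow> nat" where
  "vol as = volume (length es) l s (mset (map atom_kind as))"

lemma vol_simps [simp]: "vol [] = 1" "vol (a # as) = base a * vol as"
  by (simp_all add: vol_def volume_def)

lemma s_pos: "1 \<le> s"
proof (rule ccontr)
  assume "\<not> 1 \<le> s"
  then have "s = 0" by simp
  then show False using s(2) l by simp
qed

lemma base_pos: "1 \<le> base a"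
  using l s_pos by (cases a) auto

lemma vol_pos: "1 \<le> vol as"
proof (induction as)
  case (Cons a as)
  then have "1 * 1 \<le> base a * vol as" using base_pos[of a] by (intro mult_mono) auto
  then show ?case by simp
qed simp

definition realizes :: "('p \<times> 'p) set \<Rightarrow> 'p set \<Rightarrow> ('p \<Rightarrow> nat) \<Rightarrow> bool" where
  "realizes E S g \<longleftrightarrow> (\<forall>(x, y)\<in>E. (g x, g y) \<in> set es) \<and>
     (\<forall>(x, y)\<in>E. x \<notin> S \<longrightarrow> D [3, g x] = 0) \<and> (\<forall>x\<in>S. D [3, g x] \<noteq> 0)"

lemma arc_index:
  assumes "(u, v) \<in> set es"
  shows "\<exists>j<length es. D [0, u, v] = Suc j \<and> es ! j = (u, v)"
proof -
  obtain j where "j < length es" "es ! j = (u, v)" using assms by (metis in_set_conv_nth)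
  moreover have "D [0, fst (es ! j), snd (es ! j)] = Suc j"
    using D \<open>j < length es\<close> unfolding dict_ok_def by blast
  ultimately show ?thesis by auto
qed

lemma non_arc: "(u, v) \<notin> set es \<Longrightarrow> D [0, u, v] = 0"
  using D unfolding dict_ok_def by blast

lemma nbr_index:
  assumes "(u, v) \<in> set es"
  shows "\<exists>r<out_count es u. D [6, u, v] = Suc r \<and> D [2, u, r] = v"
  using D assms unfolding dict_ok_def by blast

lemma heavy_index:
  assumes "D [3, u] \<noteq> 0"
  shows "\<exists>k<s. D [3, u] = Suc k \<and> D [4, k] = u"
proof -
  have "s < out_count es u"
  proof (rule ccontr)
    assume "\<not> ?thesis"
    then have "D [3, u] = 0" using D unfolding dict_ok_def by (meson not_less)
    with assms show False by simp
  qed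
  then obtain k where k: "k < h" "D [3, u] = Suc k" "D [4, k] = u"
    using D unfolding dict_ok_def by blast
  have "h = card {u. s < out_count es u}" using D unfolding dict_ok_def by blast
  \<comment> \<open>\<open>h\<close> heavy vertices own at least \<open>h * Suc s\<close> arcs, so
    \<open>h \<le> s\<close>. This is why the base \<open>s\<close> suffices for
    \<open>HeavyAtom\<close> as it does for \<open>LightAtom\<close>.\<close>
  then have "h * Suc s < Suc s * Suc s" using card_heavy[of s es] s(2) by simp
  then have "h < Suc s" using mult_less_cancel2[of h "Suc s" "Suc s"] by blast
  then show ?thesis using k by (intro exI[of _ k]) auto
qed

lemma light_count:
  assumes "D [3, u] = 0"
  shows "out_count es u \<le> s"
proof (rule ccontr)
  assume "\<not> ?thesis"
  then have "s < out_count es u" by simp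
  then obtain k where "D [3, u] = Suc k" using D unfolding dict_ok_def by blast
  with assms show False by simp
qed

lemma digit_lt:
  assumes a: "atom_ok E S a" and g: "realizes E S g"
  shows "digit a g < base a"
proof (cases a)
  case (ArcAtom x y)
  then have "(g x, g y) \<in> set es" using a g by (auto simp: realizes_def)
  from arc_index[OF this] ArcAtom show ?thesis by auto
next
  case (NbrAtom x y)
  then have "(g x, g y) \<in> set es" using a g by (auto simp: realizes_def)
  from nbr_index[OF this] degree[of "g x"] NbrAtom show ?thesis by auto
next
  case (LightAtom x y)
  then have "(g x, g y) \<in> set es" "D [3, g x] = 0" using a g by (auto simp: realizes_def)
  from nbr_index[OF this(1)] light_count[OF this(2)] LightAtom show ?thesis by auto
next
  case (HeavyAtom x)
  then have "D [3, g x] \<noteq> 0" using a g by (auto simp: realizes_def)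
  from heavy_index[OF this] HeavyAtom show ?thesis by auto
qed

lemma code_lt:
  assumes as: "\<forall>a\<in>set as. atom_ok E S a" and g: "realizes E S g"
  shows "code as g < vol as"
  using as
proof (induction as)
  case (Cons a as)
  have "digit a g + base a * code as g < base a + base a * code as g"
    using digit_lt[of E S a g] Cons.prems g by simp
  also have "\<dots> = base a * Suc (code as g)" by simp
  also have "\<dots> \<le> base a * vol as" using Cons by (intro mult_left_mono) auto
  finally show ?case by simp
qed simp

lemma eval_base: "ready st \<Longrightarrow> eval w st (Reg (base_reg a)) = base a"
  by (cases a) (simp_all add: index_ready_def)

lemma eval_digit:
  assumes st: "ready st" and env: "\<And>v. v \<in> atom_verts a \<Longrightarrow> eval w st (env v) = g v"
  shows "eval w st (digit_exp a env) = digit a g"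
  using st env w_pos by (cases a) (simp_all add: index_ready_def const_mod)

lemma eval_encode:
  assumes st: "ready st" and as: "\<forall>a\<in>set as. atom_ok E S a" and g: "realizes E S g"
    and env: "\<And>a v. a \<in> set as \<Longrightarrow> v \<in> atom_verts a \<Longrightarrow> eval w st (env v) = g v"
    and vol: "vol as \<le> 2 ^ w"
  shows "eval w st (encode_exp as env) = code as g"
  using as env vol
proof (induction as)
  case (Cons a as)
  have "1 * vol as \<le> base a * vol as" using base_pos by (rule mult_right_mono) simp
  from order_trans[OF this] have "vol as \<le> 2 ^ w"
    using Cons.prems(3) by (simp only: vol_simps mult_1)
  then have IH: "eval w st (encode_exp as env) = code as g"
    using Cons.prems(1) by (intro Cons.IH Cons.prems(2)) simp_all
  have d: "eval w st (digit_exp a env) = digit a g"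
    using Cons.prems(2) by (intro eval_digit st) auto
  \<comment> \<open>The final value is below the word size, and with it every intermediate one, so
    no operation wraps around.\<close>
  have "code (a # as) g < 2 ^ w" using code_lt[OF Cons.prems(1) g] Cons.prems(3) by (rule less_le_trans)
  then have "digit a g + base a * code as g < 2 ^ w" "base a * code as g < 2 ^ w" by simp_all
  then show ?case using IH d eval_base[OF st, of a] by simp
qed simp

text \<open>A vertex placed earlier may be written again; as the digit stems from \<open>g\<close>,
  the new value is \<open>g v\<close> once more.\<close>

lemma eval_assign:
  assumes st: "ready st" and a: "atom_ok E S a" and g: "realizes E S g"
    and d: "eval w st d = digit a g" and n: "needs a \<subseteq> X"
    and env: "\<And>v. v \<in> X \<Longrightarrow> eval w st (env v) = g v" and v: "v \<in> X \<union> provides a"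
  shows "eval w st (assign_exp a d env v) = g v"
proof (cases a)
  case (ArcAtom x y)
  then have "(g x, g y) \<in> set es" using a g by (auto simp: realizes_def)
  from arc_index[OF this] obtain j where j: "j < length es" "D [0, g x, g y] = Suc j" "es ! j = (g x, g y)"
    by blast
  have "eval w st d = j" using d j ArcAtom by simp
  moreover have "2 * j < 2 ^ w" "Suc (2 * j) < 2 ^ w"
    by (rule less_trans[OF _ word(2)]; use j(1) in simp)
      (rule le_less_trans[OF _ word(2)]; use j(1) in simp)
  moreover have "mem st (2 * j) = g x" "mem st (Suc (2 * j)) = g y"
    using st j by (simp_all add: index_ready_def)
  ultimately show ?thesis
    using ArcAtom v env w_pos by (auto simp: const_mod)
next
  case (NbrAtom x y)
  then have "(g x, g y) \<in> set es" using a g by (auto simp: realizes_def)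
  from nbr_index[OF this] NbrAtom d v env n st show ?thesis
    by (auto simp: const_mod index_ready_def)
next
  case (LightAtom x y)
  then have "(g x, g y) \<in> set es" using a g by (auto simp: realizes_def)
  from nbr_index[OF this] LightAtom d v env n st show ?thesis
    by (auto simp: const_mod index_ready_def)
next
  case (HeavyAtom x)
  then have "D [3, g x] \<noteq> 0" using a g by (auto simp: realizes_def)
  from heavy_index[OF this] HeavyAtom d v env st show ?thesis
    by (auto simp: const_mod index_ready_def)
qed

lemma eval_decode:
  assumes st: "ready st" and g: "realizes E S g"
    and "\<forall>a\<in>set as. atom_ok E S a" "ordered_plan X as" "eval w st c = code as g"
    and "\<And>v. v \<in> X \<Longrightarrow> eval w st (env v) = g v" "v \<in> X \<union> covered as"
  shows "eval w st (decode_exp as c env v) = g v"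
  using assms(3-)
proof (induction as arbitrary: X c env)
  case (Cons a as)
  have a: "atom_ok E S a" using Cons.prems(1) by simp
  have lt: "digit a g < base a" using a g by (rule digit_lt)
  let ?b = "Reg (base_reg a)"
  have d: "eval w st (Op Mod c ?b) = digit a g" "eval w st (Op Div c ?b) = code as g"
    using lt Cons.prems(3) eval_base[OF st, of a] by simp_all
  have "eval w st (decode_exp as (Op Div c ?b) (assign_exp a (Op Mod c ?b) env) v) = g v"
  proof (rule Cons.IH[of "X \<union> provides a"])
    show "eval w st (assign_exp a (Op Mod c ?b) env x) = g x" if "x \<in> X \<union> provides a" for x
      using Cons.prems(2,4) that by (intro eval_assign[OF st a g d(1)]) auto
  qed (use Cons.prems d in auto)
  then show ?case by simp
qed simp

end

section \<open>Recognising the code of an embedding\<close>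

definition total_decode :: "'p set list \<Rightarrow> (nat \<Rightarrow> 'p atom list) \<Rightarrow> exp \<Rightarrow> 'p \<Rightarrow> exp" where
  "total_decode Ss pl c v =
     select_exp (\<lambda>i. Op Equal (Op Mod c (Const (length Ss))) (Const i))
       (\<lambda>i. decode_exp (pl i) (Op Div c (Const (length Ss))) (\<lambda>_. Const 0) v) [0..<length Ss]"

definition heavy_guard :: "'p list \<Rightarrow> 'p set \<Rightarrow> ('p \<Rightarrow> exp) \<Rightarrow> exp" where
  "heavy_guard vs S env = conj_exp (map (\<lambda>v. Op Equal (Op Equal (Lookup [Const 3, env v]) (Const 0))
     (Const (if v \<in> S then 0 else 1))) vs)"

text \<open>When \<open>Ss\<close> enumerates all subsets, exactly one guard holds, that of the
  actual heavy set, so an embedding gets a single code whatever guess the number started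
  from.\<close>

definition total_encode :: "'p list \<Rightarrow> 'p set list \<Rightarrow> (nat \<Rightarrow> 'p atom list) \<Rightarrow> ('p \<Rightarrow> exp) \<Rightarrow> exp" where
  "total_encode vs Ss pl env =
     select_exp (\<lambda>i. heavy_guard vs (Ss ! i) env)
       (\<lambda>i. Op Plus (Op Times (encode_exp (pl i) env) (Const (length Ss))) (Const i)) [0..<length Ss]"

text \<open>Several numbers can decode to the same embedding, for instance through a wrong guess of
  the heavy set or a digit whose effect is overwritten later. Comparing \<open>c\<close> with the
  re-encoded result keeps exactly one of them.\<close>

definition valid_exp ::
    "'p list \<Rightarrow> ('p \<times> 'p) list \<Rightarrow> 'p set list \<Rightarrow> (nat \<Rightarrow> 'p atom list) \<Rightarrow> exp \<Rightarrow> exp" where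
  "valid_exp vs pa Ss pl c = (let d = total_decode Ss pl c in
     conj_exp (Op Equal c (total_encode vs Ss pl d) #
       map (\<lambda>(x, y). Op Less (Const 0) (Lookup [Const 0, d x, d y])) pa @
       map (\<lambda>(x, y). Op Equal (Op Equal (d x) (d y)) (Const 0))
         (filter (\<lambda>(x, y). x \<noteq> y) (List.product vs vs))))"

locale pattern_coder = graph_index w es l s h D
  for w :: nat and es :: "(nat \<times> nat) list" and l s h :: nat and D :: "nat list \<Rightarrow> nat" +
  fixes vs :: "'p list" and pa :: "('p \<times> 'p) list" and Ss :: "'p set list"
    and pl :: "nat \<Rightarrow> 'p atom list" and K :: "kind multiset"
  assumes arcs: "set pa \<subseteq> set vs \<times> set vs"
    and Ss: "set Ss = Pow (set vs)" "distinct Ss"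
    and pl: "i < length Ss \<Longrightarrow> plan_for (set pa) (Ss ! i) K (set vs) (pl i)"
    and size: "length Ss * volume (length es) l s K < 2 ^ w"
begin

text \<open>Extensionality picks one function per map on \<open>vs\<close>, so that embeddings can
  be counted.\<close>

definition embeddings :: "('p \<Rightarrow> nat) set" where
  "embeddings = {g \<in> extensional (set vs). inj_on g (set vs) \<and> (\<forall>(x, y)\<in>set pa. (g x, g y) \<in> set es)}"

definition heavy :: "('p \<Rightarrow> nat) \<Rightarrow> 'p set" where
  "heavy g = {v\<in>set vs. D [3, g v] \<noteq> 0}"

definition heavy_pos :: "('p \<Rightarrow> nat) \<Rightarrow> nat" where
  "heavy_pos g = (SOME i. i < length Ss \<and> Ss ! i = heavy g)"

definition total_code :: "('p \<Rightarrow> nat) \<Rightarrow> nat" where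
  "total_code g = code (pl (heavy_pos g)) g * length Ss + heavy_pos g"

definition code_space :: nat where
  "code_space = length Ss * volume (length es) l s K"

lemma heavy_pos: "heavy_pos g < length Ss" "Ss ! heavy_pos g = heavy g"
proof -
  have "heavy g \<in> set Ss" using Ss(1) by (auto simp: heavy_def)
  then have "\<exists>i. i < length Ss \<and> Ss ! i = heavy g" by (metis in_set_conv_nth)
  then have "heavy_pos g < length Ss \<and> Ss ! heavy_pos g = heavy g"
    unfolding heavy_pos_def by (rule someI_ex)
  then show "heavy_pos g < length Ss" "Ss ! heavy_pos g = heavy g" by blast+
qed

lemma heavy_pos_unique: "i < length Ss \<Longrightarrow> Ss ! i = heavy g \<longleftrightarrow> i = heavy_pos g"
  using heavy_pos[of g] Ss(2) by (metis nth_eq_iff_index_eq)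

lemma realizes_heavy: "g \<in> embeddings \<Longrightarrow> realizes (set pa) (heavy g) g"
  using arcs by (auto simp: realizes_def embeddings_def heavy_def)

lemma plan_props:
  assumes "i < length Ss"
  shows "\<forall>a\<in>set (pl i). atom_ok (set pa) (Ss ! i) a" "ordered_plan {} (pl i)"
    "set vs \<subseteq> covered (pl i)" "vol (pl i) = volume (length es) l s K"
  using pl[OF assms] by (auto simp: plan_for_def vol_def)

lemma atom_verts_sub:
  assumes "i < length Ss" "a \<in> set (pl i)"
  shows "atom_verts a \<subseteq> set vs"
proof -
  have "atom_ok (set pa) (Ss ! i) a" using plan_props(1)[OF assms(1)] assms(2) by blast
  moreover have "Ss ! i \<subseteq> set vs" using Ss(1) assms(1) nth_mem by fastforce
  ultimately show ?thesis using arcs by (cases a) auto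
qed

lemma total_code_lt:
  assumes g: "g \<in> embeddings"
  shows "total_code g < code_space"
proof -
  have "code (pl (heavy_pos g)) g < volume (length es) l s K"
    using code_lt[OF plan_props(1)[OF heavy_pos(1)], of g g] realizes_heavy[OF g]
      plan_props(4)[OF heavy_pos(1)] heavy_pos(2) by simp
  then have "Suc (code (pl (heavy_pos g)) g) * length Ss \<le> volume (length es) l s K * length Ss"
    by (intro mult_right_mono) auto
  then show ?thesis
    using heavy_pos(1)[of g] by (simp add: total_code_def code_space_def mult.commute)
qed

lemma vol_pos': "1 \<le> volume (length es) l s K"
  using vol_pos plan_props(4)[OF heavy_pos(1)] by metis

lemma length_Ss_lt: "length Ss < 2 ^ w"
proof -
  have "length Ss * 1 \<le> length Ss * volume (length es) l s K"
    using vol_pos' by (rule mult_left_mono) simp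
  also note size
  finally show ?thesis by simp
qed

lemma vol_le: "i < length Ss \<Longrightarrow> vol (pl i) \<le> 2 ^ w"
proof -
  assume i: "i < length Ss"
  have "1 * volume (length es) l s K \<le> length Ss * volume (length es) l s K"
    using i by (intro mult_right_mono) auto
  also note size
  finally show ?thesis using plan_props(4)[OF i] by simp
qed

lemma Ss_ne: "Ss \<noteq> []"
  using heavy_pos(1)[of undefined] by auto

lemma code_space_pos: "0 < code_space"
  using vol_pos' Ss_ne by (simp add: code_space_def)

lemma eval_total_decode:
  assumes st: "ready st" and g: "g \<in> embeddings" and c: "eval w st c = total_code g"
    and v: "v \<in> set vs"
  shows "eval w st (total_decode Ss pl c v) = g v"
proof -
  let ?L = "length Ss" and ?i = "heavy_pos g"
  have L: "?L mod 2 ^ w = ?L" using length_Ss_lt by simp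
  have i: "?i < ?L" by (rule heavy_pos(1))
  have "total_code g mod ?L = ?i" "total_code g div ?L = code (pl ?i) g"
    using i Ss_ne by (simp_all add: total_code_def)
  then have dm: "eval w st (Op Mod c (Const ?L)) = ?i" "eval w st (Op Div c (Const ?L)) = code (pl ?i) g"
    using c L by simp_all
  have "eval w st (total_decode Ss pl c v) =
      eval w st (decode_exp (pl ?i) (Op Div c (Const ?L)) (\<lambda>_. Const 0) v)"
    unfolding total_decode_def
  proof (rule eval_select_exp[OF ready_words[OF st] w_pos])
    fix i assume "i \<in> set [0..<?L]"
    then have "i mod 2 ^ w = i" using length_Ss_lt by simp
    then show "eval w st (Op Equal (Op Mod c (Const ?L)) (Const i)) = of_bool (i = ?i)"
      using dm(1) w_pos by (auto simp del: eval.simps(1) simp: eval.simps(1)[of w st i])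
  qed (use i in simp)
  also have "\<dots> = g v"
    using plan_props[OF i] realizes_heavy[OF g] heavy_pos(2)[of g] dm(2) v
    by (intro eval_decode[OF st, of "set pa" "heavy g" g "pl ?i" "{}"]) auto
  finally show ?thesis .
qed

lemma eval_total_encode:
  assumes st: "ready st" and g: "g \<in> embeddings" and env: "\<And>v. v \<in> set vs \<Longrightarrow> eval w st (env v) = g v"
  shows "eval w st (total_encode vs Ss pl env) = total_code g"
proof -
  let ?L = "length Ss" and ?i = "heavy_pos g"
  have L: "?L mod 2 ^ w = ?L" using length_Ss_lt by simp
  have i: "?i < ?L" by (rule heavy_pos(1))
  have iL: "?i mod 2 ^ w = ?i" using i length_Ss_lt by simp
  have "eval w st (total_encode vs Ss pl env) =
      eval w st (Op Plus (Op Times (encode_exp (pl ?i) env) (Const ?L)) (Const ?i))"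
    unfolding total_encode_def
  proof (rule eval_select_exp[OF ready_words[OF st] w_pos])
    fix i assume i: "i \<in> set [0..<?L]"
    have S: "Ss ! i \<subseteq> set vs" using Ss(1) i nth_mem[of i Ss] by auto
    have guard: "eval w st (Op Equal (Op Equal (Lookup [Const 3, env v]) (Const 0)) (Const (if v \<in> Ss ! i then 0 else 1)))
        = of_bool (v \<in> heavy g \<longleftrightarrow> v \<in> Ss ! i)" if "v \<in> set vs" for v
      using env[OF that] st that w_pos by (auto simp: index_ready_def const_mod heavy_def)
    let ?b = "\<lambda>v. Op Equal (Op Equal (Lookup [Const 3, env v]) (Const 0))
      (Const (if v \<in> Ss ! i then 0 else 1))"
    have "eval w st (heavy_guard vs (Ss ! i) env) = of_bool (\<forall>b\<in>set (map ?b vs). eval w st b = 1)"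
      unfolding heavy_guard_def
    proof (rule eval_conj_exp[OF w_pos])
      fix b assume "b \<in> set (map ?b vs)"
      then obtain v where v: "v \<in> set vs" and b: "b = ?b v" by auto
      show "eval w st b \<in> {0, 1}" unfolding b guard[OF v] by simp
    qed
    also have "(\<forall>b\<in>set (map ?b vs). eval w st b = 1) \<longleftrightarrow> (\<forall>v\<in>set vs. eval w st (?b v) = 1)"
      by (simp del: eval.simps)
    also have "\<dots> \<longleftrightarrow> (\<forall>v\<in>set vs. v \<in> heavy g \<longleftrightarrow> v \<in> Ss ! i)"
      by (intro ball_cong refl) (simp only: guard of_bool_eq_1_iff)
    also have "(\<forall>v\<in>set vs. v \<in> heavy g \<longleftrightarrow> v \<in> Ss ! i) \<longleftrightarrow> Ss ! i = heavy g"
      using S by (auto simp: heavy_def)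
    also have "\<dots> \<longleftrightarrow> i = ?i" using heavy_pos_unique[of i g] i by simp
    finally show "eval w st (heavy_guard vs (Ss ! i) env) = of_bool (i = ?i)" .
  qed (use i in simp)
  also have "\<dots> = total_code g"
  proof -
    have "eval w st (encode_exp (pl ?i) env) = code (pl ?i) g"
    proof (rule eval_encode[OF st, of "pl ?i" "set pa" "heavy g" g])
      show "eval w st (env v) = g v" if "a \<in> set (pl ?i)" "v \<in> atom_verts a" for a v
        using atom_verts_sub[OF i that(1)] that(2) env by blast
    qed (use plan_props(1)[OF i] realizes_heavy[OF g] heavy_pos(2)[of g] vol_le[OF i] in auto)
    moreover have "total_code g < 2 ^ w"
      using total_code_lt[OF g] size by (simp add: code_space_def)
    ultimately show ?thesis
      using L iL by (simp add: total_code_def mod_add_left_eq)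
  qed
  finally show ?thesis .
qed

text \<open>Decoding on the machine is a left inverse of \<open>total_code\<close>; the assumption
  supplies a state to evaluate in.\<close>

lemma total_code_inj:
  assumes st: "ready st"
  shows "inj_on total_code embeddings"
proof (rule inj_onI)
  fix g g' assume g: "g \<in> embeddings" "g' \<in> embeddings" "total_code g = total_code g'"
  have "total_code g < 2 ^ w" using total_code_lt[OF g(1)] size by (simp add: code_space_def)
  then have c: "eval w st (Const (total_code g)) = total_code g" by simp
  have "g v = g' v" if "v \<in> set vs" for v
    using eval_total_decode[OF st g(1) c that] eval_total_decode[OF st g(2) _ that, of "Const (total_code g)"] c g(3)
    by simp
  moreover have "g \<in> extensional (set vs)" "g' \<in> extensional (set vs)"
    using g by (simp_all add: embeddings_def)
  ultimately show "g = g'" by (intro extensionalityI)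
qed

lemma eval_valid_exp:
  assumes st: "ready st"
  shows "eval w st (valid_exp vs pa Ss pl c) = of_bool (eval w st c \<in> total_code ` embeddings)"
proof -
  define d where "d = total_decode Ss pl c"
  \<comment> \<open>For an arbitrary number \<open>c\<close> this may be any map; the arc and
    injectivity tests decide whether it is an embedding.\<close>
  define g where "g = restrict (\<lambda>v. eval w st (d v)) (set vs)"
  have gv: "eval w st (d v) = g v" if "v \<in> set vs" for v using that by (simp add: g_def)
  let ?pairs = "filter (\<lambda>(x, y). x \<noteq> y) (List.product vs vs)"
  let ?bs = "Op Equal c (total_encode vs Ss pl d) #
    map (\<lambda>(x, y). Op Less (Const 0) (Lookup [Const 0, d x, d y])) pa @
    map (\<lambda>(x, y). Op Equal (Op Equal (d x) (d y)) (Const 0)) ?pairs"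
  have of_bool_mod: "of_bool b mod 2 ^ w = (of_bool b :: nat)" for b using w_pos by (cases b) auto
  have arc: "eval w st (Op Less (Const 0) (Lookup [Const 0, d x, d y])) = of_bool ((g x, g y) \<in> set es)"
    if "(x, y) \<in> set pa" for x y
  proof -
    have xy: "x \<in> set vs" "y \<in> set vs" using arcs that by auto
    have "0 < D [0, g x, g y] \<longleftrightarrow> (g x, g y) \<in> set es"
      using arc_index[of "g x" "g y"] non_arc[of "g x" "g y"] by force
    then show ?thesis using st xy gv by (simp add: index_ready_def of_bool_mod)
  qed
  have ne: "eval w st (Op Equal (Op Equal (d x) (d y)) (Const 0)) = of_bool (g x \<noteq> g y)"
    if "x \<in> set vs" "y \<in> set vs" for x y
    using gv that by (simp add: of_bool_mod)
  have eqc: "eval w st (Op Equal c (total_encode vs Ss pl d)) =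
      of_bool (eval w st c = eval w st (total_encode vs Ss pl d))"
    by (simp add: of_bool_mod)
  have "eval w st (valid_exp vs pa Ss pl c) = eval w st (conj_exp ?bs)"
    by (simp add: valid_exp_def d_def Let_def)
  also have "\<dots> = of_bool (\<forall>b\<in>set ?bs. eval w st b = 1)"
  proof (rule eval_conj_exp[OF w_pos])
    fix b assume "b \<in> set ?bs"
    then consider "b = Op Equal c (total_encode vs Ss pl d)"
      | x y where "(x, y) \<in> set pa" "b = Op Less (Const 0) (Lookup [Const 0, d x, d y])"
      | x y where "x \<in> set vs" "y \<in> set vs" "b = Op Equal (Op Equal (d x) (d y)) (Const 0)"
      by auto
    then show "eval w st b \<in> {0, 1}"
      by cases (simp_all only: eqc arc ne, simp_all)
  qed
  also have "(\<forall>b\<in>set ?bs. eval w st b = 1) \<longleftrightarrow>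
      eval w st c = eval w st (total_encode vs Ss pl d) \<and> g \<in> embeddings"
  proof -
    have "(\<forall>b\<in>set ?bs. eval w st b = 1) \<longleftrightarrow>
      eval w st (Op Equal c (total_encode vs Ss pl d)) = 1 \<and>
      (\<forall>(x, y)\<in>set pa. eval w st (Op Less (Const 0) (Lookup [Const 0, d x, d y])) = 1) \<and>
      (\<forall>x\<in>set vs. \<forall>y\<in>set vs. x \<noteq> y \<longrightarrow> eval w st (Op Equal (Op Equal (d x) (d y)) (Const 0)) = 1)"
      by (auto simp del: eval.simps)
    also have "\<dots> \<longleftrightarrow> eval w st c = eval w st (total_encode vs Ss pl d) \<and>
      (\<forall>(x, y)\<in>set pa. (g x, g y) \<in> set es) \<and> (\<forall>x\<in>set vs. \<forall>y\<in>set vs. x \<noteq> y \<longrightarrow> g x \<noteq> g y)"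
    proof -
      have "(\<forall>(x, y)\<in>set pa. eval w st (Op Less (Const 0) (Lookup [Const 0, d x, d y])) = 1) \<longleftrightarrow>
          (\<forall>(x, y)\<in>set pa. (g x, g y) \<in> set es)"
      proof (rule ball_cong[OF refl])
        fix e assume e: "e \<in> set pa"
        obtain x y where xy: "e = (x, y)" by (rule prod.exhaust)
        show "(case e of (x, y) \<Rightarrow> eval w st (Op Less (Const 0) (Lookup [Const 0, d x, d y])) = 1) \<longleftrightarrow>
            (case e of (x, y) \<Rightarrow> (g x, g y) \<in> set es)"
          using arc[of x y] e xy by (simp del: eval.simps)
      qed
      moreover have "(\<forall>x\<in>set vs. \<forall>y\<in>set vs. x \<noteq> y \<longrightarrow>
            eval w st (Op Equal (Op Equal (d x) (d y)) (Const 0)) = 1) \<longleftrightarrow>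
          (\<forall>x\<in>set vs. \<forall>y\<in>set vs. x \<noteq> y \<longrightarrow> g x \<noteq> g y)"
        by (intro ball_cong refl) (simp only: ne of_bool_eq_1_iff)
      ultimately show ?thesis by (simp only: eqc of_bool_eq_1_iff)
    qed
    also have "\<dots> \<longleftrightarrow> eval w st c = eval w st (total_encode vs Ss pl d) \<and> g \<in> embeddings"
      by (auto simp: embeddings_def g_def inj_on_def)
    finally show ?thesis .
  qed
  also have "\<dots> \<longleftrightarrow> eval w st c \<in> total_code ` embeddings"
  proof
    assume "eval w st c = eval w st (total_encode vs Ss pl d) \<and> g \<in> embeddings"
    then show "eval w st c \<in> total_code ` embeddings"
      using eval_total_encode[OF st _ gv] by auto
  next
    assume "eval w st c \<in> total_code ` embeddings"
    then obtain g' where g': "g' \<in> embeddings" "eval w st c = total_code g'" by blast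
    have "g v = g' v" if "v \<in> set vs" for v
      using eval_total_decode[OF st g' that] gv[OF that] by (simp add: d_def)
    then have "g = g'"
      using g'(1) by (intro extensionalityI[of g "set vs" g']) (auto simp: g_def embeddings_def)
    then show "eval w st c = eval w st (total_encode vs Ss pl d) \<and> g \<in> embeddings"
      using g' eval_total_encode[OF st g'(1), of d] gv by simp
  qed
  finally show ?thesis .
qed

end

section \<open>The sampling loop\<close>

text \<open>Register 8 holds the random code, register 9 the counter of a deterministic scan of all codes,
  which stops at the first valid one, and register 10 tells whether register 8 is valid.\<close>

definition search_body :: "exp \<Rightarrow> (exp \<Rightarrow> exp) \<Rightarrow> com" where
  "search_body n valid = Seq (Random 8 n) (Seq (Assign 10 (valid (Reg 8)))
     (Cond (valid (Reg 9)) Skip (Assign 9 (add_const 9 1))))"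

definition search_cond :: "exp \<Rightarrow> exp" where
  "search_cond n = Op Times (Op Equal (Reg 10) (Const 0)) (Op Less (Reg 9) n)"

text \<open>Output starts right behind the input arcs, at address \<open>2 * length es\<close>, so
  an operation overwrites the output of its predecessor and leaves the arcs alone.\<close>

primrec store_all :: "nat \<Rightarrow> exp list \<Rightarrow> com" where
  "store_all k [] = Skip"
| "store_all k (e # xs) = Seq (Store (Op Plus (Op Times (Const 2) (Reg 5)) (Const k)) e) (store_all (Suc k) xs)"

definition output_graph :: "'p list \<Rightarrow> ('p \<times> 'p) list \<Rightarrow> ('p \<Rightarrow> exp) \<Rightarrow> com" where
  "output_graph vs pa d =
     Seq (store_all 0 (map d vs @ concat (map (\<lambda>(x, y). [d x, d y]) pa)))
     (Seq (Assign 1 (Const (length vs))) (Seq (Assign 2 (Op Times (Const 2) (Reg 5)))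
     (Seq (Assign 3 (Const (length pa)))
     (Seq (Assign 4 (Op Plus (Op Times (Const 2) (Reg 5)) (Const (length vs))))
     (Assign 0 (Const 1))))))"

definition sampler :: "exp \<Rightarrow> (exp \<Rightarrow> exp) \<Rightarrow> com \<Rightarrow> com" where
  "sampler n valid out = Seq (Assign 9 (Const 0)) (Seq (Assign 10 (Const 0))
     (Seq (While (search_cond n) (search_body n valid))
     (Cond (Reg 10) out (Assign 0 (Const 0)))))"

text \<open>The lower bounds already sum to 1, so they are equalities and nothing is left for other
  values or for divergence. Lower bounds on point masses thus also prove termination.\<close>

lemma spmf_uniformI:
  assumes A: "finite A" "A \<noteq> {}" and ge: "\<And>x. x \<in> A \<Longrightarrow> 1 / real (card A) \<le> spmf p x"
  shows "p = spmf_of_set A"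
proof -
  have c: "0 < card A" using A by (simp add: card_gt_0_iff)
  have sum: "(\<Sum>x\<in>B. spmf p x) \<le> 1" if "finite B" for B
  proof -
    have "(\<Sum>x\<in>B. spmf p x) = measure (measure_spmf p) B"
      using measure_spmf.finite_measure_eq_sum_singleton[OF that, of p]
      by (simp add: spmf_conv_measure_spmf)
    then show ?thesis by (simp add: measure_spmf.subprob_measure_le_1)
  qed
  have sumA: "(\<Sum>x\<in>A. 1 / real (card A)) = 1" using c by simp
  have "spmf p x = spmf (spmf_of_set A) x" for x
  proof (cases "x \<in> A")
    case True
    have "spmf p x + (\<Sum>y\<in>A - {x}. spmf p y) \<le> 1"
      using sum[OF A(1)] sum.remove[OF A(1) True, of "spmf p"] by simp
    moreover have "(\<Sum>y\<in>A - {x}. 1 / real (card A)) \<le> (\<Sum>y\<in>A - {x}. spmf p y)"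
      by (intro sum_mono ge) simp
    moreover have "1 / real (card A) + (\<Sum>y\<in>A - {x}. 1 / real (card A)) = 1"
      using sum.remove[OF A(1) True, of "\<lambda>_. 1 / real (card A)"] sumA by simp
    ultimately have "spmf p x \<le> 1 / real (card A)" by linarith
    then show ?thesis using ge[OF True] True A by (simp add: spmf_of_set)
  next
    case False
    have "spmf p x + (\<Sum>y\<in>A. spmf p y) \<le> 1"
      using sum[of "insert x A"] A False by simp
    moreover have "(\<Sum>y\<in>A. 1 / real (card A)) \<le> (\<Sum>y\<in>A. spmf p y)"
      by (intro sum_mono ge)
    ultimately have "spmf p x \<le> 0" using sumA by linarith
    then show ?thesis using False pmf_nonneg[of p "Some x"] by (simp add: spmf_of_set)
  qed
  then show ?thesis by (rule spmf_eqI)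
qed

text \<open>The claim is phrased as a bound on an integral, the mass of violating final states being
  at most 0, so that \<open>admissible_nn_integral_le\<close> opens the way to fixed-point
  induction.\<close>

lemma while_spmf_invariant:
  assumes inv: "\<And>s s' t. I s \<Longrightarrow> b s \<Longrightarrow> (s', t) \<in> set_spmf (f s) \<Longrightarrow> I s'" and s: "I s"
  shows "(s', t) \<in> set_spmf (while_spmf b f s) \<Longrightarrow> I s' \<and> \<not> b s'"
proof -
  let ?E = "\<lambda>p. \<integral>\<^sup>+ x. indicator {x. \<not> (I (fst x) \<and> \<not> b (fst x))} x \<partial>measure_spmf (p :: (machine \<times> nat) spmf)"
  let ?P = "\<lambda>w. \<forall>s. I s \<longrightarrow> ?E (w s) \<le> 0"
  have "?P (while_spmf b f)"
  proof (rule while_spmf.fixp_induct[where P = "\<lambda>w. ?P (w b f)"])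
    show "spmf.admissible (\<lambda>w. ?P (curry (curry w) b f))"
      unfolding curry_def by (intro admissible_all admissible_imp admissible_const admissible_nn_integral_le | simp only: simp_thms)+
  next
    fix w assume IH: "?P (w b f)"
    show "?P (\<lambda>s. if b s then f s \<bind> (\<lambda>(s1, t1). w b f s1 \<bind>
        (\<lambda>(s2, t2). return_spmf (s2, 1 + t1 + t2))) else return_spmf (s, 1))"
    proof (intro allI impI)
      fix s assume s: "I s"
      show "?E (if b s then f s \<bind> (\<lambda>(s1, t1). w b f s1 \<bind>
        (\<lambda>(s2, t2). return_spmf (s2, 1 + t1 + t2))) else return_spmf (s, 1)) \<le> 0"
      proof (cases "b s")
        case True
        have "?E (f s \<bind> (\<lambda>(s1, t1). w b f s1 \<bind> (\<lambda>(s2, t2). return_spmf (s2, 1 + t1 + t2)))) =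
            (\<integral>\<^sup>+ x. ?E (w b f (fst x)) \<partial>measure_spmf (f s))"
          by (simp only: nn_integral_bind_spmf case_prod_beta nn_integral_return_spmf)
            (simp add: indicator_def)
        also have "\<dots> \<le> 0"
        proof (rule nn_integral_spmf_le_const)
          fix x assume "x \<in> set_spmf (f s)"
          then have "I (fst x)" using inv[OF s True, of "fst x" "snd x"] by simp
          then show "?E (w b f (fst x)) \<le> 0" using IH by blast
        qed
        finally show ?thesis using True by simp
      next
        case False
        then show ?thesis using s by (simp only: if_False nn_integral_return_spmf) simp
      qed
    qed
  qed simp
  then have "?E (while_spmf b f s) \<le> 0" using s by blast
  then have "emeasure (measure_spmf (while_spmf b f s)) {x. \<not> (I (fst x) \<and> \<not> b (fst x))} = 0" by simp
  then have "x \<notin> set_spmf (while_spmf b f s)" if "\<not> (I (fst x) \<and> \<not> b (fst x))" for x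
    using that measure_spmf_zero_iff[of "while_spmf b f s" "{x. \<not> (I (fst x) \<and> \<not> b (fst x))}"]
    by (auto simp: measure_def)
  then show "I s' \<and> \<not> b s'" if "(s', t) \<in> set_spmf (while_spmf b f s)"
    using that by force
qed

lemma (in graph_index) ready_reg:
  "ready st \<Longrightarrow> r \<notin> {5, 6, 7} \<Longrightarrow> x < 2 ^ w \<Longrightarrow> ready (st\<lparr>regs := (regs st)(r := x)\<rparr>)"
  by (auto simp: index_ready_def words_def)

locale code_search = graph_index w es l s h D
  for w :: nat and es :: "(nat \<times> nat) list" and l s h :: nat and D :: "nat list \<Rightarrow> nat" +
  fixes codes :: "nat set" and N :: nat and ne :: exp and valid :: "exp \<Rightarrow> exp"
  assumes codes: "codes \<subseteq> {..<N}" and N: "0 < N" "N < 2 ^ w"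
    and eval_ne: "index_ready w es l s D st \<Longrightarrow> eval w st ne = N"
    and eval_valid: "index_ready w es l s D st \<Longrightarrow> eval w st (valid c) = of_bool (eval w st c \<in> codes)"
begin

lemma finite_codes: "finite codes"
  using codes by (rule finite_subset) simp

lemma card_codes: "card codes \<le> N"
  using card_mono[OF _ codes] by simp

text \<open>The last clause turns an exhausted scan into a proof that there is no code.\<close>

definition inv :: "machine \<Rightarrow> bool" where
  "inv st \<longleftrightarrow> ready st \<and> (regs st 10 = 0 \<or> regs st 10 = 1 \<and> regs st 8 \<in> codes) \<and>
     regs st 9 \<le> N \<and> (\<forall>i<regs st 9. i \<notin> codes)"

definition active :: "machine \<Rightarrow> bool" where
  "active st \<longleftrightarrow> regs st 10 = 0 \<and> regs st 9 < N"

definition step :: "machine \<Rightarrow> nat \<Rightarrow> machine" where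
  "step st x = (let rs = (regs st)(8 := x, 10 := of_bool (x \<in> codes)) in
     st\<lparr>regs := (if regs st 9 \<in> codes then rs else rs(9 := Suc (regs st 9)))\<rparr>)"

lemma step_simps:
  "regs (step st x) 8 = x" "regs (step st x) 10 = of_bool (x \<in> codes)"
  "regs (step st x) 9 = (if regs st 9 \<in> codes then regs st 9 else Suc (regs st 9))"
  by (simp_all add: step_def Let_def)

lemma eval_search_cond: "inv st \<Longrightarrow> eval w st (search_cond ne) \<noteq> 0 \<longleftrightarrow> active st"
  using eval_ne[of st] w_pos by (auto simp: inv_def active_def search_cond_def)

lemma inv_step:
  assumes "inv st" "active st" "x < N"
  shows "inv (step st x)"
proof -
  have "ready (step st x)"
  proof -
    have "x < 2 ^ w" "Suc (regs st 9) < 2 ^ w" "of_bool (x \<in> codes) < (2::nat) ^ w"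
      using assms N word(1) by (auto simp: active_def of_bool_def)
    then show ?thesis
      using assms by (auto simp: step_def inv_def Let_def index_ready_def words_def)
  qed
  moreover have "i \<notin> codes" if "i < regs (step st x) 9" for i
  proof -
    have scanned: "\<forall>i<regs st 9. i \<notin> codes" using assms(1) unfolding inv_def by blast
    show ?thesis
    proof (cases "regs st 9 \<in> codes")
      case True
      then show ?thesis using that scanned unfolding step_simps(3) by simp
    next
      case False
      then have "i = regs st 9 \<or> i < regs st 9" using that unfolding step_simps(3) by (simp add: less_Suc_eq disj_commute)
      then show ?thesis using False scanned by blast
    qed
  qed
  moreover have "regs (step st x) 10 = 0 \<or> regs (step st x) 10 = 1 \<and> regs (step st x) 8 \<in> codes"
    by (simp add: step_simps(1,2))
  moreover have "regs (step st x) 9 \<le> N"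
    using assms(2) unfolding step_simps(3) active_def by simp
  ultimately show ?thesis unfolding inv_def by blast
qed

text \<open>The time 4 is one unit each for the draw, the test of the draw, the condition and its
  branch; the loop adds 1, whence the factor 5 in \<open>loop_time\<close>.\<close>

lemma exec_body:
  assumes "inv st" "active st"
  shows "exec w (search_body ne valid) st = map_spmf (\<lambda>x. (step st x, 4)) (spmf_of_set {..<N})"
proof -
  have rd: "ready st" using assms(1) by (simp add: inv_def)
  have j: "Suc (regs st 9) < 2 ^ w" using assms(2) N(2) by (simp add: active_def)
  have "exec w (search_body ne valid) st =
    spmf_of_set {..<N} \<bind> (\<lambda>x. exec w (Seq (Assign 10 (valid (Reg 8)))
      (Cond (valid (Reg 9)) Skip (Assign 9 (add_const 9 1)))) (st\<lparr>regs := (regs st)(8 := x)\<rparr>) \<bind>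
      (\<lambda>(s2, t2). return_spmf (s2, 1 + t2)))"
    unfolding search_body_def exec.simps(6)[of w "Random 8 ne"] exec.simps(5) eval_ne[OF rd]
    using N(1) by (simp del: exec.simps)
  also have "\<dots> = spmf_of_set {..<N} \<bind> (\<lambda>x. return_spmf (step st x, 4))"
  proof (rule bind_spmf_cong[OF refl])
    fix x assume "x \<in> set_spmf (spmf_of_set {..<N})"
    then have x: "x < N" by simp
    define st1 where "st1 = st\<lparr>regs := (regs st)(8 := x)\<rparr>"
    have r1: "ready st1" unfolding st1_def using rd x N(2) by (intro ready_reg) auto
    define st2 where "st2 = st1\<lparr>regs := (regs st1)(10 := of_bool (x \<in> codes))\<rparr>"
    have "of_bool (x \<in> codes) < (2::nat) ^ w" using word(1) by (auto simp: of_bool_def)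
    then have r2: "ready st2" unfolding st2_def using r1 by (intro ready_reg) auto
    have v1: "eval w st1 (valid (Reg 8)) = of_bool (x \<in> codes)"
      using eval_valid[OF r1, of "Reg 8"] by (simp add: st1_def)
    have v2: "eval w st2 (valid (Reg 9)) = of_bool (regs st 9 \<in> codes)"
      using eval_valid[OF r2, of "Reg 9"] by (simp add: st1_def st2_def)
    have "exec w (Assign 10 (valid (Reg 8))) st1 = return_spmf (st2, 1)"
      by (simp add: v1 st2_def)
    moreover have "exec w (Cond (valid (Reg 9)) Skip (Assign 9 (add_const 9 1))) st2 = return_spmf (step st x, 2)"
      unfolding exec.simps(7) v2
      using j w_pos by (cases "regs st 9 \<in> codes")
        (simp_all add: st2_def st1_def step_def Let_def add_const_def)
    ultimately have "exec w (Seq (Assign 10 (valid (Reg 8)))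
      (Cond (valid (Reg 9)) Skip (Assign 9 (add_const 9 1)))) st1 = return_spmf (step st x, 3)"
      by (simp del: exec.simps add: exec.simps(6))
    then show "exec w (Seq (Assign 10 (valid (Reg 8)))
      (Cond (valid (Reg 9)) Skip (Assign 9 (add_const 9 1)))) (st\<lparr>regs := (regs st)(8 := x)\<rparr>) \<bind>
      (\<lambda>(s2, t2). return_spmf (s2, 1 + t2)) = return_spmf (step st x, 4)"
      by (simp add: st1_def del: exec.simps)
  qed
  finally show ?thesis by (simp add: map_spmf_conv_bind_spmf)
qed

abbreviation loop :: "machine \<Rightarrow> (machine \<times> nat) spmf" where
  "loop \<equiv> exec w (While (search_cond ne) (search_body ne valid))"

lemma body_inv:
  assumes "inv st" "eval w st (search_cond ne) \<noteq> 0" "(s', t) \<in> set_spmf (exec w (search_body ne valid) st)"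
  shows "inv s'"
proof -
  have act: "active st" using eval_search_cond[OF assms(1)] assms(2) by blast
  from assms(3) obtain x where "x < N" "s' = step st x"
    unfolding exec_body[OF assms(1) act] by auto
  then show ?thesis using inv_step[OF assms(1) act] by simp
qed

lemma loop_final:
  assumes "inv st" "(s', t) \<in> set_spmf (loop st)"
  shows "inv s' \<and> \<not> active s'"
proof -
  have "inv s' \<and> \<not> eval w s' (search_cond ne) \<noteq> 0"
    using assms(2) unfolding exec.simps(8)
    by (rule while_spmf_invariant[where I = inv, rotated 2]) (fact body_inv, fact assms(1))
  then show ?thesis using eval_search_cond[of s'] by blast
qed

text \<open>The scan stops at the first code and hence never reaches \<open>N\<close> if there is
  one. So it cannot cut the random search short, which keeps the result uniform.\<close>

lemma inv_active:
  assumes "inv st" "codes \<noteq> {}"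
  shows "active st \<longleftrightarrow> regs st 10 = 0"
proof -
  obtain k where "k \<in> codes" using assms(2) by blast
  then have "\<not> k < regs st 9" "k < N" using assms(1) codes by (auto simp: inv_def)
  then show ?thesis by (auto simp: active_def)
qed

lemma loop_time:
  assumes "inv st"
  shows "(\<integral>\<^sup>+ x. of_nat (snd x) \<partial>measure_spmf (loop st)) \<le>
    ennreal (5 * (real N / max 1 (real (card codes))) + 1)"
proof (cases "codes = {}")
  case True
  \<comment> \<open>Without codes the scan advances in every round: 5 units for each number left,
    plus the final condition.\<close>
  define \<Phi> where "\<Phi> = (\<lambda>st :: machine. ennreal (5 * real (N - regs st 9) + 1))"
  have "(\<integral>\<^sup>+ x. of_nat (snd x) \<partial>measure_spmf (loop st)) \<le> \<Phi> st"
    unfolding exec.simps(8)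
  proof (rule while_spmf_expected_time[where I = inv])
    show "(\<integral>\<^sup>+ x. 1 + of_nat (snd x) + \<Phi> (fst x) \<partial>measure_spmf (exec w (search_body ne valid) st)) \<le> \<Phi> st"
      if st: "inv st" "eval w st (search_cond ne) \<noteq> 0" for st
    proof -
      have act: "active st" using st eval_search_cond by blast
      then have j: "regs st 9 < N" by (simp add: active_def)
      show ?thesis
        unfolding exec_body[OF st(1) act] nn_integral_map_spmf
      proof (rule nn_integral_spmf_le_const)
        fix x
        have s9: "regs (step st x) 9 = Suc (regs st 9)" unfolding step_simps(3) using True by simp
        have "real (N - regs st 9) = real (N - Suc (regs st 9)) + 1" using j by (simp add: of_nat_diff)
        then have "\<Phi> st = ennreal (1 + real 4 + (5 * real (N - Suc (regs st 9)) + 1))"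
          by (simp add: \<Phi>_def)
        also have "\<dots> = 1 + of_nat 4 + \<Phi> (step st x)"
          unfolding \<Phi>_def s9 ennreal_of_nat_eq_real_of_nat
          by (simp only: ennreal_plus ennreal_1 of_nat_0_le_iff zero_le_one add_nonneg_nonneg
              zero_le_mult_iff zero_le_numeral simp_thms)
        finally show "((\<lambda>x. 1 + of_nat (snd x) + \<Phi> (fst x)) \<circ> (\<lambda>x. (step st x, 4))) x \<le> \<Phi> st" by simp
      qed
    qed
    show "1 \<le> \<Phi> st" for st by (simp add: \<Phi>_def)
  qed (use body_inv assms in blast)+
  also have "\<Phi> st \<le> ennreal (5 * (real N / max 1 (real (card codes))) + 1)"
    using True unfolding \<Phi>_def by (intro ennreal_leI) auto
  finally show ?thesis .
next
  case False
  let ?K = "real (card codes)"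
  have K: "1 \<le> card codes" using False finite_codes by (simp add: Suc_le_eq card_gt_0_iff)
  \<comment> \<open>With \<open>K = card codes\<close>, \<open>B\<close> solves
    \<open>B = 5 + K / N + (1 - K / N) * B\<close>: a round costs 5, and with probability
    \<open>K / N\<close> only the final condition remains.\<close>
  define B where "B = 5 * (real N / ?K) + 1"
  have B: "1 \<le> B" by (simp add: B_def)
  define \<Phi> where "\<Phi> = (\<lambda>st :: machine. ennreal (if regs st 10 = 0 then B else 1))"
  have "(\<integral>\<^sup>+ x. of_nat (snd x) \<partial>measure_spmf (loop st)) \<le> \<Phi> st"
    unfolding exec.simps(8)
  proof (rule while_spmf_expected_time[where I = inv])
    show "(\<integral>\<^sup>+ x. 1 + of_nat (snd x) + \<Phi> (fst x) \<partial>measure_spmf (exec w (search_body ne valid) st)) \<le> \<Phi> st"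
      if st: "inv st" "eval w st (search_cond ne) \<noteq> 0" for st
    proof -
      have act: "active st" using st eval_search_cond by blast
      have "(\<integral>\<^sup>+ x. 1 + of_nat (snd x) + \<Phi> (fst x) \<partial>measure_spmf (exec w (search_body ne valid) st)) =
        (\<Sum>x<N. 1 + of_nat 4 + \<Phi> (step st x)) / ennreal (real N)"
        unfolding exec_body[OF st(1) act] nn_integral_map_spmf nn_integral_spmf_of_set
        by (simp add: o_def ennreal_of_nat_eq_real_of_nat)
      also have "(\<Sum>x<N. 1 + of_nat 4 + \<Phi> (step st x)) = (\<Sum>x<N. ennreal (5 + (if x \<in> codes then 1 else B)))"
      proof (rule sum.cong[OF refl])
        fix x
        have "ennreal (5 + (if x \<in> codes then 1 else B)) = ennreal 5 + ennreal (if x \<in> codes then 1 else B)"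
          using B by (intro ennreal_plus) auto
        moreover have "1 + of_nat 4 = (ennreal 5)"
          by simp
        ultimately show "1 + of_nat 4 + \<Phi> (step st x) = ennreal (5 + (if x \<in> codes then 1 else B))"
          by (simp add: \<Phi>_def step_simps)
      qed
      also have "\<dots> = ennreal (\<Sum>x<N. 5 + (if x \<in> codes then 1 else B))"
        using B by (intro sum_ennreal) auto
      also have "(\<Sum>x<N. 5 + (if x \<in> codes then 1 else B)) = 5 * real N + (?K + (real N - ?K) * B)"
      proof -
        have "{..<N} \<inter> {x. x \<in> codes} = codes" "{..<N} \<inter> - {x. x \<in> codes} = {..<N} - codes"
          using codes by auto
        moreover have "real (card ({..<N} - codes)) = real N - ?K"
          using card_codes finite_codes codes by (simp add: card_Diff_subset of_nat_diff)
        ultimately show ?thesis by (simp add: sum.distrib sum.If_cases)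
      qed
      also have "\<dots> = B * real N"
        using K by (simp add: B_def field_simps)
      also have "ennreal (B * real N) / ennreal (real N) = ennreal B"
        using N(1) B by (simp add: divide_ennreal)
      also have "ennreal B = \<Phi> st" using act by (simp add: \<Phi>_def active_def)
      finally show ?thesis by simp
    qed
    show "1 \<le> \<Phi> st" for st using B by (simp add: \<Phi>_def)
  qed (use body_inv assms in blast)+
  also have "\<Phi> st \<le> ennreal B" using B unfolding \<Phi>_def by (intro ennreal_leI) auto
  also have "B = 5 * (real N / max 1 ?K) + 1" using K by (simp add: B_def max_def)
  finally show ?thesis .
qed

abbreviation final :: "machine \<Rightarrow> machine spmf" where
  "final st \<equiv> map_spmf fst (loop st)"

lemma final_stop: "inv st \<Longrightarrow> \<not> active st \<Longrightarrow> final st = return_spmf st"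
  using eval_search_cond[of st] by (simp add: while_spmf.simps)

lemma final_step:
  assumes "inv st" "active st"
  shows "final st = spmf_of_set {..<N} \<bind> (\<lambda>x. final (step st x))"
proof -
  have "eval w st (search_cond ne) \<noteq> 0" using assms eval_search_cond by blast
  then have "loop st = exec w (search_body ne valid) st \<bind> (\<lambda>(s1, t1). loop s1 \<bind>
      (\<lambda>(s2, t2). return_spmf (s2, 1 + t1 + t2)))"
    unfolding exec.simps(8) by (subst while_spmf.simps) simp
  also have "\<dots> = spmf_of_set {..<N} \<bind> (\<lambda>x. loop (step st x) \<bind> (\<lambda>(s2, t2). return_spmf (s2, 1 + 4 + t2)))"
    unfolding exec_body[OF assms] by (simp add: bind_map_spmf o_def del: exec.simps)
  finally show ?thesis
    by (simp add: map_spmf_bind_spmf o_def case_prod_beta map_spmf_conv_bind_spmf del: exec.simps)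
qed

text \<open>The scan counter advances towards \<open>N\<close> whatever is drawn, so the number of
  rounds is bounded.\<close>

lemma final_lossless_empty:
  assumes "codes = {}" "inv st"
  shows "lossless_spmf (final st)"
  using assms(2)
proof (induction "N - regs st 9" arbitrary: st rule: less_induct)
  case less
  show ?case
  proof (cases "active st")
    case True
    have "lossless_spmf (final (step st x))" if "x < N" for x
    proof (rule less.hyps[OF _ inv_step[OF less.prems True that]])
      have "regs (step st x) 9 = Suc (regs st 9)" unfolding step_simps(3) using assms(1) by simp
      moreover have "regs st 9 < N" using True by (simp add: active_def)
      ultimately show "N - regs (step st x) 9 < N - regs st 9" by linarith
    qed
    then show ?thesis
      unfolding final_step[OF less.prems True] using N(1) by (simp add: lessThan_empty_iff del: exec.simps)
  next
    case False
    then show ?thesis unfolding final_stop[OF less.prems False] by simp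
  qed
qed

definition result :: "machine \<Rightarrow> (nat \<times> nat) spmf" where
  "result st = map_spmf (\<lambda>s. (regs s 10, regs s 8)) (final st)"

text \<open>By \<open>geometric_lower_bound\<close> with \<open>p = 1 / N\<close> and
  \<open>k = card codes / N\<close>, each code has probability at least
  \<open>1 / card codes\<close>; \<open>spmf_uniformI\<close> then settles uniformity and almost
  sure termination together.\<close>

lemma result_uniform:
  assumes ne: "codes \<noteq> {}" and st: "inv st" "regs st 10 = 0"
  shows "result st = spmf_of_set ({1 :: nat} \<times> codes)"
proof (rule spmf_uniformI)
  let ?K = "real (card codes)"
  have K: "0 < card codes" using ne finite_codes by (simp add: card_gt_0_iff)
  fix y assume "y \<in> {1 :: nat} \<times> codes"
  then obtain k where y: "y = (1, k)" and k: "k \<in> codes" by auto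
  have "1 / real N / (?K / real N) \<le> spmf (result st) (1, k)"
  proof (rule geometric_lower_bound[where I = "\<lambda>st. inv st \<and> regs st 10 = 0" and r = "\<lambda>st. spmf (result st) (1, k)"])
    fix st L assume st: "inv st \<and> regs st 10 = 0"
      and L: "\<And>s'. inv s' \<and> regs s' 10 = 0 \<Longrightarrow> L \<le> spmf (result s') (1, k)"
    have act: "active st" using st inv_active[OF _ ne] by blast
    have "result st = spmf_of_set {..<N} \<bind> (\<lambda>x. result (step st x))"
      unfolding result_def using st act by (subst final_step) (auto simp: map_spmf_bind_spmf o_def)
    then have eq: "spmf (result st) (1, k) = (\<Sum>x<N. spmf (result (step st x)) (1, k)) / real N"
      by (simp add: spmf_bind integral_spmf_of_set)
    have "(\<Sum>x<N. if x \<in> codes then of_bool (x = k) else L) \<le> (\<Sum>x<N. spmf (result (step st x)) (1, k))"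
    proof (rule sum_mono)
      fix x assume "x \<in> {..<N}"
      then have i: "inv (step st x)" using st act by (intro inv_step) auto
      show "(if x \<in> codes then of_bool (x = k) else L) \<le> spmf (result (step st x)) (1, k)"
      proof (cases "x \<in> codes")
        case True
        then have "\<not> active (step st x)" by (simp add: active_def step_simps)
        then have "result (step st x) = return_spmf (1, x)"
          using True unfolding result_def by (simp add: final_stop[OF i] step_simps del: exec.simps)
        then show ?thesis using True by simp
      next
        case False
        then show ?thesis using L[of "step st x"] i by (simp add: step_simps)
      qed
    qed
    also have "(\<Sum>x<N. if x \<in> codes then of_bool (x = k) else L) = 1 + (real N - ?K) * L"
    proof -
      have "{..<N} \<inter> {x. x \<in> codes} = codes" "{..<N} \<inter> - {x. x \<in> codes} = {..<N} - codes"
        using codes by auto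
      moreover have "real (card ({..<N} - codes)) = real N - ?K"
        using card_codes finite_codes codes by (simp add: card_Diff_subset of_nat_diff)
      moreover have "(\<Sum>x\<in>codes. of_bool (x = k)) = (1 :: real)"
        using k finite_codes by (simp add: of_bool_def)
      ultimately show ?thesis by (simp add: sum.If_cases)
    qed
    finally have "(1 + (real N - ?K) * L) / real N \<le> spmf (result st) (1, k)"
      unfolding eq by (rule divide_right_mono) simp
    then show "1 / real N + (1 - ?K / real N) * L \<le> spmf (result st) (1, k)"
      using N(1) by (simp add: field_simps)
  qed (use st K N(1) in auto)
  then show "1 / real (card ({1 :: nat} \<times> codes)) \<le> spmf (result st) y"
    using K N(1) by (simp add: y card_cartesian_product)
qed (use ne finite_codes in auto)

lemma sampler_operation:
  assumes out: "\<And>st. ready st \<Longrightarrow> regs st 8 \<in> codes \<Longrightarrow>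
      exec w out st = return_spmf (outs st, outt st) \<and> outt st \<le> T \<and> ready (outs st) \<and>
      outcome (outs st) = Some (Gr (regs st 8))"
  shows "sampling_operation w (sampler ne valid out) ready
    (if codes = {} then return_spmf None else map_spmf (\<lambda>k. Some (Gr k)) (spmf_of_set codes))
    (ennreal (5 * (real N / max 1 (real (card codes))) + real T + 5))"
proof -
  define fin where "fin = (\<lambda>s :: machine. if regs s 10 = 0 then s\<lparr>regs := (regs s)(0 := 0)\<rparr> else outs s)"
  define ft where "ft = (\<lambda>s :: machine. if regs s 10 = 0 then 2 else 1 + outt s)"
  define init where "init = (\<lambda>st :: machine. st\<lparr>regs := (regs st)(9 := 0, 10 := 0)\<rparr>)"
  have init: "inv (init st)" "regs (init st) 10 = 0" if "ready st" for st
    using that by (auto simp: inv_def init_def index_ready_def words_def)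
  have cond: "exec w (Cond (Reg 10) out (Assign 0 (Const 0))) s = return_spmf (fin s, ft s)"
    if "inv s" for s
    using out[of s] that by (auto simp: fin_def ft_def inv_def)
  have ready_fin: "ready (fin s)" if "inv s" for s
    using out[of s] that ready_reg[of s 0 0] by (auto simp: fin_def inv_def)
  have exec_eq: "exec w (sampler ne valid out) st =
      map_spmf (\<lambda>x. (fin (fst x), 2 + (snd x + ft (fst x)))) (loop (init st))" if st: "ready st" for st
  proof -
    have "exec w (sampler ne valid out) st = loop (init st) \<bind>
      (\<lambda>x. exec w (Cond (Reg 10) out (Assign 0 (Const 0))) (fst x) \<bind>
        (\<lambda>y. return_spmf (fst y, 2 + (snd x + snd y))))"
      unfolding sampler_def exec.simps(6) exec.simps(2)
      by (simp add: init_def case_prod_beta del: exec.simps)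
    also have "\<dots> = loop (init st) \<bind> (\<lambda>x. return_spmf (fin (fst x), 2 + (snd x + ft (fst x))))"
    proof (rule bind_spmf_cong[OF refl])
      fix x assume "x \<in> set_spmf (loop (init st))"
      then have "inv (fst x)" using loop_final[OF init(1)[OF st], of "fst x" "snd x"] by simp
      from cond[OF this] show "exec w (Cond (Reg 10) out (Assign 0 (Const 0))) (fst x) \<bind>
        (\<lambda>y. return_spmf (fst y, 2 + (snd x + snd y))) = return_spmf (fin (fst x), 2 + (snd x + ft (fst x)))"
        by (simp del: exec.simps)
    qed
    finally show ?thesis by (simp only: map_spmf_conv_bind_spmf)
  qed
  have final_inv: "inv (fst x)" "\<not> active (fst x)" if "ready st" "x \<in> set_spmf (loop (init st))" for st x
    using loop_final[OF init(1)[OF that(1)], of "fst x" "snd x"] that(2) by simp_all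
  have lossless_result: "lossless_spmf (loop (init st))" if st: "ready st" for st
  proof -
    have "lossless_spmf (final (init st))"
    proof (cases "codes = {}")
      case True
      then show ?thesis using init[OF st] by (intro final_lossless_empty)
    next
      case False
      then have "lossless_spmf (result (init st))"
        using result_uniform[OF False init[OF st]] finite_codes by simp
      then show ?thesis by (simp add: result_def del: exec.simps)
    qed
    then show ?thesis by (simp del: exec.simps)
  qed
  show ?thesis
  proof
    fix st assume st: "ready st"
    show "lossless_spmf (exec w (sampler ne valid out) st)"
      unfolding exec_eq[OF st] using lossless_result[OF st] by (simp del: exec.simps)
    show "ready s'" if "(s', t) \<in> set_spmf (exec w (sampler ne valid out) st)" for s' t
      using that final_inv[OF st] ready_fin unfolding exec_eq[OF st] by (auto simp del: exec.simps)
    have "map_spmf (outcome \<circ> fst) (exec w (sampler ne valid out) st) =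
      map_spmf (\<lambda>x. outcome (fin (fst x))) (loop (init st))"
      unfolding exec_eq[OF st] by (simp add: spmf.map_comp o_def del: exec.simps)
    also have "\<dots> = map_spmf (\<lambda>x. if regs (fst x) 10 = 0 then None else Some (Gr (regs (fst x) 8))) (loop (init st))"
    proof (rule map_spmf_cong[OF refl])
      fix x assume "x \<in> set_spmf (loop (init st))"
      then have "inv (fst x)" by (rule final_inv(1)[OF st])
      then show "outcome (fin (fst x)) = (if regs (fst x) 10 = 0 then None else Some (Gr (regs (fst x) 8)))"
        using out[of "fst x"] by (auto simp: fin_def inv_def outcome_def)
    qed
    also have "\<dots> = map_spmf (\<lambda>(f, k). if f = 0 then None else Some (Gr k)) (result (init st))"
      by (simp add: result_def spmf.map_comp o_def del: exec.simps)
    also have "\<dots> = (if codes = {} then return_spmf None else map_spmf (\<lambda>k. Some (Gr k)) (spmf_of_set codes))"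
    proof (cases "codes = {}")
      case True
      have "map_spmf (\<lambda>(f, k). if f = 0 then None else Some (Gr k)) (result (init st)) =
          map_spmf (\<lambda>_. None) (loop (init st))"
        unfolding result_def spmf.map_comp
      proof (rule map_spmf_cong[OF refl])
        fix x assume "x \<in> set_spmf (loop (init st))"
        then have "inv (fst x)" by (rule final_inv(1)[OF st])
        then show "((\<lambda>(f, k). if f = 0 then None else Some (Gr k)) \<circ> ((\<lambda>s. (regs s 10, regs s 8)) \<circ> fst)) x = None"
          using True unfolding inv_def by auto
      qed
      also have "\<dots> = return_spmf None"
        using lossless_result[OF st]
        by (simp add: map_spmf_conv_bind_spmf bind_spmf_const lossless_weight_spmfD del: exec.simps)
      finally show ?thesis using True by simp
    next
      case False
      have "spmf_of_set ({1 :: nat} \<times> codes) = map_spmf (Pair (1::nat)) (spmf_of_set codes)"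
        by (subst map_spmf_of_set_inj_on) (auto simp: inj_on_def intro!: arg_cong[of _ _ spmf_of_set])
      then show ?thesis
        using False result_uniform[OF False init[OF st]] by (simp add: spmf.map_comp o_def)
    qed
    finally show "map_spmf (outcome \<circ> fst) (exec w (sampler ne valid out) st) =
      (if codes = {} then return_spmf None else map_spmf (\<lambda>k. Some (Gr k)) (spmf_of_set codes))" .
    have "(\<integral>\<^sup>+ x. of_nat (snd x) \<partial>measure_spmf (exec w (sampler ne valid out) st)) =
      (\<integral>\<^sup>+ x. of_nat (2 + (snd x + ft (fst x))) \<partial>measure_spmf (loop (init st)))"
      unfolding exec_eq[OF st] by (simp add: o_def del: exec.simps)
    also have "\<dots> \<le> (\<integral>\<^sup>+ x. of_nat (snd x) + of_nat (4 + T) \<partial>measure_spmf (loop (init st)))"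
    proof (rule nn_integral_spmf_mono)
      fix x assume "x \<in> set_spmf (loop (init st))"
      then have "inv (fst x)" by (rule final_inv(1)[OF st])
      \<comment> \<open>A successful search pays 1 for the condition and at most \<open>T\<close>
        for the output, a failed one 2 in all.\<close>
      then have "2 + (snd x + ft (fst x)) \<le> snd x + (4 + T)"
        using out[of "fst x"] by (auto simp: ft_def inv_def)
      then have "(of_nat (2 + (snd x + ft (fst x))) :: ennreal) \<le> of_nat (snd x + (4 + T))"
        by (rule of_nat_mono)
      then show "(of_nat (2 + (snd x + ft (fst x))) :: ennreal) \<le> of_nat (snd x) + of_nat (4 + T)"
        by (simp only: of_nat_add)
    qed
    also have "\<dots> = (\<integral>\<^sup>+ x. of_nat (snd x) \<partial>measure_spmf (loop (init st))) +
        (\<integral>\<^sup>+ x. of_nat (4 + T) \<partial>measure_spmf (loop (init st)))"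
      by (rule nn_integral_add) auto
    also have "\<dots> \<le> ennreal (5 * (real N / max 1 (real (card codes))) + 1) + of_nat (4 + T)"
      by (intro add_mono loop_time init[OF st] nn_integral_spmf_le_const) simp
    also have "\<dots> = ennreal (5 * (real N / max 1 (real (card codes))) + real T + 5)"
      unfolding ennreal_of_nat_eq_real_of_nat by (subst ennreal_plus[symmetric]) (auto simp: add_ac)
    finally show "(\<integral>\<^sup>+ x. of_nat (snd x) \<partial>measure_spmf (exec w (sampler ne valid out) st)) \<le>
      ennreal (5 * (real N / max 1 (real (card codes))) + real T + 5)" .
  qed
qed

end

section \<open>Occurrences\<close>

context graph_index
begin

text \<open>Entries are evaluated one after another while earlier ones are already in memory. They
  must therefore have the same value in all ready states with the given registers.\<close>

lemma exec_store_all: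
  assumes "ready st" "length xs = length ys" "2 * length es + k + length xs < 2 ^ w"
    and "\<And>i st'. i < length xs \<Longrightarrow> ready st' \<Longrightarrow> regs st' = regs st \<Longrightarrow> eval w st' (xs ! i) = ys ! i"
  shows "\<exists>st'. exec w (store_all k xs) st = return_spmf (st', Suc (length xs)) \<and> ready st' \<and>
    regs st' = regs st \<and> (\<forall>i<length xs. mem st' (2 * length es + k + i) = ys ! i) \<and>
    (\<forall>a<2 * length es + k. mem st' a = mem st a)"
  using assms
proof (induction xs arbitrary: k ys st)
  case Nil
  then show ?case by auto
next
  case (Cons x xs)
  obtain y ys' where ys: "ys = y # ys'" using Cons.prems(2) by (cases ys) auto
  let ?a = "2 * length es + k"
  define st1 where "st1 = st\<lparr>mem := (mem st)(?a := y)\<rparr>"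
  have x: "eval w st x = y" using Cons.prems(4)[of 0 st] Cons.prems(1) ys by simp
  have "y < 2 ^ w" using eval_lt[OF ready_words[OF Cons.prems(1)], of x] x by simp
  then have r1: "ready st1"
    using Cons.prems(1) by (auto simp: st1_def index_ready_def words_def)
  have lt: "?a < 2 ^ w" "k < 2 ^ w" using Cons.prems(3) by simp_all
  have "regs st 5 = length es" using Cons.prems(1) by (simp add: index_ready_def)
  then have ex: "exec w (Store (Op Plus (Op Times (Const 2) (Reg 5)) (Const k)) x) st = return_spmf (st1, 1)"
    using lt x word(2) by (simp add: st1_def const_mod)
  have "\<exists>st'. exec w (store_all (Suc k) xs) st1 = return_spmf (st', Suc (length xs)) \<and> ready st' \<and>
    regs st' = regs st1 \<and> (\<forall>i<length xs. mem st' (2 * length es + Suc k + i) = ys' ! i) \<and>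
    (\<forall>a<2 * length es + Suc k. mem st' a = mem st1 a)"
  proof (rule Cons.IH[OF r1])
    show "eval w st' (xs ! i) = ys' ! i" if "i < length xs" "ready st'" "regs st' = regs st1" for i st'
      using Cons.prems(4)[of "Suc i" st'] that ys by (simp add: st1_def)
  qed (use Cons.prems ys in auto)
  then obtain st' where st': "exec w (store_all (Suc k) xs) st1 = return_spmf (st', Suc (length xs))"
    "ready st'" "regs st' = regs st1" "\<And>i. i < length xs \<Longrightarrow> mem st' (2 * length es + Suc k + i) = ys' ! i"
    "\<And>a. a < 2 * length es + Suc k \<Longrightarrow> mem st' a = mem st1 a" by blast
  have "exec w (store_all k (x # xs)) st = return_spmf (st', Suc (length (x # xs)))"
    using ex st'(1) by simp
  moreover have "mem st' (?a + i) = ys ! i" if "i < length (x # xs)" for i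
  proof (cases i)
    case 0
    then show ?thesis using st'(5)[of ?a] ys by (simp add: st1_def)
  next
    case (Suc j)
    then show ?thesis using st'(4)[of j] that ys by simp
  qed
  moreover have "mem st' a = mem st a" if "a < ?a" for a
    using st'(5)[of a] that by (simp add: st1_def)
  ultimately show ?case using st'(2,3) by (auto simp: st1_def)
qed

end

lemma concat_pairs:
  "length (concat (map (\<lambda>(x, y). [f x, f y]) ps)) = 2 * length ps"
  "i < length ps \<Longrightarrow> concat (map (\<lambda>(x, y). [f x, f y]) ps) ! (2 * i) = f (fst (ps ! i))"
  "i < length ps \<Longrightarrow> concat (map (\<lambda>(x, y). [f x, f y]) ps) ! Suc (2 * i) = f (snd (ps ! i))"
proof -
  show "length (concat (map (\<lambda>(x, y). [f x, f y]) ps)) = 2 * length ps"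
    by (induction ps) auto
  have "i < length ps \<Longrightarrow> concat (map (\<lambda>(x, y). [f x, f y]) ps) ! (2 * i) = f (fst (ps ! i)) \<and>
      concat (map (\<lambda>(x, y). [f x, f y]) ps) ! Suc (2 * i) = f (snd (ps ! i))" for i
  proof (induction ps arbitrary: i)
    case (Cons p ps)
    then show ?case by (cases i) (auto simp: case_prod_beta)
  qed simp
  then show "i < length ps \<Longrightarrow> concat (map (\<lambda>(x, y). [f x, f y]) ps) ! (2 * i) = f (fst (ps ! i))"
    "i < length ps \<Longrightarrow> concat (map (\<lambda>(x, y). [f x, f y]) ps) ! Suc (2 * i) = f (snd (ps ! i))"
    by blast+
qed

definition image_graph :: "'p set \<Rightarrow> ('p \<times> 'p) set \<Rightarrow> ('p \<Rightarrow> 'a) \<Rightarrow> 'a pair_pre_digraph" where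
  "image_graph V E g = \<lparr>pverts = g ` V, parcs = (\<lambda>(x, y). (g x, g y)) ` E\<rparr>"

definition count_exp :: "'p atom list \<Rightarrow> nat \<Rightarrow> exp" where
  "count_exp as n = foldr (\<lambda>a e. Op Times (Reg (base_reg a)) e) as (Const n)"

text \<open>The count may be read off plan 0 when all plans share the same kinds, and hence the same
  product of bases.\<close>

definition pattern_sampler ::
    "'p list \<Rightarrow> ('p \<times> 'p) list \<Rightarrow> 'p set list \<Rightarrow> (nat \<Rightarrow> 'p atom list) \<Rightarrow> com" where
  "pattern_sampler vs pa Ss pl = sampler (count_exp (pl 0) (length Ss)) (valid_exp vs pa Ss pl)
     (output_graph vs pa (total_decode Ss pl (Reg 8)))"

context pattern_coder
begin

lemma exec_output_graph:
  assumes st: "ready st" and g: "g \<in> embeddings" and c: "regs st 8 = total_code g"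
    and space: "2 * length es + length vs + 2 * length pa < 2 ^ w"
  shows "\<exists>st'. exec w (output_graph vs pa (total_decode Ss pl (Reg 8))) st =
      return_spmf (st', length vs + 2 * length pa + 6) \<and> ready st' \<and>
      outcome st' = Some (image_graph (set vs) (set pa) g)"
proof -
  let ?d = "total_decode Ss pl (Reg 8)" and ?m = "length es"
  let ?xs = "map ?d vs @ concat (map (\<lambda>(x, y). [?d x, ?d y]) pa)"
  let ?ys = "map g vs @ concat (map (\<lambda>(x, y). [g x, g y]) pa)"
  have len: "length ?xs = length vs + 2 * length pa" "length ?ys = length vs + 2 * length pa"
    by (simp_all add: concat_pairs(1))
  have eval: "map (eval w st') ?xs = ?ys" if "ready st'" "regs st' = regs st" for st'
  proof -
    have d: "eval w st' (?d v) = g v" if v: "v \<in> set vs" for v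
      using \<open>ready st'\<close> g _ v by (rule eval_total_decode) (use \<open>regs st' = regs st\<close> c in simp)
    have pairs: "map (eval w st') (concat (map (\<lambda>(x, y). [?d x, ?d y]) ps)) =
        concat (map (\<lambda>(x, y). [g x, g y]) ps)" if "set ps \<subseteq> set pa" for ps
      using that
    proof (induction ps)
      case (Cons p ps)
      obtain x y where p: "p = (x, y)" by (rule prod.exhaust)
      have "x \<in> set vs" "y \<in> set vs" using Cons.prems arcs p by auto
      then show ?case using Cons.IH Cons.prems d p by simp
    qed simp
    have verts: "map (eval w st') (map ?d vs) = map g vs"
      unfolding map_map by (rule map_cong[OF refl]) (simp only: o_apply d)
    show ?thesis
      unfolding map_append verts pairs[of pa, OF order_refl] by (rule refl)
  qed
  have "\<exists>st'. exec w (store_all 0 ?xs) st = return_spmf (st', Suc (length ?xs)) \<and> ready st' \<and>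
    regs st' = regs st \<and> (\<forall>i<length ?xs. mem st' (2 * ?m + 0 + i) = ?ys ! i) \<and>
    (\<forall>a<2 * ?m + 0. mem st' a = mem st a)"
  proof (rule exec_store_all[OF st])
    show "eval w st' (?xs ! i) = ?ys ! i" if "i < length ?xs" "ready st'" "regs st' = regs st" for i st'
      unfolding eval[OF that(2,3), symmetric] by (rule nth_map[OF that(1), symmetric])
    show "length ?xs = length ?ys" unfolding len ..
    show "2 * ?m + 0 + length ?xs < 2 ^ w" unfolding len using space by simp
  qed
  then obtain st1 where st1: "exec w (store_all 0 ?xs) st = return_spmf (st1, Suc (length ?xs))" "ready st1"
    "regs st1 = regs st" "\<And>i. i < length ?xs \<Longrightarrow> mem st1 (2 * ?m + i) = ?ys ! i" by auto
  define st' where "st' = st1\<lparr>regs := (regs st1)(1 := length vs, 2 := 2 * ?m, 3 := length pa,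
    4 := 2 * ?m + length vs, 0 := 1)\<rparr>"
  have lt: "length vs < 2 ^ w" "length pa < 2 ^ w" "2 * ?m + length vs < 2 ^ w" using space by simp_all
  have r5: "regs st 5 = ?m" using st by (simp add: index_ready_def)
  have "exec w (output_graph vs pa ?d) st = return_spmf (st', Suc (length ?xs) + 5)"
    unfolding output_graph_def
    using st1(1,3) lt word r5 w_pos by (simp add: st'_def const_mod len del: map_append)
  moreover have "ready st'"
    using st1(2) lt word w_pos by (auto simp: st'_def index_ready_def words_def)
  moreover have "outcome st' = Some (image_graph (set vs) (set pa) g)"
  proof -
    have m1: "mem st1 (2 * ?m + i) = g (vs ! i)" if "i < length vs" for i
      using st1(4)[of i] that by (simp add: nth_append concat_pairs(1))
    have m2: "mem st1 (2 * ?m + length vs + 2 * i) = g (fst (pa ! i))"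
      "mem st1 (2 * ?m + length vs + 2 * i + 1) = g (snd (pa ! i))" if "i < length pa" for i
      using st1(4)[of "length vs + 2 * i"] st1(4)[of "length vs + Suc (2 * i)"] that
      by (simp_all add: nth_append concat_pairs add.assoc)
    have "(\<lambda>i. mem st1 (2 * ?m + i)) ` {..<length vs} = (\<lambda>i. g (vs ! i)) ` {..<length vs}"
      using m1 by (intro image_cong) auto
    also have "\<dots> = g ` ((!) vs ` {..<length vs})" by (simp only: image_image)
    also have "(!) vs ` {..<length vs} = set vs" by (metis lessThan_atLeast0 map_nth set_map set_upt)
    finally have v: "(\<lambda>i. mem st1 (2 * ?m + i)) ` {..<length vs} = g ` set vs" .
    have "(\<lambda>i. (mem st1 (2 * ?m + length vs + 2 * i), mem st1 (2 * ?m + length vs + 2 * i + 1))) ` {..<length pa}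
      = (\<lambda>i. (\<lambda>(x, y). (g x, g y)) (pa ! i)) ` {..<length pa}"
      using m2 by (intro image_cong) (auto simp: case_prod_beta)
    also have "\<dots> = (\<lambda>(x, y). (g x, g y)) ` ((!) pa ` {..<length pa})" by (simp only: image_image)
    also have "(!) pa ` {..<length pa} = set pa" by (metis lessThan_atLeast0 map_nth set_map set_upt)
    finally have a: "(\<lambda>i. (mem st1 (2 * ?m + length vs + 2 * i), mem st1 (2 * ?m + length vs + 2 * i + 1)))
      ` {..<length pa} = (\<lambda>(x, y). (g x, g y)) ` set pa" .
    have R: "regs st' 0 = 1" "regs st' 1 = length vs" "regs st' 2 = 2 * ?m" "regs st' 3 = length pa"
      "regs st' 4 = 2 * ?m + length vs" "mem st' = mem st1"
      by (simp_all add: st'_def)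
    show ?thesis
      unfolding outcome_def R image_graph_def v a by simp
  qed
  moreover have "Suc (length ?xs) + 5 = length vs + 2 * length pa + 6" unfolding len by simp
  ultimately show ?thesis by metis
qed

lemma eval_count_exp:
  assumes st: "ready st"
  shows "eval w st (count_exp (pl 0) (length Ss)) = code_space"
proof -
  have gen: "eval w st (count_exp as (length Ss)) = length Ss * vol as" if "length Ss * vol as < 2 ^ w" for as
    using that
  proof (induction as)
    case Nil
    then show ?case by (simp add: count_exp_def)
  next
    case (Cons a as)
    have "length Ss * (1 * vol as) \<le> length Ss * vol (a # as)"
      unfolding vol_simps using base_pos by (intro mult_left_mono mult_right_mono) auto
    from le_less_trans[OF this Cons.prems] have "length Ss * vol as < 2 ^ w" by (simp only: mult_1)
    then have IH: "eval w st (count_exp as (length Ss)) = length Ss * vol as" by (rule Cons.IH)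
    have "eval w st (count_exp (a # as) (length Ss)) = (base a * (length Ss * vol as)) mod 2 ^ w"
      using IH eval_base[OF st, of a] by (simp add: count_exp_def)
    also have "base a * (length Ss * vol as) = length Ss * vol (a # as)" by (simp only: vol_simps ac_simps)
    finally show ?case using Cons.prems by simp
  qed
  have "vol (pl 0) = volume (length es) l s K" using plan_props(4)[of 0] Ss_ne by simp
  then show ?thesis using size gen[of "pl 0"] by (simp add: code_space_def)
qed

lemma finite_embeddings: "finite embeddings" if "ready st"
proof (rule inj_on_finite[OF total_code_inj[OF that]])
  show "total_code ` embeddings \<subseteq> {..<code_space}" using total_code_lt by auto
qed simp

lemma pattern_sampler_operation:
  assumes st0: "ready st0" and space: "2 * length es + length vs + 2 * length pa < 2 ^ w"
  shows "sampling_operation w (pattern_sampler vs pa Ss pl) ready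
    (if embeddings = {} then return_spmf None
     else map_spmf Some (map_spmf (image_graph (set vs) (set pa)) (spmf_of_set embeddings)))
    (ennreal (5 * (real code_space / max 1 (real (card embeddings))) + real (length vs + 2 * length pa + 6) + 5))"
proof -
  interpret code_search w es l s h D "total_code ` embeddings" code_space
    "count_exp (pl 0) (length Ss)" "valid_exp vs pa Ss pl"
  proof
    show "total_code ` embeddings \<subseteq> {..<code_space}" using total_code_lt by auto
    show "0 < code_space" by (rule code_space_pos)
    show "code_space < 2 ^ w" using size by (simp add: code_space_def)
  qed (rule eval_count_exp eval_valid_exp; assumption)+
  define G where "G = (\<lambda>k. image_graph (set vs) (set pa) (inv_into embeddings total_code k))"
  let ?out = "output_graph vs pa (total_decode Ss pl (Reg 8))" and ?T = "length vs + 2 * length pa + 6"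
  have inj: "inj_on total_code embeddings" by (rule total_code_inj[OF st0])
  have "\<forall>st. \<exists>st'. ready st \<longrightarrow> regs st 8 \<in> total_code ` embeddings \<longrightarrow>
    exec w ?out st = return_spmf (st', ?T) \<and> ready st' \<and> outcome st' = Some (G (regs st 8))"
  proof
    fix st
    show "\<exists>st'. ready st \<longrightarrow> regs st 8 \<in> total_code ` embeddings \<longrightarrow>
      exec w ?out st = return_spmf (st', ?T) \<and> ready st' \<and> outcome st' = Some (G (regs st 8))"
    proof (cases "ready st \<and> regs st 8 \<in> total_code ` embeddings")
      case True
      then obtain g where g: "g \<in> embeddings" "regs st 8 = total_code g" by blast
      then have "G (regs st 8) = image_graph (set vs) (set pa) g" using inj by (simp add: G_def)
      then show ?thesis using exec_output_graph[OF _ g space] True by auto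
    qed blast
  qed
  then obtain outs where outs: "\<And>st. ready st \<Longrightarrow> regs st 8 \<in> total_code ` embeddings \<Longrightarrow>
    exec w ?out st = return_spmf (outs st, ?T) \<and> ready (outs st) \<and> outcome (outs st) = Some (G (regs st 8))"
    by metis
  have op: "sampling_operation w (sampler (count_exp (pl 0) (length Ss)) (valid_exp vs pa Ss pl) ?out) ready
    (if total_code ` embeddings = {} then return_spmf None
     else map_spmf (\<lambda>k. Some (G k)) (spmf_of_set (total_code ` embeddings)))
    (ennreal (5 * (real code_space / max 1 (real (card (total_code ` embeddings)))) + real ?T + 5))"
    by (rule sampler_operation[where outs = outs and outt = "\<lambda>_. ?T"]) (use outs in auto)
  have "map_spmf (\<lambda>k. Some (G k)) (spmf_of_set (total_code ` embeddings)) =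
    map_spmf Some (map_spmf (image_graph (set vs) (set pa)) (spmf_of_set embeddings))"
    if "embeddings \<noteq> {}"
  proof -
    have "map_spmf (\<lambda>k. Some (G k)) (spmf_of_set (total_code ` embeddings)) =
      map_spmf (\<lambda>g. Some (G (total_code g))) (spmf_of_set embeddings)"
      using inj by (simp add: spmf.map_comp o_def flip: map_spmf_of_set_inj_on)
    also have "\<dots> = map_spmf (\<lambda>g. Some (image_graph (set vs) (set pa) g)) (spmf_of_set embeddings)"
      using inj finite_embeddings[OF st0] that by (intro map_spmf_cong refl) (simp add: G_def)
    finally show ?thesis by (simp add: spmf.map_comp o_def)
  qed
  then have U: "(if total_code ` embeddings = {} then return_spmf None
     else map_spmf (\<lambda>k. Some (G k)) (spmf_of_set (total_code ` embeddings))) =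
    (if embeddings = {} then return_spmf None
     else map_spmf Some (map_spmf (image_graph (set vs) (set pa)) (spmf_of_set embeddings)))"
    by simp
  show ?thesis
    using op unfolding pattern_sampler_def U card_image[OF inj] .
qed

end

lemma sampling_operation_Cond:
  assumes e: "\<And>st. I st \<Longrightarrow> (eval w st e \<noteq> 0) = b"
    and op: "sampling_operation w (if b then c1 else c2) I U B"
  shows "sampling_operation w (Cond e c1 c2) I U (1 + B)"
proof -
  interpret sampling_operation w "if b then c1 else c2" I U B by fact
  have ex: "exec w (Cond e c1 c2) st = map_spmf (\<lambda>x. (fst x, 1 + snd x)) (exec w (if b then c1 else c2) st)"
    if "I st" for st
    using e[OF that] by (auto simp: map_spmf_conv_bind_spmf case_prod_unfold)
  show ?thesis
  proof
    fix st assume st: "I st"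
    show "lossless_spmf (exec w (Cond e c1 c2) st)"
      unfolding ex[OF st] using exec_lossless[OF st] by simp
    show "I s'" if "(s', t) \<in> set_spmf (exec w (Cond e c1 c2) st)" for s' t
      using that exec_inv[OF st] unfolding ex[OF st] by auto
    show "map_spmf (outcome \<circ> fst) (exec w (Cond e c1 c2) st) = U"
      unfolding ex[OF st] using exec_outcome[OF st] by (simp add: spmf.map_comp o_def)
    have "(\<integral>\<^sup>+ x. of_nat (snd x) \<partial>measure_spmf (exec w (Cond e c1 c2) st)) =
      (\<integral>\<^sup>+ x. 1 + of_nat (snd x) \<partial>measure_spmf (exec w (if b then c1 else c2) st))"
      unfolding ex[OF st] by (simp add: o_def)
    also have "\<dots> = (\<integral>\<^sup>+ x. 1 \<partial>measure_spmf (exec w (if b then c1 else c2) st)) +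
      (\<integral>\<^sup>+ x. of_nat (snd x) \<partial>measure_spmf (exec w (if b then c1 else c2) st))"
      by (rule nn_integral_add) auto
    also have "\<dots> \<le> 1 + B"
      by (intro add_mono exec_time[OF st] nn_integral_spmf_le_const) simp
    finally show "(\<integral>\<^sup>+ x. of_nat (snd x) \<partial>measure_spmf (exec w (Cond e c1 c2) st)) \<le> 1 + B" .
  qed
qed

text \<open>Inequalities between all pairs of fibres force equal sizes, so an injection from each
  fibre into each other one is enough to apply the lemma.\<close>

lemma map_spmf_equal_fibres:
  assumes A: "finite A" "A \<noteq> {}"
    and le: "\<And>x y. x \<in> A \<Longrightarrow> y \<in> A \<Longrightarrow> card {z\<in>A. f z = f x} \<le> card {z\<in>A. f z = f y}"
  shows "map_spmf f (spmf_of_set A) = spmf_of_set (f ` A)"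
proof (rule spmf_uniformI)
  fix b assume "b \<in> f ` A"
  then obtain y where y: "y \<in> A" "b = f y" by blast
  have "card A = (\<Sum>c\<in>f ` A. card {z\<in>A. f z = c})"
    using sum.image_gen[OF A(1), of "\<lambda>_. 1::nat" f] by simp
  also have "\<dots> \<le> (\<Sum>c\<in>f ` A. card {z\<in>A. f z = f y})"
    by (intro sum_mono) (use le y(1) in auto)
  finally have "card A \<le> card (f ` A) * card {z\<in>A. f z = f y}" by simp
  then have "real (card A) \<le> real (card (f ` A)) * real (card {z\<in>A. f z = f y})"
    by (metis of_nat_le_iff of_nat_mult)
  moreover have "0 < card A" "0 < card (f ` A)" using A by (simp_all add: card_gt_0_iff)
  moreover have "spmf (map_spmf f (spmf_of_set A)) b = real (card {z\<in>A. f z = f y}) / real (card A)"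
  proof -
    have "A \<inter> f -` {b} = {z\<in>A. f z = f y}" using y by auto
    then show ?thesis by (simp add: spmf_map measure_spmf_of_set)
  qed
  ultimately show "1 / real (card (f ` A)) \<le> spmf (map_spmf f (spmf_of_set A)) b"
    by (simp only:) (simp add: divide_simps mult.commute)
qed (use A in auto)

section \<open>Occurrences as images of embeddings\<close>

definition graph_embeddings :: "'p pair_pre_digraph \<Rightarrow> 'a pair_pre_digraph \<Rightarrow> ('p \<Rightarrow> 'a) set" where
  "graph_embeddings P G = {g \<in> extensional (pverts P). inj_on g (pverts P) \<and>
     (\<forall>(x, y)\<in>parcs P. (g x, g y) \<in> parcs G)}"

lemma image_graph_arc:
  assumes "inj_on g V" "E \<subseteq> V \<times> V" "x \<in> V" "y \<in> V"
  shows "(g x, g y) \<in> (\<lambda>(x, y). (g x, g y)) ` E \<longleftrightarrow> (x, y) \<in> E"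
proof
  assume "(g x, g y) \<in> (\<lambda>(x, y). (g x, g y)) ` E"
  then obtain x' y' where "(x', y') \<in> E" "g x = g x'" "g y = g y'" by auto
  then show "(x, y) \<in> E" using assms by (metis inj_onD mem_Sigma_iff subsetD)
qed force

text \<open>The equivalence in \<open>occurrences\<close> concerns the arcs selected for the
  subgraph, not all arcs of \<open>G\<close> among its vertices, so occurrences are images of
  injective homomorphisms rather than induced copies. It speaks of distinct vertices; pairs of equal
  ones carry no arc because \<open>G\<close> has no loops. Vertices land in \<open>G\<close> because
  each of them is an endpoint of an arc.\<close>

lemma occurrences_eq:
  fixes P :: "'p pair_pre_digraph" and G :: "'a pair_pre_digraph"
  assumes P: "pair_digraph P" "pverts P \<subseteq> fst ` parcs P \<union> snd ` parcs P" and G: "pair_digraph G"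
  shows "occurrences P G = image_graph (pverts P) (parcs P) ` graph_embeddings P G"
proof -
  interpret P: pair_digraph P by fact
  interpret G: pair_digraph G by fact
  let ?V = "pverts P" and ?E = "parcs P"
  have EV: "?E \<subseteq> ?V \<times> ?V" using P.in_arcsD1 P.in_arcsD2 by auto
  show ?thesis
  proof (intro equalityI subsetI)
    fix H assume "H \<in> image_graph ?V ?E ` graph_embeddings P G"
    then obtain g where g: "inj_on g ?V" "\<And>x y. (x, y) \<in> ?E \<Longrightarrow> (g x, g y) \<in> parcs G"
      and H: "H = image_graph ?V ?E g" by (auto simp: graph_embeddings_def)
    have pH: "pverts H = g ` ?V" "parcs H = (\<lambda>(x, y). (g x, g y)) ` ?E"
      by (simp_all add: H image_graph_def)
    have "g v \<in> pverts G" if "v \<in> ?V" for v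
    proof -
      have "v \<in> fst ` ?E \<union> snd ` ?E" using P(2) that by blast
      then obtain x y where "(x, y) \<in> ?E" "v = x \<or> v = y" by auto
      then show ?thesis using g(2)[of x y] G.in_arcsD1 G.in_arcsD2 by blast
    qed
    then have sv: "pverts H \<subseteq> pverts G" by (auto simp: pH)
    have sa: "parcs H \<subseteq> parcs G" using g(2) by (auto simp: pH)
    have "pair_wf_digraph H"
      by unfold_locales (use EV in \<open>auto simp: pH\<close>)
    then have "wf_digraph (with_proj H)" by (simp add: wf_digraph_wp_iff)
    moreover have "wf_digraph (with_proj G)" using G.pair_wf_digraph by (simp add: wf_digraph_wp_iff)
    ultimately have sub: "subgraph (with_proj H) (with_proj G)"
      using sv sa by (simp add: subgraph_def compatible_def)
    let ?f = "inv_into ?V g"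
    have fg: "?f (g x) = x" if "x \<in> ?V" for x using g(1) that by simp
    have "bij_betw ?f (pverts H) ?V"
      unfolding pH by (rule bij_betw_inv_into) (simp add: bij_betw_def g(1))
    moreover have "(u1, u2) \<in> parcs H \<longleftrightarrow> (?f u1, ?f u2) \<in> ?E" if "u1 \<in> pverts H" "u2 \<in> pverts H" for u1 u2
    proof -
      obtain x y where xy: "x \<in> ?V" "y \<in> ?V" "u1 = g x" "u2 = g y" using \<open>u1 \<in> pverts H\<close> \<open>u2 \<in> pverts H\<close> by (auto simp: pH)
      show ?thesis using image_graph_arc[OF g(1) EV xy(1,2)] xy fg by (simp add: pH)
    qed
    ultimately show "H \<in> occurrences P G"
      unfolding occurrences_def using sub by blast
  next
    fix H assume "H \<in> occurrences P G"
    then obtain f where sub: "subgraph (with_proj H) (with_proj G)"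
      and f: "bij_betw f (pverts H) ?V"
      and arcs: "\<And>u1 u2. u1 \<in> pverts H \<Longrightarrow> u2 \<in> pverts H \<Longrightarrow> u1 \<noteq> u2 \<Longrightarrow> (u1, u2) \<in> parcs H \<longleftrightarrow> (f u1, f u2) \<in> ?E"
      unfolding occurrences_def by blast
    have Hwf: "pair_wf_digraph H" and sa: "parcs H \<subseteq> parcs G"
      using sub by (simp_all add: subgraph_def wf_digraph_wp_iff)
    define g where "g = restrict (inv_into (pverts H) f) ?V"
    have bij: "bij_betw g ?V (pverts H)"
      using bij_betw_inv_into[OF f] unfolding g_def by (simp add: bij_betw_restrict_eq)
    have gV: "g x \<in> pverts H" "f (g x) = x" if "x \<in> ?V" for x
      using bij that f by (auto simp: bij_betw_def g_def f_inv_into_f)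
    have gf: "g (f u) = u" "f u \<in> ?V" if "u \<in> pverts H" for u
      using f that by (auto simp: g_def bij_betw_def)
    have garc: "(g x, g y) \<in> parcs H" if xy: "(x, y) \<in> ?E" for x y
    proof -
      have V: "x \<in> ?V" "y \<in> ?V" "x \<noteq> y" using xy P.in_arcsD1 P.in_arcsD2 P.no_loops' by blast+
      have "g x \<noteq> g y" using gV(2)[OF V(1)] gV(2)[OF V(2)] V(3) by metis
      then show ?thesis using arcs[of "g x" "g y"] gV V xy by simp
    qed
    have "g \<in> extensional ?V" by (simp add: g_def)
    moreover have "inj_on g ?V" using bij by (simp add: bij_betw_def)
    moreover have "\<forall>(x, y)\<in>?E. (g x, g y) \<in> parcs G" using garc sa by blast
    ultimately have "g \<in> graph_embeddings P G" unfolding graph_embeddings_def by blast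
    moreover have "parcs H \<subseteq> (\<lambda>(x, y). (g x, g y)) ` ?E"
    proof
      fix e assume e: "e \<in> parcs H"
      obtain u1 u2 where u: "e = (u1, u2)" by (rule prod.exhaust)
      have "(u1, u2) \<in> parcs G" using e u sa by blast
      then have uH: "u1 \<in> pverts H" "u2 \<in> pverts H" "u1 \<noteq> u2"
        using e u pair_wf_digraph.in_arcsD1[OF Hwf, of u1 u2] pair_wf_digraph.in_arcsD2[OF Hwf, of u1 u2]
          G.no_loops'[of u1 u2] by simp_all
      then have "(f u1, f u2) \<in> ?E" using arcs e u by blast
      then show "e \<in> (\<lambda>(x, y). (g x, g y)) ` ?E"
        using gf uH u by (intro image_eqI[of _ _ "(f u1, f u2)"]) auto
    qed
    then have "image_graph ?V ?E g = H"
      using garc bij by (intro pair_pre_digraph.equality) (auto simp: image_graph_def bij_betw_def)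
    ultimately show "H \<in> image_graph ?V ?E ` graph_embeddings P G" by blast
  qed
qed

text \<open>Embeddings with the same image graph differ by an automorphism of \<open>P\<close>. With
  \<open>\<sigma> g\<close> the automorphism for which \<open>g\<close> is \<open>g1\<close> after
  \<open>\<sigma> g\<close>, sending \<open>g\<close> to \<open>g2\<close> after
  \<open>\<sigma> g\<close> injects one fibre into the other.\<close>

lemma embedding_fibres:
  fixes P :: "'p pair_pre_digraph" and G :: "'a pair_pre_digraph"
  assumes P: "pair_digraph P" and fin: "finite (graph_embeddings P G)"
    and g1: "g1 \<in> graph_embeddings P G" and g2: "g2 \<in> graph_embeddings P G"
  defines "F \<equiv> image_graph (pverts P) (parcs P)"
  shows "card {g \<in> graph_embeddings P G. F g = F g1} \<le> card {g \<in> graph_embeddings P G. F g = F g2}"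
proof -
  interpret P: pair_digraph P by fact
  let ?V = "pverts P" and ?E = "parcs P"
  have EV: "?E \<subseteq> ?V \<times> ?V" using P.in_arcsD1 P.in_arcsD2 by auto
  have inj: "inj_on g1 ?V" "inj_on g2 ?V" using g1 g2 by (simp_all add: graph_embeddings_def)
  define \<sigma> :: "('p \<Rightarrow> 'a) \<Rightarrow> 'p \<Rightarrow> 'p" where "\<sigma> = (\<lambda>g v. inv_into ?V g1 (g v))"
  define \<Psi> where "\<Psi> = (\<lambda>g. restrict (\<lambda>v. g2 (\<sigma> g v)) ?V)"
  have fibre: "\<sigma> g v \<in> ?V" "g1 (\<sigma> g v) = g v" if "F g = F g1" "v \<in> ?V" for g v
  proof -
    have "g ` ?V = g1 ` ?V" using that(1) by (simp add: F_def image_graph_def)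
    then have "g v \<in> g1 ` ?V" using that(2) by blast
    then show "\<sigma> g v \<in> ?V" "g1 (\<sigma> g v) = g v"
      by (simp_all add: \<sigma>_def inv_into_into f_inv_into_f)
  qed
  show ?thesis
  proof (rule card_inj_on_le[of \<Psi>])
    show "inj_on \<Psi> {g \<in> graph_embeddings P G. F g = F g1}"
    proof (rule inj_onI)
      fix g g' assume g: "g \<in> {g \<in> graph_embeddings P G. F g = F g1}"
        and g': "g' \<in> {g \<in> graph_embeddings P G. F g = F g1}" and eq: "\<Psi> g = \<Psi> g'"
      have "g v = g' v" if v: "v \<in> ?V" for v
      proof -
        have "g2 (\<sigma> g v) = g2 (\<sigma> g' v)" using fun_cong[OF eq, of v] v by (simp add: \<Psi>_def)
        then have "\<sigma> g v = \<sigma> g' v"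
          using inj(2) fibre(1)[of g v] fibre(1)[of g' v] g g' v by (auto dest: inj_onD)
        then show ?thesis using fibre(2)[of g v] fibre(2)[of g' v] g g' v by simp
      qed
      then show "g = g'"
        using g g' by (intro extensionalityI[of g ?V g']) (auto simp: graph_embeddings_def)
    qed
    show "\<Psi> ` {g \<in> graph_embeddings P G. F g = F g1} \<subseteq> {g \<in> graph_embeddings P G. F g = F g2}"
    proof (intro image_subsetI)
      fix g assume "g \<in> {g \<in> graph_embeddings P G. F g = F g1}"
      then have g: "g \<in> graph_embeddings P G" and Fg: "F g = F g1" by auto
      have injg: "inj_on g ?V" using g by (simp add: graph_embeddings_def)
      have inj\<sigma>: "inj_on (\<sigma> g) ?V"
        using fibre(2)[OF Fg] injg by (metis (no_types, lifting) inj_on_def)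
      have \<sigma>V: "\<sigma> g ` ?V = ?V"
        using fibre(1)[OF Fg] inj\<sigma> P.pair_finite_verts
        by (intro card_subset_eq card_image) auto
      have imgs: "(\<lambda>(x, y). (g x, g y)) ` ?E = (\<lambda>(x, y). (g1 x, g1 y)) ` ?E"
        using Fg by (simp add: F_def image_graph_def)
      have \<sigma>arc: "(\<sigma> g x, \<sigma> g y) \<in> ?E" if "(x, y) \<in> ?E" for x y
      proof -
        have V: "x \<in> ?V" "y \<in> ?V" using that EV by auto
        have "(g x, g y) \<in> (\<lambda>(x, y). (g1 x, g1 y)) ` ?E" using that imgs by force
        then have "(g1 (\<sigma> g x), g1 (\<sigma> g y)) \<in> (\<lambda>(x, y). (g1 x, g1 y)) ` ?E"
          using fibre(2)[OF Fg] V by simp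
        then show ?thesis using image_graph_arc[OF inj(1) EV] fibre(1)[OF Fg] V by blast
      qed
      let ?s = "\<lambda>(x, y). (\<sigma> g x, \<sigma> g y)"
      \<comment> \<open>An injective map of the finite arc set into itself is onto, so
        \<open>\<sigma> g\<close> permutes the arcs.\<close>
      have "inj_on ?s ?E"
        using inj\<sigma> EV by (auto simp: inj_on_def)
      then have \<sigma>E: "?s ` ?E = ?E"
        using \<sigma>arc P.pair_finite_arcs by (intro card_subset_eq card_image) auto
      have arcs: "(\<lambda>(x, y). (\<Psi> g x, \<Psi> g y)) ` ?E = (\<lambda>(x, y). (g2 x, g2 y)) ` ?E"
      proof -
        have "(\<lambda>(x, y). (\<Psi> g x, \<Psi> g y)) ` ?E = (\<lambda>(x, y). (g2 x, g2 y)) ` (?s ` ?E)"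
          unfolding image_image using EV by (intro image_cong) (auto simp: \<Psi>_def)
        then show ?thesis by (simp only: \<sigma>E)
      qed
      have verts: "\<Psi> g ` ?V = g2 ` ?V"
      proof -
        have "\<Psi> g ` ?V = g2 ` (\<sigma> g ` ?V)" unfolding image_image by (intro image_cong) (auto simp: \<Psi>_def)
        then show ?thesis by (simp only: \<sigma>V)
      qed
      have "inj_on (\<Psi> g) ?V"
      proof (rule inj_onI)
        fix x y assume xy: "x \<in> ?V" "y \<in> ?V" "\<Psi> g x = \<Psi> g y"
        then have "g2 (\<sigma> g x) = g2 (\<sigma> g y)" by (simp add: \<Psi>_def)
        then have "\<sigma> g x = \<sigma> g y" using inj(2) fibre(1)[OF Fg] xy by (auto dest: inj_onD)
        then show "x = y" using inj\<sigma> xy by (auto dest: inj_onD)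
      qed
      moreover have "(\<Psi> g x, \<Psi> g y) \<in> parcs G" if "(x, y) \<in> ?E" for x y
      proof -
        have "(\<Psi> g x, \<Psi> g y) \<in> (\<lambda>(x, y). (g2 x, g2 y)) ` ?E" using that arcs by force
        then show ?thesis using g2 by (auto simp: graph_embeddings_def)
      qed
      moreover have "\<Psi> g \<in> extensional ?V" by (simp add: \<Psi>_def)
      ultimately have "\<Psi> g \<in> graph_embeddings P G"
        unfolding graph_embeddings_def by blast
      moreover have "F (\<Psi> g) = F g2" by (simp add: F_def image_graph_def verts arcs)
      ultimately show "\<Psi> g \<in> {g \<in> graph_embeddings P G. F g = F g2}" by simp
    qed
  qed (use fin in simp)
qed

lemma uniform_occurrence_eq:
  assumes P: "pair_digraph P" "pverts P \<subseteq> fst ` parcs P \<union> snd ` parcs P" and G: "pair_digraph G"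
    and fin: "finite (graph_embeddings P G)"
  shows "uniform_occurrence P G = (if graph_embeddings P G = {} then return_spmf None
    else map_spmf Some (map_spmf (image_graph (pverts P) (parcs P)) (spmf_of_set (graph_embeddings P G))))"
proof (cases "graph_embeddings P G = {}")
  case True
  then show ?thesis by (simp add: uniform_occurrence_def occurrences_eq[OF P G])
next
  case False
  have "map_spmf (image_graph (pverts P) (parcs P)) (spmf_of_set (graph_embeddings P G)) =
      spmf_of_set (occurrences P G)"
    unfolding occurrences_eq[OF P G]
    by (rule map_spmf_equal_fibres[OF fin False]) (rule embedding_fibres[OF P(1) fin])
  then show ?thesis using False by (simp add: uniform_occurrence_def occurrences_eq[OF P G])
qed

section \<open>Assembling the program and its constants\<close>

record 'p scheme =
  subsets :: "'p set list"
  plans :: "nat \<Rightarrow> 'p atom list"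
  kinds :: "kind multiset"

text \<open>The data depends on the pattern and the density regime alone, so it can be built into
  the program text.\<close>

definition scheme_for :: "'p pair_pre_digraph \<Rightarrow> bool \<Rightarrow> 'p scheme \<Rightarrow> bool" where
  "scheme_for P dense c \<longleftrightarrow> set (subsets c) = Pow (pverts P) \<and> distinct (subsets c) \<and>
     (\<forall>i<length (subsets c). plan_for (parcs P) (subsets c ! i) (kinds c) (pverts P) (plans c i)) \<and>
     sampling_kinds P dense (kinds c)"

lemma scheme_exists:
  assumes P: "pair_digraph P" and K: "sampling_kinds P dense K"
  shows "\<exists>c. scheme_for P dense c"
proof -
  interpret pair_digraph P by fact
  obtain Ss where Ss: "set Ss = Pow (pverts P)" "distinct Ss"
    using finite_distinct_list[of "Pow (pverts P)"] pair_finite_verts by auto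
  obtain f where f: "\<And>S. plan_for (parcs P) S K (pverts P) (f S)"
    using K unfolding sampling_kinds_def by metis
  have "scheme_for P dense \<lparr>subsets = Ss, plans = (\<lambda>i. f (Ss ! i)), kinds = K\<rparr>"
    using Ss f K by (simp add: scheme_for_def)
  then show ?thesis by blast
qed

lemma volume_le_power:
  assumes "1 \<le> m" "l \<le> m" "s \<le> m"
  shows "volume m l s K \<le> m ^ size K"
proof (induction K)
  case (add k K)
  have "kind_base m l s k \<le> m" using assms by (cases k) auto
  then show ?case using add by (simp add: volume_def mult_mono)
qed (simp add: volume_def)

text \<open>Constants of the pattern are absorbed by powers of \<open>m + 1\<close>, which is at
  least 2, using \<open>n < 2 ^ n\<close>; a large enough exponent \<open>c\<close> then excludes
  every overflow.\<close>

lemma power_word_bounds: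
  fixes m :: nat
  assumes m: "1 \<le> m" and w: "(m + 1) ^ c \<le> 2 ^ w"
  shows "2 + n \<le> c \<Longrightarrow> 2 * m + n < 2 ^ w"
    and "L + k + 1 \<le> c \<Longrightarrow> v \<le> m ^ k \<Longrightarrow> L * v < 2 ^ w"
    and "4 \<le> c \<Longrightarrow> (m + 1) ^ 4 \<le> 2 ^ w"
proof -
  have two: "2 \<le> m + 1" using m by simp
  have pw: "(m + 1) ^ d \<le> 2 ^ w" if "d \<le> c" for d
    using power_increasing[OF that, of "m + 1"] w by simp
  have exp: "n < (m + 1) ^ n" for n
    using less_exp[of n] power_mono[OF two, of n] by linarith
  show "2 * m + n < 2 ^ w" if "2 + n \<le> c"
  proof -
    have "2 * m + n < 2 * (m + 1) * (n + 1)" by simp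
    also have "\<dots> \<le> (m + 1) * (m + 1) * (m + 1) ^ n"
      using two exp[of n] by (intro mult_mono) auto
    also have "\<dots> = (m + 1) ^ (2 + n)" by (simp only: power_add power2_eq_square)
    also have "\<dots> \<le> 2 ^ w" using that by (rule pw)
    finally show ?thesis .
  qed
  show "L * v < 2 ^ w" if "L + k + 1 \<le> c" "v \<le> m ^ k"
  proof -
    have "v \<le> (m + 1) ^ k" using that(2) power_mono[of m "m + 1" k] by simp
    then have "L * v \<le> (m + 1) ^ L * (m + 1) ^ k" using exp[of L] by (intro mult_mono) auto
    also have "\<dots> < (m + 1) ^ (L + k + 1)" using m by (simp add: power_add)
    also have "\<dots> \<le> 2 ^ w" using that(1) by (rule pw)
    finally show ?thesis .
  qed
  show "(m + 1) ^ 4 \<le> 2 ^ w" if "4 \<le> c" using that by (rule pw)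
qed

lemma out_count_out_degree:
  assumes "distinct es" "set es = parcs G"
  shows "out_count es u = out_degree (with_proj G) u"
proof -
  have "out_count es u = card (set (filter (\<lambda>e. fst e = u) es))"
    unfolding out_count_def by (rule distinct_card[symmetric]) (simp add: assms(1))
  also have "set (filter (\<lambda>e. fst e = u) es) = out_arcs (with_proj G) u"
    using assms(2) by (auto simp: out_arcs_def)
  finally show ?thesis by (simp add: out_degree_def)
qed

text \<open>The cost of a trial is dominated by the number of trials, because the code space has at least
  as many elements as there are embeddings.\<close>

lemma trial_cost_le:
  fixes L v T :: nat and B :: real
  assumes N: "1 \<le> L" "1 \<le> v" and e: "e \<le> L * v" and o: "o' \<le> e" and v: "real v \<le> B"
  shows "1 + (5 * (real (L * v) / max 1 (real e)) + real T + 5) \<le>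
    (real T + 11) * real L * (B / max 1 (real o'))"
proof -
  let ?x = "real (L * v) / max 1 (real e)"
  have "1 \<le> L * v" using N by simp
  then have "max 1 (real e) \<le> real (L * v)" using e by (metis max.bounded_iff of_nat_1 of_nat_le_iff)
  then have x: "1 \<le> ?x" by (simp add: le_divide_eq)
  \<comment> \<open>The additive \<open>t + 6\<close> is at most \<open>(t + 6) * x\<close>, since
    \<open>1 \<le> x\<close>; together with \<open>5 * x\<close> this makes 11.\<close>
  have "1 + (5 * x + t + 5) \<le> (t + 11) * x" if "1 \<le> x" "0 \<le> t" for x t :: real
    using mult_left_mono[OF that] that by (simp add: algebra_simps)
  from this[OF x] have "1 + (5 * ?x + real T + 5) \<le> (real T + 11) * ?x" by simp
  also have "?x \<le> real (L * v) / max 1 (real o')"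
    using o by (intro divide_left_mono) auto
  then have "(real T + 11) * ?x \<le> (real T + 11) * (real (L * v) / max 1 (real o'))"
    by (intro mult_left_mono) auto
  also have "real (L * v) / max 1 (real o') \<le> (real L * B) / max 1 (real o')"
    using v by (intro divide_right_mono) (simp_all add: mult_left_mono)
  then have "(real T + 11) * (real (L * v) / max 1 (real o')) \<le> (real T + 11) * ((real L * B) / max 1 (real o'))"
    by (intro mult_left_mono) auto
  finally show ?thesis by (simp add: mult.assoc)
qed

definition scheme_sampler :: "'p list \<Rightarrow> ('p \<times> 'p) list \<Rightarrow> 'p scheme \<Rightarrow> com" where
  "scheme_sampler vs pa c = pattern_sampler vs pa (subsets c) (plans c)"

lemma scheme_sampler_operation:
  fixes P :: "'p pair_pre_digraph"
  assumes P: "pair_digraph P" "pverts P \<subseteq> fst ` parcs P \<union> snd ` parcs P"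
    and vs: "set vs = pverts P" and pa: "set pa = parcs P"
    and c: "scheme_for P dense c" and dense: "length es < l * l \<longleftrightarrow> dense"
    and G: "pair_digraph G" and es_G: "set es = parcs G"
    and gi: "graph_index w es l s h D" and st0: "index_ready w es l s D st0"
    and space: "2 * length es + (length vs + 2 * length pa) < 2 ^ w"
      "length (subsets c) * volume (length es) l s (kinds c) < 2 ^ w"
  shows "\<exists>B. sampling_operation w (scheme_sampler vs pa c) (index_ready w es l s D) (uniform_occurrence P G) B \<and>
    1 + B \<le> ennreal ((real (length vs + 2 * length pa + 6) + 11) * real (length (subsets c)) *
      (polymat_dir (length es) l P / max 1 (real (card (occurrences P G)))))"
proof -
  interpret graph_index w es l s h D by fact
  interpret pattern_coder w es l s h D vs pa "subsets c" "plans c" "kinds c"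
  proof
    show "set pa \<subseteq> set vs \<times> set vs"
      using P(1) unfolding vs pa pair_digraph_def pair_fin_digraph_def
      by (auto dest: pair_wf_digraph.in_arcsD1 pair_wf_digraph.in_arcsD2)
  qed (use c vs pa space(2) in \<open>auto simp: scheme_for_def\<close>)
  have emb: "embeddings = graph_embeddings P G"
    by (simp add: embeddings_def graph_embeddings_def vs pa es_G)
  have fin: "finite embeddings" using st0 by (rule finite_embeddings)
  have U: "uniform_occurrence P G = (if embeddings = {} then return_spmf None
     else map_spmf Some (map_spmf (image_graph (set vs) (set pa)) (spmf_of_set embeddings)))"
    using uniform_occurrence_eq[OF P G] fin unfolding emb vs pa by blast
  let ?T = "length vs + 2 * length pa + 6"
  let ?B = "5 * (real code_space / max 1 (real (card embeddings))) + real ?T + 5"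
  have "sampling_operation w (scheme_sampler vs pa c) ready (uniform_occurrence P G) (ennreal ?B)"
    unfolding scheme_sampler_def U using st0 space(1) by (intro pattern_sampler_operation) auto
  moreover have "1 + ennreal ?B \<le> ennreal ((real ?T + 11) * real (length (subsets c)) *
      (polymat_dir (length es) l P / max 1 (real (card (occurrences P G)))))"
  proof -
    have "1 + ennreal ?B = ennreal (1 + ?B)" by (subst ennreal_plus) auto
    also have "\<dots> \<le> ennreal ((real ?T + 11) * real (length (subsets c)) *
      (polymat_dir (length es) l P / max 1 (real (card (occurrences P G)))))"
    proof (rule ennreal_leI)
      show "1 + ?B \<le> (real ?T + 11) * real (length (subsets c)) *
        (polymat_dir (length es) l P / max 1 (real (card (occurrences P G))))"
        unfolding code_space_def
      proof (rule trial_cost_le)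
        show "1 \<le> length (subsets c)" using Ss_ne by (simp add: Suc_le_eq)
        show "1 \<le> volume (length es) l s (kinds c)" by (rule vol_pos')
        have "card embeddings = card (total_code ` embeddings)"
          by (rule card_image[OF total_code_inj[OF st0], symmetric])
        also have "\<dots> \<le> card {..<code_space}"
          using total_code_lt by (intro card_mono) auto
        finally show "card embeddings \<le> length (subsets c) * volume (length es) l s (kinds c)"
          by (simp add: code_space_def)
        show "card (occurrences P G) \<le> card embeddings"
          unfolding occurrences_eq[OF P G] emb[symmetric] using fin by (rule card_image_le)
        show "real (volume (length es) l s (kinds c)) \<le> polymat_dir (length es) l P"
          using c l s dense unfolding scheme_for_def sampling_kinds_def by blast
      qed
    qed
    finally show ?thesis .
  qed
  ultimately show ?thesis by blast
qed

theorem theorem4p2: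
  fixes P :: "'p pair_pre_digraph"
  assumes "pair_digraph P"
    and "Digraph_Component.connected (with_proj P)"
    and "parcs P \<noteq> {}"
  shows "\<exists>build sample :: com. \<exists>c :: nat. \<exists>C :: real.
    \<forall>(G :: nat pair_pre_digraph) (l :: nat) (w :: nat) (es :: (nat \<times> nat) list) (n :: nat).
      pair_digraph G \<and> parcs G \<noteq> {} \<and>
      1 \<le> l \<and> l \<le> card (parcs G) \<and>
      (\<forall>v\<in>pverts G. out_degree (with_proj G) v \<le> l) \<and>
      pverts G \<subseteq> {..<2 ^ w} \<and> (card (parcs G) + 1) ^ c \<le> 2 ^ w \<and>
      distinct es \<and> set es = parcs G \<longrightarrow>
      (let D = session w build sample n (input_state l es) in
        lossless_spmf D \<and>
        (\<integral>\<^sup>+ x. of_nat (fst x) \<partial>measure_spmf D) \<le> ennreal (C * real (card (parcs G))) \<and>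
        (\<forall>i<n. (\<integral>\<^sup>+ x. of_nat (snd (snd x ! i)) \<partial>measure_spmf D)
           \<le> ennreal (C * (polymat_dir (card (parcs G)) l P
                / max 1 (real (card (occurrences P G)))))) \<and>
        (\<forall>i<n. map_spmf (\<lambda>x. fst (snd x ! i)) D = uniform_occurrence P G) \<and>
        prob_space.indep_vars (measure_spmf D) (\<lambda>_. count_space UNIV)
          (\<lambda>i x. fst (snd x ! i)) {..<n})"
proof -
  interpret P: pair_digraph P by fact
  have cover: "pverts P \<subseteq> fst ` parcs P \<union> snd ` parcs P" by (rule connected_cover[OF assms])
  obtain vs where vs: "set vs = pverts P" using finite_list[OF P.pair_finite_verts] by blast
  obtain pa where pa: "set pa = parcs P" using finite_list[OF P.pair_finite_arcs] by blast
  \<comment> \<open>Both regimes are prepared; the program picks one at run time by comparing the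
    number of arcs with \<open>l * l\<close>.\<close>
  have "\<forall>dense. \<exists>c. scheme_for P dense c"
  proof
    fix dense
    obtain K where "sampling_kinds P dense K"
      using sampling_kinds_dense[OF assms(1) cover] sampling_kinds_sparse[OF assms(1) cover]
      by (cases dense) auto
    then show "\<exists>c. scheme_for P dense c" by (rule scheme_exists[OF assms(1)])
  qed
  then obtain sch where sch: "\<And>dense. scheme_for P dense (sch dense)" by metis
  let ?n = "length vs + 2 * length pa"
  let ?L = "\<lambda>b. length (subsets (sch b))"
  define sample where "sample = Cond (Op Less (Reg 5) (Op Times (Reg 6) (Reg 6)))
    (scheme_sampler vs pa (sch True)) (scheme_sampler vs pa (sch False))"
  \<comment> \<open>The exponent adds up what \<open>power_word_bounds\<close> asks for: 4 for the
    index, the pattern size for output addresses, and for each regime the number of heavy sets, the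
    size of the plans and 1 for the code space.\<close>
  define c where "c = 4 + ?n + (?L True + size (kinds (sch True)) + 1) + (?L False + size (kinds (sch False)) + 1)"
  \<comment> \<open>The 20 comes from the construction; the product is the constant of
    \<open>trial_cost_le\<close>, with both enumerations in place of the one in use.\<close>
  define C where "C = 20 + (real (?n + 6) + 11) * real (?L True + ?L False)"
  show ?thesis
  proof (rule exI[of _ build_index], rule exI[of _ sample], rule exI[of _ c], rule exI[of _ C],
      intro allI impI)
    fix G :: "nat pair_pre_digraph" and l w :: nat and es :: "(nat \<times> nat) list" and n :: nat
    assume *: "pair_digraph G \<and> parcs G \<noteq> {} \<and>
      1 \<le> l \<and> l \<le> card (parcs G) \<and>
      (\<forall>v\<in>pverts G. out_degree (with_proj G) v \<le> l) \<and>
      pverts G \<subseteq> {..<2 ^ w} \<and> (card (parcs G) + 1) ^ c \<le> 2 ^ w \<and>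
      distinct es \<and> set es = parcs G"
    then interpret G: pair_digraph G by blast
    have es: "distinct es" "set es = parcs G" "es \<noteq> []" using * by auto
    have m: "card (parcs G) = length es" using es by (metis distinct_card)
    have l: "1 \<le> l" "l \<le> length es" using * m by auto
    have m1: "1 \<le> length es" using l by simp
    have w: "(length es + 1) ^ c \<le> 2 ^ w" using * m by simp
    note bounds = power_word_bounds[OF m1 w]
    have arcs_w: "u < 2 ^ w \<and> v < 2 ^ w" if "(u, v) \<in> set es" for u v
    proof -
      have "u \<in> pverts G" "v \<in> pverts G" using that es(2) G.in_arcsD1 G.in_arcsD2 by blast+
      then show ?thesis using * by blast
    qed
    have deg: "out_count es u \<le> l" for u
    proof (cases "u \<in> pverts G")
      case True
      then show ?thesis using * out_count_out_degree[OF es(1,2), of u] by simp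
    next
      case False
      then have "filter (\<lambda>e. fst e = u) es = []"
        using es(2) G.in_arcsD1 by (auto simp: filter_empty_conv)
      then show ?thesis by (simp add: out_count_def)
    qed
    have w4: "(length es + 1) ^ 4 \<le> 2 ^ w" using bounds(3) by (simp add: c_def)
    obtain st t D s h where build: "exec w build_index (input_state l es) = return_spmf (st, t)"
      and t: "t \<le> 20 * length es" and ready: "index_ready w es l s D st" and D: "dict_ok s es h D"
      and s: "s * s \<le> length es" "length es < Suc s * Suc s"
      using build_index_correct[OF es(1) arcs_w l(2) es(3) w4] by blast
    have w16: "16 \<le> (2::nat) ^ w"
    proof -
      have "(2::nat) ^ 4 \<le> (length es + 1) ^ 4" using m1 by (intro power_mono) auto
      then show ?thesis using w4 by simp
    qed
    have space: "2 * length es + ?n < 2 ^ w" by (rule bounds(1)) (simp add: c_def)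
    have gi: "graph_index w es l s h D"
      by unfold_locales (use es l deg s D w16 space in auto)
    have sm: "s \<le> length es" using s(1) le_square[of s] by linarith
    define b where "b \<longleftrightarrow> length es < l * l"
    have vol: "?L b * volume (length es) l s (kinds (sch b)) < 2 ^ w"
      by (rule bounds(2)[OF _ volume_le_power[OF m1 l(2) sm]]) (cases b; simp add: c_def)
    obtain B where B: "sampling_operation w (scheme_sampler vs pa (sch b)) (index_ready w es l s D)
        (uniform_occurrence P G) B"
      and B_le: "1 + B \<le> ennreal ((real (?n + 6) + 11) * real (?L b) *
        (polymat_dir (length es) l P / max 1 (real (card (occurrences P G)))))"
      using scheme_sampler_operation[OF assms(1) cover vs pa sch[of b] b_def[symmetric] G.pair_digraph
          es(2) gi ready space vol] by blast
    have op: "sampling_operation w sample (index_ready w es l s D) (uniform_occurrence P G) (1 + B)"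
      unfolding sample_def
    proof (rule sampling_operation_Cond[where b = b])
      fix st' assume "index_ready w es l s D st'"
      then have r: "regs st' 5 = length es" "regs st' 6 = l" by (simp_all add: index_ready_def)
      \<comment> \<open>As the product does not wrap around, the comparison made by the machine
        decides the regime correctly.\<close>
      have "l * l < 2 ^ w"
      proof -
        have "l * l < (length es + 1) * (length es + 1)" using l(2) by (intro mult_strict_mono) auto
        also have "\<dots> \<le> (length es + 1) * (length es + 1) * ((length es + 1) * (length es + 1))" by simp
        also have "\<dots> = (length es + 1) ^ 4" by (simp only: power4_eq_xxxx mult.assoc)
        also note w4
        finally show ?thesis .
      qed
      moreover have "0 < w" using w16 by (cases w) auto
      ultimately show "(eval w st' (Op Less (Reg 5) (Op Times (Reg 6) (Reg 6))) \<noteq> 0) = b"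
        using r by (simp add: b_def)
    next
      show "sampling_operation w (if b then scheme_sampler vs pa (sch True) else scheme_sampler vs pa (sch False))
        (index_ready w es l s D) (uniform_occurrence P G) B"
        using B by (cases b) simp_all
    qed
    interpret sampling_operation w sample "index_ready w es l s D" "uniform_occurrence P G" "1 + B"
      by (rule op)
    have U: "lossless_spmf (uniform_occurrence P G)"
      using exec_lossless[OF ready] exec_outcome[OF ready] by (metis lossless_map_spmf)
    define S where "S = session w build_index sample n (input_state l es)"
    note correct = session_correct[OF build ready U S_def]
    have "0 \<le> polymat_dir (length es) l P" by (simp add: polymat_dir_def)
    then have q: "0 \<le> polymat_dir (length es) l P / max 1 (real (card (occurrences P G)))" by simp
    have "(\<integral>\<^sup>+ x. of_nat (fst x) \<partial>measure_spmf S) \<le> ennreal (C * real (card (parcs G)))"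
    proof -
      have "real t \<le> 20 * real (length es)" using t by linarith
      also have "\<dots> \<le> C * real (card (parcs G))"
        unfolding m by (intro mult_right_mono) (simp_all add: C_def)
      finally have "of_nat t \<le> ennreal (C * real (card (parcs G)))"
        unfolding ennreal_of_nat_eq_real_of_nat by (rule ennreal_leI)
      with correct(2) show ?thesis by (rule order_trans)
    qed
    moreover have "(\<integral>\<^sup>+ x. of_nat (snd (snd x ! i)) \<partial>measure_spmf S)
      \<le> ennreal (C * (polymat_dir (card (parcs G)) l P / max 1 (real (card (occurrences P G)))))"
      if "i < n" for i
    proof -
      have "(real (?n + 6) + 11) * real (?L b) \<le> C"
      proof -
        have "real (?L b) \<le> real (?L True + ?L False)" by (cases b) auto
        then have "(real (?n + 6) + 11) * real (?L b) \<le> (real (?n + 6) + 11) * real (?L True + ?L False)"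
          by (rule mult_left_mono) simp
        then show ?thesis unfolding C_def by linarith
      qed
      then have "(real (?n + 6) + 11) * real (?L b) * (polymat_dir (length es) l P / max 1 (real (card (occurrences P G))))
        \<le> C * (polymat_dir (length es) l P / max 1 (real (card (occurrences P G))))"
        using q by (rule mult_right_mono)
      then have "ennreal ((real (?n + 6) + 11) * real (?L b) * (polymat_dir (length es) l P / max 1 (real (card (occurrences P G)))))
        \<le> ennreal (C * (polymat_dir (length es) l P / max 1 (real (card (occurrences P G)))))"
        by (rule ennreal_leI)
      with order_trans[OF correct(3)[OF that] B_le] show ?thesis
        unfolding m by (rule order_trans)
    qed
    ultimately show "let D = session w build_index sample n (input_state l es) in
        lossless_spmf D \<and>
        (\<integral>\<^sup>+ x. of_nat (fst x) \<partial>measure_spmf D) \<le> ennreal (C * real (card (parcs G))) \<and>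
        (\<forall>i<n. (\<integral>\<^sup>+ x. of_nat (snd (snd x ! i)) \<partial>measure_spmf D)
           \<le> ennreal (C * (polymat_dir (card (parcs G)) l P
                / max 1 (real (card (occurrences P G)))))) \<and>
        (\<forall>i<n. map_spmf (\<lambda>x. fst (snd x ! i)) D = uniform_occurrence P G) \<and>
        prob_space.indep_vars (measure_spmf D) (\<lambda>_. count_space UNIV)
          (\<lambda>i x. fst (snd x ! i)) {..<n}"
      unfolding Let_def S_def[symmetric] using correct(1,4,5) by blast
  qed
qed

end
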